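(* Let $G=(V,E,L)$ be a balanced, $\mathcal{M}_{lc}$-connected looped simple graph distinct from $K_1^{[3]}$. Then $G$ has an admissible edge or loop, or an admissible node.
   Context: A looped simple graph $G=(V,E,L)$: $E$ is a set of non-loop edges with no parallel edges, $L$ a set of loops (several may be at one vertex). $K_1^{[3]}$ is the graph with one vertex and three loops. $G$ is balanced if for every $X\subseteq V$ with $|X|=2$ each connected component of $G-X$ contains a loop. For $F\subseteq E\cup L$ let $V_F$ be the set of vertices incident to $F$. The matroid $\mathcal{M}_{lc}(G)$ on $E\cup L$ has independent sets those $F$ with $|F'|\le 2|V_{F'}|$ for all $F'\subseteq F$ and $|F'|\le 2|V_{F'}|-3$ for all nonempty $F'\subseteq F\cap E$; $G$ is $\mathcal{M}_{lc}$-connected if every pair of elements of $E\cup L$ lies in a common circuit of $\mathcal{M}_{lc}(G)$. A node is a vertex incident to exactly three edges or loops (each loop counted once). The $1$-extension operation at an edge $uw\in E$ deletes $uw$ and adds a new vertex $v$, new edges $uv,wv$ and either a new edge $vx$ for some $x\in V\setminus\{u,w\}$ or a new loop at $v$; the $1$-extension at a loop at $u$ deletes that loop and adds a new vertex $v$, a new edge $uv$, a new loop at $v$, and either a new edge $wv$ for some $w\in V-u$ or a second new loop at $v$. A $1$-reduction at a node $v$ is the inverse of such a $1$-extension creating $v$. An edge or loop $f$ is admissible if $G-f$ is $\mathcal{M}_{lc}$-connected; a node $v$ is admissible if some $1$-reduction at $v$ yields an $\mathcal{M}_{lc}$-connected graph.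
   Formalization: The formal theorem also assumes E ∪ L is nonempty and excludes K_1^{[3]} together with isolated vertices; the claim fails for edgeless, loopless graphs on at most two vertices and for K_1^{[3]} plus one isolated vertex. *)

theory Defs
  imports Main
begin

(* A loop is a pair (v, i): the vertex carrying it and a label distinguishing the loops at v. *)

record 'a looped_graph =
  verts :: "'a set"
  edges :: "'a set set"
  loops :: "('a \<times> nat) set"

definition looped_simple_graph :: "'a looped_graph \<Rightarrow> bool" where
  "looped_simple_graph G \<longleftrightarrow>
     finite (verts G) \<and> finite (loops G) \<and>
     (\<forall>e\<in>edges G. e \<subseteq> verts G \<and> card e = 2) \<and>
     (\<forall>(v, i)\<in>loops G. v \<in> verts G)"

type_synonym 'a element = "'a set + 'a \<times> nat"

definition ground :: "'a looped_graph \<Rightarrow> 'a element set" where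
  "ground G = edges G <+> loops G"

fun ends :: "'a element \<Rightarrow> 'a set" where
  "ends (Inl e) = e"
| "ends (Inr (v, i)) = {v}"

definition incident_verts :: "'a element set \<Rightarrow> 'a set" where
  "incident_verts F = (\<Union>f\<in>F. ends f)"

(* The three loops of K1_3 together with an isolated vertex form a balanced and connected graph with
   nothing admissible, so a graph has to be compared with K1_3 up to isolated vertices. *)

definition drop_isolated :: "'a looped_graph \<Rightarrow> 'a looped_graph" where
  "drop_isolated G = G\<lparr>verts := incident_verts (ground G)\<rparr>"

definition is_K1_3 :: "'a looped_graph \<Rightarrow> bool" where
  "is_K1_3 G \<longleftrightarrow> (\<exists>v. verts G = {v} \<and> edges G = {} \<and> loops G \<subseteq> {v} \<times> UNIV \<and> card (loops G) = 3)"

definition delete_verts :: "'a looped_graph \<Rightarrow> 'a set \<Rightarrow> 'a looped_graph" where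
  "delete_verts G X =
     \<lparr>verts = verts G - X, edges = {e \<in> edges G. e \<inter> X = {}}, loops = {(v, i) \<in> loops G. v \<notin> X}\<rparr>"

definition delete_element :: "'a looped_graph \<Rightarrow> 'a element \<Rightarrow> 'a looped_graph" where
  "delete_element G f =
     (case f of Inl e \<Rightarrow> G\<lparr>edges := edges G - {e}\<rparr> | Inr l \<Rightarrow> G\<lparr>loops := loops G - {l}\<rparr>)"

definition adjacency :: "'a looped_graph \<Rightarrow> 'a rel" where
  "adjacency G = {(u, w). u \<noteq> w \<and> {u, w} \<in> edges G}"

definition components :: "'a looped_graph \<Rightarrow> 'a set set" where
  "components G = {(adjacency G)\<^sup>* `` {v} | v. v \<in> verts G}"

definition balanced :: "'a looped_graph \<Rightarrow> bool" where
  "balanced G \<longleftrightarrow>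
     (\<forall>X\<subseteq>verts G. card X = 2 \<longrightarrow>
        (\<forall>C\<in>components (delete_verts G X). \<exists>(v, i)\<in>loops (delete_verts G X). v \<in> C))"

definition mlc_indep :: "'a looped_graph \<Rightarrow> 'a element set \<Rightarrow> bool" where
  "mlc_indep G F \<longleftrightarrow>
     F \<subseteq> ground G \<and>
     (\<forall>F'\<subseteq>F. int (card F') \<le> 2 * int (card (incident_verts F'))) \<and>
     (\<forall>F'\<subseteq>F \<inter> Inl ` edges G. F' \<noteq> {} \<longrightarrow>
        int (card F') \<le> 2 * int (card (incident_verts F')) - 3)"

definition mlc_circuit :: "'a looped_graph \<Rightarrow> 'a element set \<Rightarrow> bool" where
  "mlc_circuit G C \<longleftrightarrow> C \<subseteq> ground G \<and> \<not> mlc_indep G C \<and> (\<forall>D\<subset>C. mlc_indep G D)"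

(* As usual for matroids, only pairs of distinct elements are considered. *)

definition mlc_connected :: "'a looped_graph \<Rightarrow> bool" where
  "mlc_connected G \<longleftrightarrow>
     (\<forall>f\<in>ground G. \<forall>g\<in>ground G. f \<noteq> g \<longrightarrow> (\<exists>C. mlc_circuit G C \<and> f \<in> C \<and> g \<in> C))"

(* G is obtained from H by a 1-extension creating the vertex v. *)

definition edge_one_extension :: "'a looped_graph \<Rightarrow> 'a \<Rightarrow> 'a looped_graph \<Rightarrow> bool" where
  "edge_one_extension H v G \<longleftrightarrow>
     v \<notin> verts H \<and> verts G = insert v (verts H) \<and>
     (\<exists>u w. u \<noteq> w \<and> {u, w} \<in> edges H \<and>
        ((\<exists>x\<in>verts H - {u, w}.
            edges G = (edges H - {{u, w}}) \<union> {{u, v}, {w, v}, {v, x}} \<and> loops G = loops H) \<or>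
         (\<exists>i. edges G = (edges H - {{u, w}}) \<union> {{u, v}, {w, v}} \<and>
            loops G = loops H \<union> {(v, i)})))"

definition loop_one_extension :: "'a looped_graph \<Rightarrow> 'a \<Rightarrow> 'a looped_graph \<Rightarrow> bool" where
  "loop_one_extension H v G \<longleftrightarrow>
     v \<notin> verts H \<and> verts G = insert v (verts H) \<and>
     (\<exists>u i j. (u, i) \<in> loops H \<and>
        ((\<exists>w\<in>verts H - {u}.
            edges G = edges H \<union> {{u, v}, {w, v}} \<and>
            loops G = (loops H - {(u, i)}) \<union> {(v, j)}) \<or>
         (\<exists>k. k \<noteq> j \<and> edges G = edges H \<union> {{u, v}} \<and>
            loops G = (loops H - {(u, i)}) \<union> {(v, j), (v, k)})))"

definition one_reduction :: "'a looped_graph \<Rightarrow> 'a \<Rightarrow> 'a looped_graph \<Rightarrow> bool" where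
  "one_reduction G v H \<longleftrightarrow>
     looped_simple_graph H \<and> (edge_one_extension H v G \<or> loop_one_extension H v G)"

definition is_node :: "'a looped_graph \<Rightarrow> 'a \<Rightarrow> bool" where
  "is_node G v \<longleftrightarrow> v \<in> verts G \<and> card {f \<in> ground G. v \<in> ends f} = 3"

definition admissible_element :: "'a looped_graph \<Rightarrow> 'a element \<Rightarrow> bool" where
  "admissible_element G f \<longleftrightarrow> f \<in> ground G \<and> mlc_connected (delete_element G f)"

definition admissible_node :: "'a looped_graph \<Rightarrow> 'a \<Rightarrow> bool" where
  "admissible_node G v \<longleftrightarrow> is_node G v \<and> (\<exists>H. one_reduction G v H \<and> mlc_connected H)"

end

theory Submission
  imports Defs
begin

text \<open>
  If no edge or loop is admissible, an ear decomposition of the matroid ends with an ear \<open>D\<close> of at least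
  two elements: \<open>D\<close> consists of all elements meeting a vertex set \<open>X\<close>, and \<open>H\<close>, the rest of the graph, is
  empty or connected of full rank \<open>2|Y|\<close> on its vertex set \<open>Y\<close>. Contracting \<open>H\<close> makes \<open>D\<close> a circuit, so every nonempty
  \<open>Z \<subseteq> X\<close> is met by at least \<open>2|Z| + 1\<close> elements, with equality for \<open>X\<close>. Hence \<open>X\<close> contains nodes, and a
  1-reduction at a node \<open>v\<close> of \<open>X\<close> can only be spoiled by a petal (a set with equality in this count,
  joined to \<open>v\<close> by a single edge) or by a critical set of \<open>2|W| - 3\<close> edges.

  Distinct petals of \<open>v\<close> are disjoint and not joined by edges, and a petal of a node contained in another
  set with equality can be shrunk into it; so if all neighbours of all nodes were reached by petals, an infinite descent
  would result. Balancedness excludes two critical sets at one node. The remaining case is a pair of petals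
  blocked by a critical set \<open>W\<close>; then both petals lie in \<open>W\<close>, carry no loops, and for \<open>W\<close> of minimum
  size the descent applies inside one of them.
\<close>

subsection \<open>Counting in a loop-weighted graph\<close>

text \<open>Full rank \<open>2|Y|\<close> of \<open>H\<close>, rather than \<open>2|Y| - 3\<close>,
  is what makes the argument local. An independent subset of \<open>H\<close> of that size exhausts
  the count on \<open>Y\<close>, so any replacement of the ear is judged by counts on
  \<open>X\<close> alone and the surgery never looks inside \<open>H\<close>. Only sets with loops
  reach this rank, so the ears start from a circuit through a loop, which balancedness supplies. The
  obstacle is that an excluded reduction gives only local information: a petal names a neighbour
  that must be an end of the new element, a critical set forbids one pair of neighbours, and a third
  possibility is that the reduction cuts the last link from the ear to \<open>H\<close>. The first
  and third kinds are merged in \<open>center\<close>. The descent turns this into a contradiction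
  by moving petals from one node to the next. An ear with a single vertex outside \<open>H\<close>
  is treated apart: its new edge lies inside \<open>Y\<close> and may already be present, in which
  case that edge is itself admissible.\<close>

locale weighted_graph =
  fixes V :: "'a set" and E :: "'a set set" and lam :: "'a \<Rightarrow> nat"
  assumes finite_V: "finite V"
    and edge_sub: "e \<in> E \<Longrightarrow> e \<subseteq> V"
    and edge_card: "e \<in> E \<Longrightarrow> card e = 2"
begin

definition nbrs :: "'a \<Rightarrow> 'a set" where
  "nbrs v = {w. {v, w} \<in> E}"

definition touching :: "'a set \<Rightarrow> 'a set set" where
  "touching Z = {e \<in> E. e \<inter> Z \<noteq> {}}"

definition touch_count :: "'a set \<Rightarrow> nat" where
  "touch_count Z = card (touching Z) + sum lam Z"

definition inside :: "'a set \<Rightarrow> 'a set set" where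
  "inside W = {e \<in> E. e \<subseteq> W}"

lemma finite_E: "finite E"
  by (rule finite_subset[of _ "Pow V"]) (use edge_sub finite_V in auto)

lemma finite_touching [simp]: "finite (touching Z)"
  using finite_E unfolding touching_def by simp

lemma finite_inside [simp]: "finite (inside W)"
  using finite_E unfolding inside_def by simp

lemma edge_pair: "e \<in> E \<Longrightarrow> \<exists>a b. a \<noteq> b \<and> e = {a, b}"
  using edge_card by (meson card_2_iff)

lemma edge_at: "e \<in> E \<Longrightarrow> v \<in> e \<Longrightarrow> \<exists>w. w \<noteq> v \<and> e = {v, w} \<and> w \<in> nbrs v"
  using edge_pair[of e] unfolding nbrs_def by (auto simp: insert_commute)

lemma nbrs_sym: "w \<in> nbrs v \<longleftrightarrow> v \<in> nbrs w"
  unfolding nbrs_def by (simp add: insert_commute)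

lemma not_nbr_self [simp]: "v \<notin> nbrs v"
  using edge_card[of "{v, v}"] unfolding nbrs_def by auto

lemma nbrs_sub: "nbrs v \<subseteq> V"
  using edge_sub unfolding nbrs_def by auto

lemma finite_nbrs [simp]: "finite (nbrs v)"
  using nbrs_sub finite_V finite_subset by blast

lemma card_star: "card {e \<in> E. v \<in> e \<and> e \<inter> A \<noteq> {}} = card (nbrs v \<inter> A)" if "v \<notin> A"
proof -
  have "{e \<in> E. v \<in> e \<and> e \<inter> A \<noteq> {}} = (\<lambda>w. {v, w}) ` (nbrs v \<inter> A)" (is "?L = ?R")
  proof
    show "?L \<subseteq> ?R"
    proof
      fix e assume e: "e \<in> ?L"
      then obtain w where "w \<noteq> v" "e = {v, w}" "w \<in> nbrs v" using edge_at[of e v] by blast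
      then show "e \<in> ?R" using e that by auto
    qed
    show "?R \<subseteq> ?L" unfolding nbrs_def by auto
  qed
  moreover have "inj_on (\<lambda>w. {v, w}) (nbrs v \<inter> A)"
    by (rule inj_onI) (auto simp: doubleton_eq_iff)
  ultimately show ?thesis by (simp add: card_image)
qed

lemma card_star_all: "card {e \<in> E. v \<in> e} = card (nbrs v)"
proof -
  have "{e \<in> E. v \<in> e} = {e \<in> E. v \<in> e \<and> e \<inter> (V - {v}) \<noteq> {}}"
    using edge_at edge_sub by fastforce
  moreover have "nbrs v \<inter> (V - {v}) = nbrs v" using nbrs_sub by auto
  ultimately show ?thesis using card_star[of v "V - {v}"] by simp
qed

lemma touch_count_single: "touch_count {v} = card (nbrs v) + lam v"
  using card_star_all[of v] unfolding touch_count_def touching_def by simp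

text \<open>Only the edges between \<open>v\<close> and \<open>A\<close> are counted twice. For a
  node the count grows by 3 minus the number of its neighbours in \<open>A\<close>, against 2 in
  \<open>2|A|\<close>; all petal computations rest on this comparison.\<close>

lemma touch_count_insert:
  assumes "v \<notin> A" "finite A"
  shows "touch_count (insert v A) + card (nbrs v \<inter> A) = touch_count A + touch_count {v}"
proof -
  have "touching (insert v A) = touching A \<union> touching {v}" unfolding touching_def by auto
  moreover have "touching A \<inter> touching {v} = {e \<in> E. v \<in> e \<and> e \<inter> A \<noteq> {}}"
    unfolding touching_def by auto
  ultimately have "card (touching (insert v A)) + card (nbrs v \<inter> A) = card (touching A) + card (touching {v})"
    using card_Un_Int[of "touching A" "touching {v}"] card_star[OF assms(1)] by simp
  then show ?thesis using assms unfolding touch_count_def by simp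
qed

lemma inside_insert:
  assumes "v \<notin> W"
  shows "card (inside (insert v W)) = card (inside W) + card (nbrs v \<inter> W)"
proof -
  have "inside (insert v W) = inside W \<union> {e \<in> E. v \<in> e \<and> e \<inter> W \<noteq> {}}" (is "?L = _ \<union> ?B")
  proof
    show "?L \<subseteq> inside W \<union> ?B"
    proof
      fix e assume e: "e \<in> ?L"
      then have eE: "e \<in> E" "e \<subseteq> insert v W" unfolding inside_def by auto
      show "e \<in> inside W \<union> ?B"
      proof (cases "v \<in> e")
        case True
        then obtain w where "w \<noteq> v" "e = {v, w}" using edge_at eE by blast
        then show ?thesis using eE by auto
      qed (use eE in \<open>auto simp: inside_def\<close>)
    qed
    show "inside W \<union> ?B \<subseteq> ?L"
    proof
      fix e assume "e \<in> inside W \<union> ?B"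
      then show "e \<in> ?L"
      proof
        assume e: "e \<in> ?B"
        then obtain w where "w \<noteq> v" "e = {v, w}" using edge_at by blast
        then show ?thesis using e assms unfolding inside_def by auto
      qed (auto simp: inside_def)
    qed
  qed
  moreover have "inside W \<inter> ?B = {}" using assms unfolding inside_def by auto
  ultimately show ?thesis
    using card_Un_disjoint[of "inside W" ?B] card_star[OF assms] finite_E by simp
qed

lemma touch_count_submod:
  assumes "finite A" "finite B"
  shows "touch_count (A \<union> B) + touch_count (A \<inter> B) \<le> touch_count A + touch_count B"
proof -
  have "touching (A \<union> B) = touching A \<union> touching B" unfolding touching_def by auto
  moreover have "card (touching (A \<inter> B)) \<le> card (touching A \<inter> touching B)"
    by (rule card_mono) (simp, auto simp: touching_def)
  ultimately have "card (touching (A \<union> B)) + card (touching (A \<inter> B)) \<le> card (touching A) + card (touching B)"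
    using card_Un_Int[of "touching A" "touching B"] by simp
  then show ?thesis
    using sum.union_inter[OF assms, of lam] unfolding touch_count_def by simp
qed

lemma touch_count_disjoint:
  assumes "finite A" "finite B" "A \<inter> B = {}"
  shows "(\<forall>z\<in>A. nbrs z \<inter> B = {}) \<Longrightarrow> touch_count (A \<union> B) = touch_count A + touch_count B"
    and "\<not> (\<forall>z\<in>A. nbrs z \<inter> B = {}) \<Longrightarrow> touch_count (A \<union> B) < touch_count A + touch_count B"
proof -
  have U: "touching (A \<union> B) = touching A \<union> touching B" unfolding touching_def by auto
  have s: "sum lam (A \<union> B) = sum lam A + sum lam B" using sum.union_disjoint assms by blast
  note c = card_Un_Int[of "touching A" "touching B", simplified, folded U]
  {
    assume n: "\<forall>z\<in>A. nbrs z \<inter> B = {}"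
    have "touching A \<inter> touching B = {}"
    proof (rule ccontr)
      assume "\<not> ?thesis"
      then obtain e z w where e: "e \<in> E" "z \<in> e" "z \<in> A" "w \<in> e" "w \<in> B" unfolding touching_def by auto
      moreover have "z \<noteq> w" using assms e by auto
      ultimately have "w \<in> nbrs z" using edge_at[of e z] by auto
      then show False using n e by auto
    qed
    then show "touch_count (A \<union> B) = touch_count A + touch_count B"
      using c s unfolding touch_count_def by simp
  next
    assume "\<not> (\<forall>z\<in>A. nbrs z \<inter> B = {})"
    then obtain z w where "z \<in> A" "w \<in> B" "{z, w} \<in> E" unfolding nbrs_def by auto
    then have "{z, w} \<in> touching A \<inter> touching B" unfolding touching_def by auto
    then have "card (touching A \<inter> touching B) > 0" by (auto simp: card_gt_0_iff)
    then show "touch_count (A \<union> B) < touch_count A + touch_count B"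
      using c s unfolding touch_count_def by simp
  }
qed

lemma inside_supermod:
  "card (inside A) + card (inside B) \<le> card (inside (A \<union> B)) + card (inside (A \<inter> B))"
proof -
  have "inside A \<inter> inside B = inside (A \<inter> B)" unfolding inside_def by auto
  moreover have "card (inside A \<union> inside B) \<le> card (inside (A \<union> B))"
    by (rule card_mono) (simp, auto simp: inside_def)
  ultimately show ?thesis using card_Un_Int[of "inside A" "inside B"] by simp
qed

text \<open>Edges inside \<open>A\<close> are counted at both ends, all other elements meeting
  \<open>A\<close> once.\<close>

lemma sum_touch_count_single: "finite A \<Longrightarrow> (\<Sum>z\<in>A. touch_count {z}) = touch_count A + card (inside A)"
proof (induction A rule: finite_induct)
  case empty
  have "inside {} = {}" using edge_card unfolding inside_def by fastforce
  then show ?case unfolding touch_count_def touching_def by simp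
next
  case (insert v A)
  then show ?case using touch_count_insert[of v A] inside_insert[of v A] by simp
qed

end

subsection \<open>Nodes, petals and critical sets\<close>

text \<open>Abstract form of the last ear over \<open>H\<close>, where \<open>V - X\<close> are the
  vertices of \<open>H\<close>. \<open>touch_lower\<close> and \<open>touch_X\<close> say that the
  ear is a circuit after contracting \<open>H\<close>; \<open>sparse\<close> holds because loopless
  parts of the ear are proper subsets of a circuit; \<open>three_nbrs\<close> is what remains of
  balancedness; \<open>attached\<close> says that the ear reaches a nonempty
  \<open>H\<close>.\<close>

locale connected_lobe = weighted_graph +
  fixes X :: "'a set"
  assumes X_sub: "X \<subseteq> V"
    and X_large: "2 \<le> card X"
    and touch_lower: "Z \<subseteq> X \<Longrightarrow> Z \<noteq> {} \<Longrightarrow> 2 * card Z + 1 \<le> touch_count Z"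
    and touch_X: "touch_count X = 2 * card X + 1"
    and sparse: "W \<subseteq> V \<Longrightarrow> 2 \<le> card W \<Longrightarrow> card (inside W) + 3 \<le> 2 * card W"
    and three_nbrs: "Z \<subseteq> X \<Longrightarrow> Z \<noteq> {} \<Longrightarrow> (\<And>z. z \<in> Z \<Longrightarrow> lam z = 0) \<Longrightarrow> 3 \<le> card (\<Union> (nbrs ` Z) - Z)"
    and attached: "X = V \<or> (\<exists>e\<in>E. \<not> e \<subseteq> X)"
begin

text \<open>Tightness of the complement: the ear has \<open>2|X| + 1\<close> elements, so those
  avoiding \<open>A\<close> number exactly \<open>2|X - A|\<close>, the most that independence over
  \<open>H\<close> allows. Nodes are the cotight singletons.\<close>

definition cotight :: "'a set \<Rightarrow> bool" where
  "cotight A \<longleftrightarrow> A \<subseteq> X \<and> A \<noteq> {} \<and> touch_count A = 2 * card A + 1"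

definition critical :: "'a set \<Rightarrow> bool" where
  "critical W \<longleftrightarrow> W \<subseteq> V \<and> 2 \<le> card W \<and> card (inside W) + 3 = 2 * card W"

definition node :: "'a \<Rightarrow> bool" where
  "node v \<longleftrightarrow> v \<in> X \<and> touch_count {v} = 3"

text \<open>Such an \<open>A\<close> blocks every 1-reduction at \<open>v\<close> whose new edge or loop avoids \<open>A\<close>.\<close>
definition petal :: "'a \<Rightarrow> 'a set \<Rightarrow> 'a \<Rightarrow> bool" where
  "petal v A r \<longleftrightarrow> cotight A \<and> v \<notin> A \<and> nbrs v \<inter> A = {r}"

text \<open>\<open>f\<close> is the set of ends of the new edge or loop. The conditions say that after the reduction at \<open>v\<close>
  the count on \<open>X - {v}\<close> persists, no edge set is overfull, and the lobe still reaches \<open>V - X\<close>.\<close>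
definition good_reduction :: "'a \<Rightarrow> 'a set \<Rightarrow> bool" where
  "good_reduction v f \<longleftrightarrow>
     (\<forall>A\<subseteq>X - {v}. A \<noteq> {} \<longrightarrow>
        2 * card A + 1 + card (nbrs v \<inter> A) \<le> touch_count A + (if f \<inter> A \<noteq> {} then 1 else 0)) \<and>
     (card f = 2 \<longrightarrow> (\<forall>W. critical W \<longrightarrow> f \<subseteq> W \<longrightarrow> v \<in> W)) \<and>
     (X = V \<or> (\<exists>e\<in>E. \<not> e \<subseteq> X \<and> v \<notin> e) \<or> \<not> f \<subseteq> X)"

lemma finite_X: "finite X"
  using X_sub finite_V finite_subset by blast

lemma finite_sub_X: "A \<subseteq> X \<Longrightarrow> finite A"
  using finite_X finite_subset by blast

lemma finite_sub_V: "A \<subseteq> V \<Longrightarrow> finite A"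
  using finite_V finite_subset by blast

section \<open>Uncrossing and nodes of cotight sets\<close>

lemma cotightI: "A \<subseteq> X \<Longrightarrow> A \<noteq> {} \<Longrightarrow> touch_count A \<le> 2 * card A + 1 \<Longrightarrow> cotight A"
  using touch_lower[of A] unfolding cotight_def by simp

text \<open>The union obeys the lower bound, so submodularity leaves only the minimum value for the
  intersection.\<close>

lemma cotight_Int:
  assumes "cotight A" "cotight B" "A \<inter> B \<noteq> {}"
  shows "cotight (A \<inter> B)"
proof -
  have f: "finite A" "finite B" "A \<subseteq> X" "B \<subseteq> X" using assms finite_sub_X unfolding cotight_def by auto
  have "2 * card (A \<union> B) + 1 \<le> touch_count (A \<union> B)" using f assms by (intro touch_lower) auto
  moreover have "card (A \<union> B) + card (A \<inter> B) = card A + card B" using card_Un_Int f by metis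
  ultimately have "touch_count (A \<inter> B) \<le> 2 * card (A \<inter> B) + 1"
    using touch_count_submod[OF f(1,2)] assms unfolding cotight_def by linarith
  then show ?thesis using f assms by (intro cotightI) auto
qed

text \<open>Without an edge between the two parts their counts would add up to at least
  \<open>2|A| + 2\<close>.\<close>

lemma cotight_connected:
  assumes "cotight A" "B \<subseteq> A" "B \<noteq> {}" "B \<noteq> A"
  shows "\<exists>z\<in>B. \<exists>w\<in>A - B. w \<in> nbrs z"
proof (rule ccontr)
  assume "\<not> ?thesis"
  then have n: "\<forall>z\<in>B. nbrs z \<inter> (A - B) = {}" by auto
  have A: "A \<subseteq> X" "finite A" using assms finite_sub_X unfolding cotight_def by auto
  have fB: "finite B" using A assms finite_subset by blast
  have "touch_count (B \<union> (A - B)) = touch_count B + touch_count (A - B)"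
    using A fB n by (intro touch_count_disjoint(1)) auto
  moreover have "B \<union> (A - B) = A" using assms by auto
  moreover have "2 * card B + 1 \<le> touch_count B" "2 * card (A - B) + 1 \<le> touch_count (A - B)"
    using A assms by (intro touch_lower; auto)+
  moreover have "card A = card B + card (A - B)"
    using A assms by (metis card_Un_disjoint Diff_disjoint fB finite_Diff calculation(2))
  ultimately show False using assms unfolding cotight_def by simp
qed

text \<open>The sum of the single counts is at most
  \<open>(2|A| + 1) + (2|A| - 3) = 4|A| - 2\<close>, so two vertices must fall below 4. One of them
  survives the exclusion of \<open>u\<close>.\<close>

lemma cotight_nodes:
  assumes "cotight A" "2 \<le> card A"
  shows "\<exists>v\<in>A - {u}. node v"
proof (rule ccontr)
  assume n: "\<not> ?thesis"
  have A: "A \<subseteq> X" "finite A" using assms finite_sub_X unfolding cotight_def by auto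
  have ge3: "3 \<le> touch_count {z}" if "z \<in> A" for z
    using touch_lower[of "{z}"] A that by auto
  have ge4: "4 \<le> touch_count {z}" if "z \<in> A - {u}" for z
    using ge3[of z] n that A unfolding node_def by fastforce
  have "4 * card (A - {u}) \<le> (\<Sum>z\<in>A - {u}. touch_count {z})"
    using sum_bounded_below[of "A - {u}" 4 "\<lambda>z. touch_count {z}"] ge4 by simp
  \<comment> \<open>All vertices of \<open>A\<close> but \<open>u\<close> count at least 4;
    \<open>u\<close> itself may count 3, hence the added 1.\<close>
  moreover have "(\<Sum>z\<in>A. touch_count {z}) + 1 \<ge> (\<Sum>z\<in>A - {u}. touch_count {z}) + 4 * (card A - card (A - {u}))"
  proof (cases "u \<in> A")
    case True
    then show ?thesis using A ge3[OF True] sum.remove[of A u "\<lambda>z. touch_count {z}"] by simp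
  qed simp
  ultimately have "4 * card A \<le> (\<Sum>z\<in>A. touch_count {z}) + 1"
    using card_mono[of A "A - {u}"] A by (simp add: Diff_subset)
  also have "\<dots> = touch_count A + card (inside A) + 1" using sum_touch_count_single A by simp
  finally show False using assms sparse[of A] A X_sub unfolding cotight_def by auto
qed

section \<open>Petals of a node and their descent\<close>

lemma petal_sub: "petal v A r \<Longrightarrow> A \<subseteq> X"
  and petal_center: "petal v A r \<Longrightarrow> r \<in> A" "petal v A r \<Longrightarrow> r \<in> nbrs v"
  unfolding petal_def cotight_def by auto

text \<open>The lower bound for \<open>A\<close>, \<open>B\<close> and \<open>v\<close> together
  forces \<open>2|A \<union> B| + 2\<close> elements to meet \<open>A \<union> B\<close>, since
  \<open>v\<close> contributes only one new element. That is the sum of two cotight counts for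
  disjoint sets, so neither an overlap nor a joining edge can be afforded.\<close>

lemma petal_pair:
  assumes v: "node v" and A: "petal v A a" and B: "petal v B b" and ab: "a \<noteq> b"
  shows "A \<inter> B = {}" and "\<forall>z\<in>A. nbrs z \<inter> B = {}"
    and "touch_count (A \<union> B) = 2 * card (A \<union> B) + 2"
proof -
  have AB: "A \<subseteq> X" "B \<subseteq> X" "finite A" "finite B" using A B petal_sub finite_sub_X by auto
  have tA: "touch_count A = 2 * card A + 1" and tB: "touch_count B = 2 * card B + 1"
    using A B unfolding petal_def cotight_def by auto
  have vn: "v \<notin> A \<union> B" "v \<in> X" "touch_count {v} = 3" using A B v unfolding petal_def node_def by auto
  have "nbrs v \<inter> (A \<union> B) = {a, b}" using A B unfolding petal_def by auto
  then have "touch_count (insert v (A \<union> B)) + 2 = touch_count (A \<union> B) + 3"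
    using touch_count_insert[of v "A \<union> B"] AB vn ab by simp
  moreover have "2 * card (insert v (A \<union> B)) + 1 \<le> touch_count (insert v (A \<union> B))"
    using AB vn by (intro touch_lower) auto
  ultimately have low: "2 * card (A \<union> B) + 2 \<le> touch_count (A \<union> B)" using vn AB by simp
  show disj: "A \<inter> B = {}"
  proof (rule ccontr)
    assume "A \<inter> B \<noteq> {}"
    then have "2 * card (A \<inter> B) + 1 \<le> touch_count (A \<inter> B)" using AB by (intro touch_lower) auto
    moreover have "card (A \<union> B) + card (A \<inter> B) = card A + card B" using card_Un_Int AB by metis
    ultimately show False using touch_count_submod[OF AB(3,4)] tA tB low by linarith
  qed
  have c: "card (A \<union> B) = card A + card B" using card_Un_disjoint AB disj by metis
  show no: "\<forall>z\<in>A. nbrs z \<inter> B = {}"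
    using touch_count_disjoint(2)[OF AB(3,4) disj] tA tB low c by linarith
  show "touch_count (A \<union> B) = 2 * card (A \<union> B) + 2"
    using touch_count_disjoint(1)[OF AB(3,4) disj no] tA tB c by linarith
qed

lemma petal_shrink:
  assumes "cotight P" "petal v A r" "r \<in> P"
  shows "petal v (A \<inter> P) r"
  using assms cotight_Int[of A P] unfolding petal_def by blast

text \<open>This moves a petal across \<open>v\<close>: the node adds \<open>3 - 1 = 2\<close> to
  the count of \<open>B\<close>, so \<open>insert v B\<close> stays cotight, and \<open>v\<close> is
  the only neighbour of \<open>a\<close> in it because \<open>A\<close> and \<open>B\<close> are not
  joined. If \<open>a\<close> is a node, the result is a strictly larger petal.\<close>

lemma petal_grow:
  assumes v: "node v" and A: "petal v A a" and B: "petal v B b" and ab: "a \<noteq> b" and a: "a \<in> X"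
  shows "petal a (insert v B) v"
proof -
  note d = petal_pair[OF v A B ab]
  have Bf: "B \<subseteq> X" "finite B" "v \<notin> B" using B finite_sub_X unfolding petal_def cotight_def by auto
  have "nbrs v \<inter> B = {b}" "touch_count B = 2 * card B + 1" using B unfolding petal_def cotight_def by auto
  then have "touch_count (insert v B) = 2 * card (insert v B) + 1"
    using touch_count_insert[of v B] Bf v unfolding node_def by simp
  then have "cotight (insert v B)" using Bf v unfolding node_def cotight_def by auto
  moreover have "a \<notin> insert v B" using d(1) petal_center[OF A] by auto
  moreover have "nbrs a \<inter> insert v B = {v}"
    using d(2) petal_center[OF A] nbrs_sym[of a v] by auto
  ultimately show ?thesis unfolding petal_def by simp
qed

text \<open>A largest petal in \<open>P\<close> forces some node to have a petal whose center is not
  a node, and a smallest petal of that kind contains a smaller one. The vertex \<open>u\<close> is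
  exempt from the hypotheses; in the main application it is the vertex through which the petal
  \<open>P\<close> hangs on an outer node.\<close>

lemma no_petal_descent:
  assumes P: "cotight P" "2 \<le> card P"
    and centers: "\<And>v r. node v \<Longrightarrow> v \<in> P \<Longrightarrow> v \<noteq> u \<Longrightarrow> r \<in> nbrs v \<Longrightarrow> r \<in> P \<Longrightarrow> \<exists>A. petal v A r"
    and two: "\<And>v. node v \<Longrightarrow> v \<in> P \<Longrightarrow> v \<noteq> u \<Longrightarrow> 2 \<le> card (nbrs v \<inter> P)"
  shows False
proof -
  have PX: "P \<subseteq> X" "finite P" using P finite_sub_X unfolding cotight_def by auto
  have inner: "\<exists>A\<subseteq>P. petal v A r" if "node v" "v \<in> P" "v \<noteq> u" "r \<in> nbrs v" "r \<in> P" for v r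
    using centers[OF that] petal_shrink[OF P(1)] that by blast
  define Pi where "Pi = (\<lambda>(v, U). node v \<and> v \<in> P \<and> v \<noteq> u \<and> U \<subseteq> P \<and> (\<exists>r. petal v U r))"
  \<comment> \<open>Sets containing \<open>u\<close> come first, then larger sets.\<close>
  define m where "m = (\<lambda>(v :: 'a, U). (if u \<in> U then card P + 1 else 0) + card U)"
  obtain v0 where v0: "node v0" "v0 \<in> P" "v0 \<noteq> u" using cotight_nodes[OF P, of u] by blast
  have "nbrs v0 \<inter> P \<noteq> {}" using two[OF v0] by auto
  then obtain r0 where "r0 \<in> nbrs v0" "r0 \<in> P" by blast
  then obtain A0 where "A0 \<subseteq> P" "petal v0 A0 r0" using inner v0 by blast
  then have Pi0: "Pi (v0, A0)" using v0 unfolding Pi_def by auto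
  have bound: "m y < 2 * card P + 2" if "Pi y" for y
  proof (cases y)
    case (Pair v U)
    then have "card U \<le> card P" using that card_mono[OF PX(2)] unfolding Pi_def by simp
    then show ?thesis using Pair unfolding m_def by simp
  qed
  have "\<exists>x. Pi x \<and> (\<forall>y. Pi y \<longrightarrow> m y \<le> m x)"
    by (rule ex_has_greatest_nat[of Pi "(v0, A0)" m "2 * card P + 2"]) (use bound Pi0 in blast)+
  then obtain x where "Pi x" and mx: "\<forall>y. Pi y \<longrightarrow> m y \<le> m x" by blast
  then obtain v U b where v: "node v" "v \<in> P" "v \<noteq> u" and U: "U \<subseteq> P" "petal v U b"
    and x: "x = (v, U)"
    unfolding Pi_def by (cases x) auto
  have mvU: "m (v', U') \<le> m (v, U)" if "Pi (v', U')" for v' U'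
    using mx that unfolding x by blast
  have "\<not> nbrs v \<inter> P \<subseteq> {b}" using two[OF v] card_mono[of "{b}" "nbrs v \<inter> P"] by auto
  then obtain a where a: "a \<in> nbrs v" "a \<in> P" "a \<noteq> b" by auto
  obtain A where A: "A \<subseteq> P" "petal v A a" using inner v a by blast
  have disj: "A \<inter> U = {}" by (rule petal_pair(1)[OF v(1) A(2) U(2) a(3)])
  have cU: "card U \<le> card P" by (rule card_mono[OF PX(2) U(1)])
  \<comment> \<open>Petals at the same node are disjoint, so \<open>u\<close> in \<open>A\<close>
    would make \<open>A\<close> the better choice under \<open>m\<close>.\<close>
  have uA: "u \<notin> A"
  proof
    assume "u \<in> A"
    moreover have "Pi (v, A)" using v A unfolding Pi_def by auto
    moreover have "card A > 0" using \<open>u \<in> A\<close> A PX by (auto simp: card_gt_0_iff intro: finite_subset)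
    moreover have "u \<notin> U" using \<open>u \<in> A\<close> disj by blast
    ultimately show False using mvU[of v A] cU unfolding m_def by auto
  qed
  \<comment> \<open>If \<open>a\<close> were a node, \<open>petal_grow\<close> would enlarge
    \<open>U\<close> by \<open>v\<close> and keep \<open>u\<close> if present, against the choice of
    \<open>x\<close>.\<close>
  have na: "\<not> node a"
  proof
    assume node: "node a"
    have g: "petal a (insert v U) v" by (rule petal_grow[OF v(1) A(2) U(2) a(3)]) (use a PX in blast)
    have "a \<noteq> u" using uA petal_center[OF A(2)] by auto
    then have "Pi (a, insert v U)" using g node a U v unfolding Pi_def by auto
    from mvU[OF this] have "m (a, insert v U) \<le> m (v, U)" .
    moreover have "card (insert v U) = card U + 1"
      using U finite_subset[OF U(1) PX(2)] unfolding petal_def by simp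
    ultimately show False using v unfolding m_def by (auto split: if_splits)
  qed
  \<comment> \<open>Excluding \<open>u\<close> from the petal keeps every node found inside it
    subject to the hypotheses.\<close>
  define Qi where "Qi = (\<lambda>(v, A). node v \<and> v \<in> P \<and> v \<noteq> u \<and> A \<subseteq> P \<and> u \<notin> A \<and> (\<exists>r. petal v A r \<and> \<not> node r))"
  have "Qi (v, A)" using v A uA na unfolding Qi_def by auto
  then have "\<exists>y. Qi y \<and> (\<forall>z. Qi z \<longrightarrow> card (snd y) \<le> card (snd z))"
    by (rule ex_has_least_nat)
  then obtain y where "Qi y" and my: "\<forall>z. Qi z \<longrightarrow> card (snd y) \<le> card (snd z)" by blast
  then obtain w B r where w: "node w" "w \<in> P" "w \<noteq> u" and B: "B \<subseteq> P" "u \<notin> B" "petal w B r" "\<not> node r"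
    and y: "y = (w, B)"
    unfolding Qi_def by (cases y) auto
  have least: "card B \<le> card B'" if "Qi (w', B')" for w' B'
    using my that unfolding y by fastforce
  have cB: "cotight B" using B unfolding petal_def by simp
  have rB: "r \<in> B" using petal_center[OF B(3)] by simp
  have fB: "finite B" using B PX finite_subset by blast
  have "card B \<noteq> 1"
  proof
    assume "card B = 1"
    then have "B = {r}" using rB card_1_singletonE by blast
    then have "node r" using cB PX B unfolding cotight_def node_def by auto
    then show False using B by simp
  qed
  moreover have "card B > 0" using rB fB by (auto simp: card_gt_0_iff)
  ultimately have "2 \<le> card B" by linarith
  then have "{z \<in> B. node z} \<noteq> {}" using cotight_nodes[OF cB] by blast
  moreover have "{z \<in> B. node z} \<noteq> B" using rB B(4) by blast
  \<comment> \<open>Connectedness of \<open>B\<close> yields an edge from a node to a non-node. The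
    petal of \<open>z\<close> at \<open>z'\<close>, intersected with \<open>B\<close>, misses
    \<open>z\<close> and is therefore smaller.\<close>
  ultimately obtain z z' where z: "z \<in> B" "node z" and z': "z' \<in> B" "\<not> node z'" "z' \<in> nbrs z"
    using cotight_connected[OF cB, of "{z \<in> B. node z}"] by auto
  have zP: "z \<in> P" "z \<noteq> u" "z' \<in> P" using z z' B by auto
  obtain B' where "petal z B' z'" using centers[OF z(2) zP(1,2) z'(3) zP(3)] by blast
  then have B': "petal z (B' \<inter> B) z'" by (rule petal_shrink[OF cB _ z'(1)])
  then have "Qi (z, B' \<inter> B)" using z z' zP B unfolding Qi_def by auto
  then have "card B \<le> card (B' \<inter> B)" by (rule least)
  moreover have "card (B' \<inter> B) < card B"
    using B' z fB unfolding petal_def by (intro psubset_card_mono) auto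
  ultimately show False by simp
qed

text \<open>Equality in the count forces every element meeting \<open>A\<close> to be one of the edges in \<open>F\<close>.\<close>
lemma absorb:
  assumes A: "A \<subseteq> X" "A \<noteq> {}" and tA: "touch_count A \<le> 2 * card A + k"
    and F: "F \<subseteq> touching A" "\<And>e. e \<in> F \<Longrightarrow> e \<inter> (A - W) = {}"
    and cF: "2 * card (A \<inter> W) + k \<le> card F"
  shows "A \<subseteq> W" and "touching A = F" and "\<forall>z\<in>A. lam z = 0"
proof -
  have fA: "finite A" using A finite_sub_X by blast
  have fF: "finite F" using F(1) finite_touching finite_subset by blast
  have cA: "card A = card (A \<inter> W) + card (A - W)"
    by (rule card_Int_Diff[OF fA])
  have dis: "touching (A - W) \<inter> F = {}" using F(2) unfolding touching_def by blast
  have "touching (A - W) \<union> F \<subseteq> touching A" using F(1) unfolding touching_def by auto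
  then have "card (touching (A - W)) + card F \<le> card (touching A)"
    using card_mono[OF finite_touching, of "touching (A - W) \<union> F" A] card_Un_disjoint[OF finite_touching fF dis] by simp
  moreover have "sum lam (A - W) \<le> sum lam A" by (rule sum_mono2) (use fA in auto)
  ultimately have le: "touch_count (A - W) + card F \<le> touch_count A" unfolding touch_count_def by simp
  \<comment> \<open>The elements meeting \<open>A - W\<close> are disjoint from \<open>F\<close>, so
    at most \<open>2|A - W|\<close> of them are left, one fewer than the lower bound for a nonempty
    set.\<close>
  show AW: "A \<subseteq> W"
  proof (rule ccontr)
    assume "\<not> A \<subseteq> W"
    then have "2 * card (A - W) + 1 \<le> touch_count (A - W)" using A by (intro touch_lower) auto
    then show False using le cF cA tA by simp
  qed
  then have "A \<inter> W = A" by auto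
  then have "touch_count A \<le> card F" using tA cF by simp
  then have "card (touching A) \<le> card F" "sum lam A = 0"
    using card_mono[OF finite_touching F(1)] unfolding touch_count_def by auto
  then show "touching A = F" "\<forall>z\<in>A. lam z = 0"
    using card_seteq[OF finite_touching F(1)] fA by auto
qed

section \<open>Critical sets\<close>

text \<open>Supermodularity of induced edges forces union and intersection to attain the sparsity
  bound. Two common vertices are needed for that bound to apply to the intersection.\<close>

lemma critical_Un_Int:
  assumes "critical W" "critical W'" "2 \<le> card (W \<inter> W')"
  shows "critical (W \<union> W')" and "critical (W \<inter> W')"
proof -
  have WV: "W \<subseteq> V" "W' \<subseteq> V" "finite W" "finite W'" using assms finite_sub_V unfolding critical_def by auto
  have c: "card (W \<union> W') + card (W \<inter> W') = card W + card W'" using card_Un_Int WV by metis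
  have ge: "2 \<le> card (W \<union> W')" using assms card_mono[of "W \<union> W'" W] WV unfolding critical_def by auto
  have "card (inside (W \<union> W')) + 3 \<le> 2 * card (W \<union> W')" using WV ge by (intro sparse) auto
  moreover have "card (inside (W \<inter> W')) + 3 \<le> 2 * card (W \<inter> W')" using WV assms by (intro sparse) auto
  ultimately have "card (inside (W \<union> W')) + 3 = 2 * card (W \<union> W')"
    "card (inside (W \<inter> W')) + 3 = 2 * card (W \<inter> W')"
    using inside_supermod[of W W'] c assms unfolding critical_def by linarith+
  then show "critical (W \<union> W')" "critical (W \<inter> W')" using WV ge assms unfolding critical_def by auto
qed

text \<open>The weaker constant admits single vertices, for which \<open>2|W| - 3\<close> is
  negative.\<close>

lemma inside_le:
  assumes "W \<subseteq> V" "W \<noteq> {}"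
  shows "card (inside W) + 2 \<le> 2 * card W"
proof (cases "2 \<le> card W")
  case True
  then show ?thesis using sparse[OF assms(1)] by simp
next
  case False
  moreover have "card W \<noteq> 0" using assms finite_sub_V by simp
  ultimately have "card W = 1" by linarith
  then obtain w where "W = {w}" by (rule card_1_singletonE)
  have "False" if "e \<in> E" "e \<subseteq> {w}" for e
    using card_mono[OF _ that(2)] edge_card[OF that(1)] by simp
  then have "inside W = {}" unfolding inside_def \<open>W = {w}\<close> by blast
  then show ?thesis using \<open>W = {w}\<close> by simp
qed

text \<open>Otherwise all \<open>2|W| - 3\<close> edges would lie on one vertex less, where at most
  \<open>2|W| - 4\<close> fit.\<close>

lemma critical_nbr:
  assumes W: "critical W" and w: "w \<in> W"
  shows "\<exists>z\<in>W. z \<in> nbrs w"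
proof (rule ccontr)
  assume "\<not> ?thesis"
  then have n: "nbrs w \<inter> (W - {w}) = {}" by auto
  have WV: "W \<subseteq> V" "finite W" using W finite_sub_V unfolding critical_def by auto
  have "card (W - {w}) + 1 = card W" using w WV by (metis Suc_eq_plus1 card_Suc_Diff1)
  moreover have "card (inside W) = card (inside (W - {w}))"
    using inside_insert[of w "W - {w}"] n w by (simp add: insert_absorb)
  moreover have "W - {w} \<noteq> {}"
    using W calculation(1) unfolding critical_def by (metis card.empty add_0 not_less_eq_eq numeral_2_eq_2 Suc_eq_plus1 order_refl)
  ultimately show False using inside_le[of "W - {w}"] WV W unfolding critical_def by auto
qed

text \<open>Three edges from \<open>v\<close> would give \<open>2|W|\<close> edges on
  \<open>|W| + 1\<close> vertices, one above the bound.\<close>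

lemma critical_not_overfull:
  assumes "critical W" "v \<in> V" "v \<notin> W" "3 \<le> card (nbrs v \<inter> W)"
  shows False
proof -
  have WV: "W \<subseteq> V" "finite W" using assms finite_sub_V unfolding critical_def by auto
  have "card (inside (insert v W)) + 3 \<le> 2 * card (insert v W)"
    using assms WV unfolding critical_def by (intro sparse) auto
  then show False using inside_insert[of v W] assms WV unfolding critical_def by auto
qed

section \<open>Two petals blocked by a critical set\<close>

text \<open>The petals force the new element of a reduction at \<open>v\<close> to meet both
  \<open>P\<close> and \<open>Q\<close>, which leaves only the edge \<open>uw\<close>;
  \<open>W\<close> excludes that one.\<close>

definition blocked_pair :: "'a \<Rightarrow> 'a \<Rightarrow> 'a \<Rightarrow> 'a set \<Rightarrow> 'a set \<Rightarrow> 'a set \<Rightarrow> bool" where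
  "blocked_pair v u w P Q W \<longleftrightarrow> node v \<and> u \<noteq> w \<and> petal v P u \<and> petal v Q w \<and>
     critical W \<and> u \<in> W \<and> w \<in> W \<and> v \<notin> W"

text \<open>In the second alternative \<open>{v, r}\<close> is the only edge leaving \<open>X\<close>, so that a reduction at \<open>v\<close> with new edge inside \<open>X\<close>
  would cut the lobe off.\<close>
definition center :: "'a \<Rightarrow> 'a \<Rightarrow> bool" where
  "center v r \<longleftrightarrow> (\<exists>A. petal v A r) \<or> (r \<notin> X \<and> (\<forall>e\<in>E. \<not> e \<subseteq> X \<longrightarrow> e = {v, r}))"

lemma blocked_pair_sym: "blocked_pair v u w P Q W \<Longrightarrow> blocked_pair v w u Q P W"
  unfolding blocked_pair_def by auto

lemma critical_subD: "critical W \<Longrightarrow> W \<subseteq> V" "critical W \<Longrightarrow> finite W"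
  using finite_sub_V unfolding critical_def by auto

text \<open>No edge joins \<open>P\<close> to \<open>Q\<close>, so all edges of \<open>W\<close> lie
  in \<open>W - Q\<close> or \<open>W - P\<close>. Two sparse pieces overlapping in at most one
  vertex carry at most \<open>2|W| - 4\<close> edges.\<close>

lemma blocked_pair_remainder:
  assumes b: "blocked_pair v u w P Q W"
  shows "2 \<le> card (W - (P \<union> Q))"
proof (rule ccontr)
  let ?R = "W - (P \<union> Q)"
  assume "\<not> ?thesis"
  then have R1: "card ?R \<le> 1" by simp
  have b': "node v" "u \<noteq> w" "petal v P u" "petal v Q w" "critical W" "u \<in> W" "w \<in> W" "v \<notin> W"
    using b unfolding blocked_pair_def by auto
  note pp = petal_pair[OF b'(1,3,4,2)]
  have uw: "u \<in> P" "w \<in> Q" using b' petal_center by auto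
  have W: "W \<subseteq> V" "finite W" using b' critical_subD by auto
  have "inside W \<subseteq> inside (W - Q) \<union> inside (W - P)"
  proof
    fix e assume e: "e \<in> inside W"
    then have eE: "e \<in> E" "e \<subseteq> W" unfolding inside_def by auto
    show "e \<in> inside (W - Q) \<union> inside (W - P)"
    proof (rule ccontr)
      assume "\<not> ?thesis"
      then obtain z y where zy: "z \<in> e" "z \<in> Q" "y \<in> e" "y \<in> P" using eE unfolding inside_def by auto
      moreover have "z \<noteq> y" using zy pp(1) by auto
      ultimately have "z \<in> nbrs y" using edge_at[OF eE(1) zy(3)] by auto
      then show False using pp(2) zy by auto
    qed
  qed
  then have "card (inside W) \<le> card (inside (W - Q) \<union> inside (W - P))"
    by (intro card_mono) auto
  also have "\<dots> \<le> card (inside (W - Q)) + card (inside (W - P))" by (rule card_Un_le)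
  finally have le: "card (inside W) \<le> card (inside (W - Q)) + card (inside (W - P))" .
  have "(W - Q) \<union> (W - P) = W" "(W - Q) \<inter> (W - P) = ?R" using pp(1) by auto
  then have c: "card W + card ?R = card (W - Q) + card (W - P)"
    using card_Un_Int[of "W - Q" "W - P"] W by simp
  show False
  proof (cases "?R = {}")
    case True
    \<comment> \<open>A side may be a single vertex, hence the constant 2; without overlap it still
      gives \<open>2|W| - 4\<close>.\<close>
    have "card (inside (W - Q)) + 2 \<le> 2 * card (W - Q)" "card (inside (W - P)) + 2 \<le> 2 * card (W - P)"
      using W b' uw pp(1) by (intro inside_le; auto)+
    then show False using le c True b'(5) unfolding critical_def by simp
  next
    case False
    then obtain y where y: "y \<in> W" "y \<notin> P" "y \<notin> Q" by auto
    have "card {u, y} \<le> card (W - Q)" "card {w, y} \<le> card (W - P)"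
      using W b' uw pp(1) y by (intro card_mono; auto)+
    moreover have "u \<noteq> y" "w \<noteq> y" using uw y by auto
    ultimately have "card (inside (W - Q)) + 3 \<le> 2 * card (W - Q)" "card (inside (W - P)) + 3 \<le> 2 * card (W - P)"
      using W by (intro sparse; auto)+
    then show False using le c R1 b'(5) unfolding critical_def by simp
  qed
qed

lemma inside_split: "card (inside W) = card (inside (W - A)) + card {e \<in> inside W. e \<inter> A \<noteq> {}}"
proof -
  have "inside W = inside (W - A) \<union> {e \<in> inside W. e \<inter> A \<noteq> {}}"
    "inside (W - A) \<inter> {e \<in> inside W. e \<inter> A \<noteq> {}} = {}"
    unfolding inside_def by auto
  then show ?thesis by (metis (no_types, lifting) card_Un_disjoint finite_Un finite_inside)
qed

text \<open>The remainder is sparse, so at least \<open>2|(P \<union> Q) \<inter> W|\<close> edges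
  of \<open>W\<close> meet the petals. With \<open>vu\<close> and \<open>vw\<close> they use up the
  whole count \<open>2|P \<union> Q| + 2\<close>, and \<open>absorb\<close> applies with
  \<open>k = 2\<close>. Equality everywhere then shows that removing one or both petals keeps
  \<open>W\<close> critical.\<close>

lemma blocked_pair_structure:
  assumes b: "blocked_pair v u w P Q W"
  shows "P \<union> Q \<subseteq> W"
    and "\<forall>z\<in>P \<union> Q. lam z = 0"
    and "\<forall>z\<in>P \<union> Q. nbrs z \<subseteq> insert v W"
    and "critical (W - (P \<union> Q))"
    and "critical (W - Q)"
proof -
  let ?A = "P \<union> Q" and ?R = "W - (P \<union> Q)"
  have b': "node v" "u \<noteq> w" "petal v P u" "petal v Q w" "critical W" "u \<in> W" "w \<in> W" "v \<notin> W"
    using b unfolding blocked_pair_def by auto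
  note pp = petal_pair[OF b'(1,3,4,2)]
  have uw: "u \<in> P" "w \<in> Q" "u \<in> nbrs v" "w \<in> nbrs v" using b' petal_center by auto
  have vA: "v \<notin> ?A" using b' unfolding petal_def by auto
  have W: "W \<subseteq> V" "finite W" using b' critical_subD by auto
  have A: "?A \<subseteq> X" using petal_sub[OF b'(3)] petal_sub[OF b'(4)] by simp
  let ?In = "{e \<in> inside W. e \<inter> ?A \<noteq> {}}"
  let ?F = "?In \<union> {{v, u}, {v, w}}"
  have R2: "2 \<le> card ?R" by (rule blocked_pair_remainder[OF b])
  have sR: "card (inside ?R) + 3 \<le> 2 * card ?R" using W R2 by (intro sparse) auto
  have cW: "card W = card ?R + card (?A \<inter> W)"
    using card_Int_Diff[OF W(2), of ?A] by (simp add: Int_commute)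
  have F0c: "2 * card (?A \<inter> W) \<le> card ?In"
    using inside_split[of W ?A] sR cW b'(5) unfolding critical_def by linarith
  have nin: "{v, u} \<notin> ?In" "{v, w} \<notin> ?In" "{v, u} \<noteq> {v, w}"
    using b' unfolding inside_def by (auto simp: doubleton_eq_iff)
  have fF0: "finite ?In" by simp
  have cF: "card ?F = card ?In + 2" using nin fF0 by simp
  have FA: "?F \<subseteq> touching ?A" using uw unfolding touching_def inside_def nbrs_def by auto
  have Fd: "e \<inter> (?A - W) = {}" if "e \<in> ?F" for e
    using that b' vA unfolding inside_def by auto
  have "?A \<noteq> {}" "touch_count ?A \<le> 2 * card ?A + 2" "2 * card (?A \<inter> W) + 2 \<le> card ?F"
    using uw pp(3) F0c cF by auto
  note ab = absorb[OF A this(1,2) FA Fd this(3)]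
  show AW: "?A \<subseteq> W" by (rule ab(1))
  show l0: "\<forall>z\<in>?A. lam z = 0" by (rule ab(3))
  show "\<forall>z\<in>?A. nbrs z \<subseteq> insert v W"
  proof (intro ballI subsetI)
    fix z y assume z: "z \<in> ?A" "y \<in> nbrs z"
    then have "{z, y} \<in> touching ?A" unfolding touching_def nbrs_def by auto
    then have "{z, y} \<in> ?F" using ab(2) by simp
    then show "y \<in> insert v W" using z vA unfolding inside_def by (auto simp: doubleton_eq_iff)
  qed
  have AiW: "?A \<inter> W = ?A" using AW by auto
  have "card ?F = touch_count ?A" using ab(2) l0 unfolding touch_count_def by simp
  then have "card ?In = 2 * card (?A \<inter> W)" using cF pp(3) AiW by simp
  then have "card (inside ?R) + 3 = 2 * card ?R"
    using inside_split[of W ?A] cW b'(5) unfolding critical_def by linarith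
  then show "critical ?R" using R2 W unfolding critical_def by auto
  have "touching Q = {e \<in> inside W. e \<inter> Q \<noteq> {}} \<union> {{v, w}}" (is "_ = ?G \<union> _")
  proof -
    have "touching Q = {e \<in> touching ?A. e \<inter> Q \<noteq> {}}" unfolding touching_def by auto
    also have "\<dots> = {e \<in> ?F. e \<inter> Q \<noteq> {}}" using ab(2) by simp
    also have "\<dots> = ?G \<union> {{v, w}}" using uw vA pp(1) by auto
    finally show ?thesis .
  qed
  moreover have "{v, w} \<notin> ?G" using nin(2) by auto
  ultimately have "card (touching Q) = card ?G + 1" by simp
  moreover have "card (touching Q) = 2 * card Q + 1"
    using l0 b'(4) unfolding petal_def cotight_def touch_count_def by simp
  ultimately have "card ?G = 2 * card Q" by simp
  moreover have "card W = card (W - Q) + card Q"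
    using card_Int_Diff[OF W(2), of Q] AW by (simp add: Int_absorb1)
  ultimately have "card (inside (W - Q)) + 3 = 2 * card (W - Q)"
    using inside_split[of W Q] b'(5) unfolding critical_def by linarith
  moreover have "card ?R \<le> card (W - Q)" using W by (intro card_mono) auto
  ultimately show "critical (W - Q)" using W R2 unfolding critical_def by auto
qed

text \<open>Two pairs of neighbours are excluded by critical sets, the third by any obstruction. In
  the petal case counting only shrinks the configuration to \<open>v\<close> and \<open>r\<close>
  hanging on \<open>p\<close> and \<open>q\<close>; balancedness forbids what is left.\<close>

lemma two_critical_pairs:
  assumes v: "node v" "lam v = 0" and N: "nbrs v = {p, q, r}" and d: "p \<noteq> q" "p \<noteq> r" "q \<noteq> r"
    and W1: "critical W1" "p \<in> W1" "r \<in> W1" "v \<notin> W1"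
    and W2: "critical W2" "q \<in> W2" "r \<in> W2" "v \<notin> W2"
    and pq: "center v r \<or> (\<exists>W. critical W \<and> p \<in> W \<and> q \<in> W \<and> v \<notin> W)"
  shows False
proof -
  have vV: "v \<in> V" "v \<in> X" using v X_sub unfolding node_def by auto
  have not_all: False if "critical W" "v \<notin> W" "p \<in> W" "q \<in> W" "r \<in> W" for W
    using critical_not_overfull[OF that(1) vV(1) that(2)] that N d by auto
  \<comment> \<open>A second common vertex would make \<open>A \<union> B\<close> critical, although
    it contains all three neighbours of \<open>v\<close>.\<close>
  have meet1: "A \<inter> B = {c}" if "critical A" "critical B" "c \<in> A" "c \<in> B" "{p, q, r} \<subseteq> A \<union> B" "v \<notin> A" "v \<notin> B"
    for A B c
  proof (rule ccontr)
    assume ne: "A \<inter> B \<noteq> {c}"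
    have "c \<in> A \<inter> B" using that by simp
    with ne obtain c' where c': "c' \<in> A \<inter> B" "c' \<noteq> c" by blast
    have "card {c, c'} \<le> card (A \<inter> B)" using that c' critical_subD by (intro card_mono) auto
    then have "critical (A \<union> B)" using that c' by (intro critical_Un_Int) auto
    then show False using not_all[of "A \<union> B"] that by auto
  qed
  have r12: "W1 \<inter> W2 = {r}" using W1 W2 by (intro meet1) auto
  have f12: "finite W1" "finite W2" "W1 \<subseteq> V" "W2 \<subseteq> V" using W1 W2 critical_subD by auto
  have c12: "card (W1 \<union> W2) + 1 = card W1 + card W2" using card_Un_Int[OF f12(1,2)] r12 by simp
  have no_single: "inside {c} = {}" for c
    using edge_pair unfolding inside_def by fastforce
  have i12: "inside W1 \<inter> inside W2 = {}"
  proof -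
    have "inside W1 \<inter> inside W2 = inside (W1 \<inter> W2)" unfolding inside_def by auto
    then show ?thesis using r12 no_single by simp
  qed
  have rnbr1: "\<exists>z\<in>W1. z \<in> nbrs r" and rnbr2: "\<exists>z\<in>W2. z \<in> nbrs r"
    using critical_nbr W1 W2 by auto
  consider (petal) A where "petal v A r"
    | (cut) "r \<notin> X" "\<forall>e\<in>E. \<not> e \<subseteq> X \<longrightarrow> e = {v, r}"
    | (crit) W3 where "critical W3" "p \<in> W3" "q \<in> W3" "v \<notin> W3"
    using pq unfolding center_def by blast
  then show False
  proof cases
    case cut
    obtain z where z: "z \<in> W1" "z \<in> nbrs r" using rnbr1 by auto
    then have "{r, z} \<in> E" unfolding nbrs_def by simp
    then have "{r, z} = {v, r}" using cut by auto
    then show False using z W1 by (auto simp: doubleton_eq_iff)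
  next
    case crit
    \<comment> \<open>Three critical sets meeting pairwise in single vertices form a critical set,
      like three bars forming a triangle: \<open>-9 + 2 * 3 = -3\<close>.\<close>
    have p13: "W1 \<inter> W3 = {p}" and q23: "W2 \<inter> W3 = {q}" using W1 W2 crit by (intro meet1; auto)+
    have f3: "finite W3" "W3 \<subseteq> V" using crit critical_subD by auto
    have int: "(W1 \<union> W2) \<inter> W3 = {p, q}" using p13 q23 by auto
    have c: "card (W1 \<union> W2 \<union> W3) + 2 = card (W1 \<union> W2) + card W3"
      using card_Un_Int[of "W1 \<union> W2" W3] f12 f3 int d by simp
    have "inside W1 \<inter> inside W3 = inside {p}" "inside W2 \<inter> inside W3 = inside {q}"
      using p13 q23 unfolding inside_def by auto
    then have i3: "(inside W1 \<union> inside W2) \<inter> inside W3 = {}" using no_single by auto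
    have "card (inside W1) + card (inside W2) + card (inside W3) = card (inside W1 \<union> inside W2 \<union> inside W3)"
      using card_Un_disjoint[OF _ _ i3] card_Un_disjoint[OF _ _ i12] by simp
    also have "\<dots> \<le> card (inside (W1 \<union> W2 \<union> W3))" by (intro card_mono) (simp, auto simp: inside_def)
    finally have ge: "2 * card (W1 \<union> W2 \<union> W3) \<le> card (inside (W1 \<union> W2 \<union> W3)) + 3"
      using c c12 W1(1) W2(1) crit(1) unfolding critical_def by linarith
    have "card W1 \<le> card (W1 \<union> W2 \<union> W3)" using f12 f3 by (intro card_mono) auto
    then have big: "2 \<le> card (W1 \<union> W2 \<union> W3)" using W1(1) unfolding critical_def by linarith
    have "card (inside (W1 \<union> W2 \<union> W3)) + 3 \<le> 2 * card (W1 \<union> W2 \<union> W3)" using f12 f3 big by (intro sparse) auto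
    then have "critical (W1 \<union> W2 \<union> W3)" using ge big f12 f3 unfolding critical_def by auto
    then show False using not_all[of "W1 \<union> W2 \<union> W3"] W1 W2 crit by auto
  next
    case petal
    have A: "A \<subseteq> X" "A \<noteq> {}" "touch_count A \<le> 2 * card A + 1" "v \<notin> A" "nbrs v \<inter> A = {r}"
      using petal unfolding petal_def cotight_def by auto
    have rA: "r \<in> A" "p \<notin> A" "q \<notin> A" "{v, r} \<in> E" using A(5) N d nbrs_def by blast+
    \<comment> \<open>If \<open>B - A\<close> had a second vertex, \<open>absorb\<close> would list
      the elements meeting \<open>A\<close> as \<open>vr\<close> and edges inside \<open>B\<close>;
      but \<open>r\<close> has a further neighbour in the other critical set.\<close>
    have only: "B - A = {c}"
      if B: "critical B" "c \<in> B" "r \<in> B" "v \<notin> B" "c \<notin> A" and B': "B \<inter> B' = {r}" "\<exists>z\<in>B'. z \<in> nbrs r" "v \<notin> B'"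
      for B B' c
    proof (rule ccontr)
      assume ne: "B - A \<noteq> {c}"
      have fB: "finite B" "B \<subseteq> V" using B critical_subD by auto
      from ne B obtain c' where c': "c' \<in> B - A" "c' \<noteq> c" by blast
      have "card {c, c'} \<le> card (B - A)" using fB c' B by (intro card_mono) auto
      then have "card (inside (B - A)) + 3 \<le> 2 * card (B - A)" using c' fB by (intro sparse) auto
      moreover have "card B = card (B - A) + card (A \<inter> B)"
        using card_Int_Diff[OF fB(1), of A] by (simp add: Int_commute)
      ultimately have c0: "2 * card (A \<inter> B) \<le> card {e \<in> inside B. e \<inter> A \<noteq> {}}" (is "_ \<le> card ?In")
        using inside_split[of B A] B(1) unfolding critical_def by linarith
      let ?F = "insert {v, r} ?In"
      have "{v, r} \<notin> ?In" using B unfolding inside_def by auto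
      then have cF: "2 * card (A \<inter> B) + 1 \<le> card ?F" using c0 by simp
      have "?F \<subseteq> touching A" using rA unfolding touching_def inside_def by auto
      moreover have "e \<inter> (A - B) = {}" if "e \<in> ?F" for e using that B A unfolding inside_def by auto
      ultimately have t: "touching A = ?F" using absorb(2)[OF A(1,2,3) _ _ cF] by blast
      obtain z where z: "z \<in> B'" "z \<in> nbrs r" using B' by blast
      then have "{r, z} \<in> touching A" using rA unfolding touching_def nbrs_def by auto
      then have "z = v \<or> z \<in> B" unfolding t inside_def by (auto simp: doubleton_eq_iff)
      then have "z \<in> B \<inter> B'" using z(1) B'(3) by blast
      then have "z = r" unfolding B'(1) by simp
      then show False using z(2) by simp
    qed
    have W1A: "W1 - A = {p}" by (rule only[OF W1(1,2,3,4) rA(2) r12 rnbr2 W2(4)])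
    have W2A: "W2 - A = {q}"
      using only[OF W2(1,2,3,4) rA(3) _ rnbr1 W1(4)] r12 by (simp add: Int_commute)
    let ?W = "W1 \<union> W2" and ?In = "inside W1 \<union> inside W2"
    let ?F = "insert {v, r} ?In"
    have touch_in: "e \<inter> A \<noteq> {}" if "e \<in> E" "e \<subseteq> B" "B - A = {c}" for e B c
    proof
      assume "e \<inter> A = {}"
      then have "e \<subseteq> {c}" using that by auto
      then show False using no_single[of c] that unfolding inside_def by auto
    qed
    have FA: "?F \<subseteq> touching A"
      using rA touch_in[OF _ _ W1A] touch_in[OF _ _ W2A] unfolding touching_def inside_def by auto
    have Fd: "e \<inter> (A - ?W) = {}" if "e \<in> ?F" for e using that W1 A(4) unfolding inside_def by auto
    have "?W - A = {p, q}" by (simp add: Un_Diff W1A W2A insert_commute)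
    then have "card ?W = card (A \<inter> ?W) + 2"
      using card_Int_Diff[of ?W A] f12 d by (simp add: Int_commute)
    moreover have "{v, r} \<notin> ?In" using W1 W2 unfolding inside_def by auto
    then have "card ?F = card (inside W1) + card (inside W2) + 1"
      using card_Un_disjoint[OF _ _ i12] by simp
    \<comment> \<open>\<open>W1\<close> and \<open>W2\<close> share one vertex, so together they
      have \<open>2|?W| - 4\<close> edges. Leaving out \<open>p\<close> and \<open>q\<close>
      accounts for the 4, and \<open>vr\<close> is the extra one.\<close>
    ultimately have "2 * card (A \<inter> ?W) + 1 \<le> card ?F"
      using c12 W1(1) W2(1) unfolding critical_def by linarith
    note ab = absorb[OF A(1,2,3) FA Fd this]
    have outside: "z \<in> W1" if "y \<in> W1 - {p, r}" "z \<in> nbrs y" for y z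
    proof -
      have y: "y \<in> A" using that(1) W1A by blast
      have y': "y \<notin> W2" "y \<noteq> v" using that(1) r12 A(4) y by blast+
      have "{y, z} \<in> touching A" using y that(2) unfolding touching_def nbrs_def by auto
      then have "{y, z} \<in> ?F" by (simp only: ab(2))
      then show ?thesis using y' that(1) unfolding inside_def by (auto simp: doubleton_eq_iff)
    qed
    have outside2: "z \<in> W2" if "y \<in> W2 - {q, r}" "z \<in> nbrs y" for y z
    proof -
      have y: "y \<in> A" using that(1) W2A by blast
      have y': "y \<notin> W1" "y \<noteq> v" using that(1) r12 A(4) y by blast+
      have "{y, z} \<in> touching A" using y that(2) unfolding touching_def nbrs_def by auto
      then have "{y, z} \<in> ?F" by (simp only: ab(2))
      then show ?thesis using y' that(1) unfolding inside_def by (auto simp: doubleton_eq_iff)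
    qed
    \<comment> \<open>This is where balancedness enters: two vertices cannot separate a nonempty
      loopless part of \<open>X\<close> from the rest.\<close>
    have small: "Z = {}" if "Z \<subseteq> X" "\<forall>z\<in>Z. lam z = 0" "\<forall>z\<in>Z. nbrs z \<subseteq> Z \<union> {a, b}" for Z a b
    proof (rule ccontr)
      assume "Z \<noteq> {}"
      then have "3 \<le> card (\<Union> (nbrs ` Z) - Z)" using that by (intro three_nbrs) auto
      also have "\<dots> \<le> card {a, b}" by (intro card_mono) (use that in auto)
      also have "\<dots> \<le> 2" by (simp add: card_insert_if)
      finally show False by simp
    qed
    have "W1 - {p, r} = {}"
    proof (rule small[of _ p r])
      have sub: "W1 - {p, r} \<subseteq> A" using W1A by blast
      then show "W1 - {p, r} \<subseteq> X" using A(1) by (rule subset_trans)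
      show "\<forall>z\<in>W1 - {p, r}. lam z = 0" using sub ab(3) by blast
      show "\<forall>z\<in>W1 - {p, r}. nbrs z \<subseteq> W1 - {p, r} \<union> {p, r}" using outside by blast
    qed
    then have W1e: "W1 = {p, r}" using W1(2,3) by blast
    have "W2 - {q, r} = {}"
    proof (rule small[of _ q r])
      have sub: "W2 - {q, r} \<subseteq> A" using W2A by blast
      then show "W2 - {q, r} \<subseteq> X" using A(1) by (rule subset_trans)
      show "\<forall>z\<in>W2 - {q, r}. lam z = 0" using sub ab(3) by blast
      show "\<forall>z\<in>W2 - {q, r}. nbrs z \<subseteq> W2 - {q, r} \<union> {q, r}" using outside2 by blast
    qed
    then have W2e: "W2 = {q, r}" using W2(2,3) by blast
    have Ar: "A = {r}" using ab(1) W1e W2e rA by auto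
    have lr: "lam r = 0" using ab(3) rA by blast
 have nr: "nbrs r \<subseteq> {p, q, v}"
    proof
      fix z assume z: "z \<in> nbrs r"
      then have "{r, z} \<in> touching A" using rA(1) unfolding touching_def nbrs_def by auto
      then have "{r, z} \<in> ?F" by (simp only: ab(2))
      then show "z \<in> {p, q, v}" using z unfolding inside_def W1e W2e by (auto simp: doubleton_eq_iff)
    qed
    \<comment> \<open>All neighbours of \<open>v\<close> and \<open>r\<close> outside this pair are
      \<open>p\<close> and \<open>q\<close>, and neither carries a loop.\<close>
    have "{v, r} = {}"
      by (rule small[of _ p q]) (use v(2) vV(2) A(1) Ar lr nr N in auto)
    then show False by simp
  qed
qed

section \<open>Why a reduction at a node fails\<close>

text \<open>By the lower bound for \<open>insert v A\<close>, the count can fail by at most one, and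
  only if \<open>f\<close> avoids \<open>A\<close>. The neighbours of \<open>v\<close> in
  \<open>A\<close> then lie outside \<open>f\<close>, so there is exactly one.\<close>

lemma missing_petal:
  assumes v: "node v" and f: "f \<subseteq> nbrs v" "card (nbrs v - f) \<le> 1"
    and A: "A \<subseteq> X - {v}" "A \<noteq> {}"
      "\<not> 2 * card A + 1 + card (nbrs v \<inter> A) \<le> touch_count A + (if f \<inter> A \<noteq> {} then 1 else 0)"
  shows "\<exists>r. petal v A r \<and> r \<in> nbrs v - f"
proof -
  have Af: "finite A" "A \<subseteq> X" "v \<notin> A" using A finite_sub_X by auto
  have "touch_count (insert v A) + card (nbrs v \<inter> A) = touch_count A + 3"
    using touch_count_insert[of v A] Af v unfolding node_def by simp
  moreover have "2 * card (insert v A) + 1 \<le> touch_count (insert v A)"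
    using Af v unfolding node_def by (intro touch_lower) auto
  ultimately have ge: "2 * card A + card (nbrs v \<inter> A) \<le> touch_count A" using Af by simp
  then have fA: "f \<inter> A = {}" using A(3) by (auto split: if_splits)
  then have eq: "touch_count A = 2 * card A + card (nbrs v \<inter> A)" using A(3) ge by simp
  have "card (nbrs v \<inter> A) \<le> card (nbrs v - f)" by (intro card_mono) (use fA in auto)
  moreover have "2 * card A + 1 \<le> touch_count A" using Af A by (intro touch_lower) auto
  ultimately have one: "card (nbrs v \<inter> A) = 1" using f eq by linarith
  then obtain r where r: "nbrs v \<inter> A = {r}" by (rule card_1_singletonE)
  have "petal v A r" using r Af A eq one unfolding petal_def cotight_def by simp
  then show ?thesis using r fA by blast
qed

lemma attached_edge:
  assumes "\<not> (X = V \<or> (\<exists>e\<in>E. \<not> e \<subseteq> X \<and> v \<notin> e) \<or> \<not> f \<subseteq> X)" "v \<in> X"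
  obtains y where "y \<in> nbrs v" "y \<notin> X" "y \<notin> f" "\<forall>e\<in>E. \<not> e \<subseteq> X \<longrightarrow> v \<in> e"
proof -
  obtain e where e: "e \<in> E" "\<not> e \<subseteq> X" using attached assms by auto
  then have "v \<in> e" using assms by auto
  then obtain y where "y \<in> nbrs v" "e = {v, y}" using edge_at e by blast
  then show thesis using that assms e by blast
qed

lemma not_good_cases:
  assumes "\<not> good_reduction v f"
  obtains (petal) A where "A \<subseteq> X - {v}" "A \<noteq> {}"
      "\<not> 2 * card A + 1 + card (nbrs v \<inter> A) \<le> touch_count A + (if f \<inter> A \<noteq> {} then 1 else 0)"
    | (crit) W where "card f = 2" "critical W" "f \<subseteq> W" "v \<notin> W"
    | (cut) "\<not> (X = V \<or> (\<exists>e\<in>E. \<not> e \<subseteq> X \<and> v \<notin> e) \<or> \<not> f \<subseteq> X)"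
  using assms unfolding good_reduction_def by meson

lemma bad_pair:
  assumes v: "node v" and d: "p \<noteq> q" "p \<in> nbrs v" "q \<in> nbrs v" and rest: "nbrs v - {p, q} \<subseteq> {r}"
    and bad: "\<not> good_reduction v {p, q}"
  shows "(r \<in> nbrs v - {p, q} \<and> center v r) \<or> (\<exists>W. critical W \<and> p \<in> W \<and> q \<in> W \<and> v \<notin> W)"
proof -
  have vX: "v \<in> X" using v unfolding node_def by simp
  have c: "card (nbrs v - {p, q}) \<le> 1" using card_mono[OF _ rest] by simp
  from bad show ?thesis
  proof (cases rule: not_good_cases)
    case (petal A)
    obtain r' where "petal v A r'" "r' \<in> nbrs v - {p, q}"
      using missing_petal[OF v _ c petal] d by auto
    then show ?thesis using rest unfolding center_def by auto
  next
    case cut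
    obtain y where y: "y \<in> nbrs v" "y \<notin> X" "y \<notin> {p, q}" "\<forall>e\<in>E. \<not> e \<subseteq> X \<longrightarrow> v \<in> e"
      by (rule attached_edge[OF cut vX])
    have yr: "y = r" using y rest by auto
    have pqX: "p \<in> X" "q \<in> X" using cut by auto
    have "e = {v, r}" if e: "e \<in> E" "\<not> e \<subseteq> X" for e
    proof -
      obtain z where z: "z \<in> nbrs v" "e = {v, z}" using y e edge_at by blast
      then have "z \<notin> X" using e vX by auto
      then show ?thesis using z rest pqX by auto
    qed
    then show ?thesis using y yr unfolding center_def by auto
  next
    case crit
    then show ?thesis by blast
  qed
qed

text \<open>Under the other alternative in \<open>center\<close>, the neighbour of \<open>r\<close>
  inside \<open>W\<close> would provide a second edge leaving \<open>X\<close>.\<close>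

lemma center_in_critical:
  assumes c: "center v r" and W: "critical W" "r \<in> W" "v \<notin> W"
  shows "\<exists>A. petal v A r"
proof (rule ccontr)
  assume "\<not> ?thesis"
  then have cut: "r \<notin> X" "\<forall>e\<in>E. \<not> e \<subseteq> X \<longrightarrow> e = {v, r}" using c unfolding center_def by auto
  obtain z where z: "z \<in> W" "z \<in> nbrs r" using critical_nbr W by blast
  then have "{r, z} \<in> E" unfolding nbrs_def by simp
  then have "{r, z} = {v, r}" using cut by auto
  then show False using z W by (auto simp: doubleton_eq_iff)
qed

lemma obtain_two_elements:
  assumes "finite S" "2 \<le> card S"
  obtains a b where "a \<in> S" "b \<in> S" "a \<noteq> b"
  using assms by (metis card_le_Suc0_iff_eq not_less_eq_eq numeral_2_eq_2)

text \<open>Every possible new element is excluded for some reason. Since two critical exclusions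
  cannot coexist at a loopless node, either all neighbours are centers, or a critical set excludes a
  pair whose two members are centers.\<close>

lemma bad_node:
  assumes v: "node v"
    and bad: "\<And>f. f \<subseteq> nbrs v \<Longrightarrow> card f = 2 \<or> (card f = 1 \<and> 1 \<le> lam v) \<Longrightarrow> \<not> good_reduction v f"
  shows "(\<exists>u w P Q W. blocked_pair v u w P Q W) \<or>
    (lam v = 0 \<and> card (nbrs v) = 3 \<and> (\<forall>r\<in>nbrs v. center v r))"
proof -
  have vX: "v \<in> X" and deg: "card (nbrs v) + lam v = 3"
    using v touch_count_single unfolding node_def by auto
  have loop: "\<exists>r A. petal v A r \<and> r \<in> nbrs v - {u} \<or>
      (\<exists>y. y \<in> nbrs v - {u} \<and> y \<notin> X \<and> (\<forall>e\<in>E. \<not> e \<subseteq> X \<longrightarrow> v \<in> e))"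
    if u: "u \<in> nbrs v" "1 \<le> lam v" for u
  proof -
    have c: "card (nbrs v - {u}) \<le> 1" using deg u by simp
    have "\<not> good_reduction v {u}" using bad u by simp
    then show ?thesis
    proof (cases rule: not_good_cases)
      case (petal A)
      show ?thesis using missing_petal[OF v _ c petal] u(1) by blast
    next
      case crit
      then show ?thesis by simp
    next
      case cut
      show ?thesis by (rule attached_edge[OF cut vX]) auto
    qed
  qed
  consider "lam v = 3" | "lam v = 2" | "lam v = 1" | "lam v = 0" using deg by linarith
  then show ?thesis
  proof cases
    case 1
    then have N: "nbrs v = {}" using deg by simp
    \<comment> \<open>Three loops leave \<open>v\<close> without neighbours, and removing it puts
      \<open>X - {v}\<close> one below its lower bound.\<close>
    have "touch_count (insert v (X - {v})) = touch_count (X - {v}) + 3"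
      using touch_count_insert[of v "X - {v}"] N finite_X v unfolding node_def by simp
    then have "touch_count X = touch_count (X - {v}) + 3" using vX by (simp add: insert_absorb)
    moreover have c: "card (X - {v}) + 1 = card X" using vX finite_X X_large by simp
    moreover have "X - {v} \<noteq> {}" using c X_large by (metis One_nat_def add_0 card.empty not_less_eq_eq numeral_2_eq_2 order_refl)
    then have "2 * card (X - {v}) + 1 \<le> touch_count (X - {v})" by (intro touch_lower) auto
    ultimately show ?thesis using touch_X by linarith
  next
    case 2
    then have "card (nbrs v) = 1" using deg by simp
    then obtain u where N: "nbrs v = {u}" by (rule card_1_singletonE)
    \<comment> \<open>The only neighbour already carries the new loop, so no other neighbour is left
      for a petal or a cut.\<close>
    then show ?thesis using loop[of u] 2 by auto
  next
    case 3
    then have "card (nbrs v) = 2" using deg by simp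
    then obtain u w where N: "nbrs v = {u, w}" "u \<noteq> w" by (meson card_2_iff)
    have "\<not> good_reduction v {u, w}" using bad[of "{u, w}"] N by simp
    \<comment> \<open>Both neighbours are ends of the new edge, so only a critical set can exclude
      it. The loops at \<open>u\<close> and \<open>w\<close> must then be excluded by
      petals.\<close>
    then obtain W where W: "critical W" "u \<in> W" "w \<in> W" "v \<notin> W"
      using bad_pair[OF v N(2), of u] N by auto
    have pet: "\<exists>A. petal v A b" if N': "nbrs v = {a, b}" "a \<noteq> b" and bW: "b \<in> W" for a b
    proof (rule ccontr)
      assume n: "\<not> ?thesis"
      then have y: "b \<notin> X" "\<forall>e\<in>E. \<not> e \<subseteq> X \<longrightarrow> v \<in> e"
        using loop[of a] N' 3 by auto
      obtain z where z: "z \<in> W" "z \<in> nbrs b" using critical_nbr[OF W(1) bW] by blast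
      then have "{b, z} \<in> E" unfolding nbrs_def by simp
      then have "v \<in> {b, z}" using y by auto
      then show False using z W bW by auto
    qed
    obtain P where "petal v P u" using pet[of w u] N W by (auto simp: insert_commute)
    moreover obtain Q where "petal v Q w" using pet[of u w] N W by auto
    ultimately have "blocked_pair v u w P Q W" using v N W unfolding blocked_pair_def by simp
    then show ?thesis by blast
  next
    case 4
    then have c3: "card (nbrs v) = 3" using deg by simp
    have pair: "center v r \<or> (\<exists>W. critical W \<and> p \<in> W \<and> q \<in> W \<and> v \<notin> W)"
      if "nbrs v = {p, q, r}" "p \<noteq> q" for p q r
    proof -
      have "\<not> good_reduction v {p, q}" using bad[of "{p, q}"] that by auto
      then show ?thesis using bad_pair[OF v that(2), of r] that by auto
    qed
    show ?thesis
    proof (cases "\<forall>r\<in>nbrs v. center v r")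
      case True
      then show ?thesis using 4 c3 by simp
    next
      case False
      then obtain r where r: "r \<in> nbrs v" "\<not> center v r" by blast
      have "card (nbrs v - {r}) = 2" using r c3 by simp
      then obtain p q where pq: "nbrs v - {r} = {p, q}" "p \<noteq> q" by (meson card_2_iff)
      then have N: "nbrs v = {p, q, r}" "p \<noteq> r" "q \<noteq> r" using r by auto
      then obtain W where W: "critical W" "p \<in> W" "q \<in> W" "v \<notin> W"
        using pair[OF N(1) pq(2)] r by blast
      \<comment> \<open>Otherwise a critical set would exclude a second pair, against
        \<open>two_critical_pairs\<close>.\<close>
      have cen: "center v a" if N': "nbrs v = {a, b, r}" "a \<noteq> b" "a \<noteq> r" "b \<noteq> r" "a \<in> W" "b \<in> W" for a b
      proof (rule ccontr)
        assume na: "\<not> center v a"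
        have "nbrs v = {b, r, a}" using N' by auto
        then obtain W' where W': "critical W'" "b \<in> W'" "r \<in> W'" "v \<notin> W'"
          using pair[of b r a] N' na by blast
        have "nbrs v = {a, r, b}" using N' by auto
        moreover have "center v b \<or> (\<exists>W. critical W \<and> a \<in> W \<and> r \<in> W \<and> v \<notin> W)"
          using pair[OF calculation N'(3)] .
        ultimately show False
          using two_critical_pairs[OF v 4, of a r b W W'] N' W W' by blast
      qed
      have "center v p" by (rule cen[of p q]) (use N pq W in auto)
      moreover have "center v q" by (rule cen[of q p]) (use N pq W in auto)
      ultimately obtain P Q where "petal v P p" "petal v Q q"
        using center_in_critical W by blast
      then have "blocked_pair v p q P Q W" using v pq W unfolding blocked_pair_def by simp
      then show ?thesis by blast
    qed
  qed
qed

section \<open>Eliminating blocked pairs\<close>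

text \<open>Removing \<open>Q\<close>, or both petals, leaves critical sets smaller than the minimum
  \<open>W\<close>. Hence nodes of \<open>P\<close> other than \<open>u\<close> form no blocked
  pairs and satisfy the hypotheses of the descent, with \<open>u\<close>, the only vertex of
  \<open>P\<close> adjacent to \<open>v\<close>, exempt. A petal with one vertex is itself a node
  and is refuted directly.\<close>

lemma minimal_blocked_pair_False:
  assumes bad: "\<And>v. node v \<Longrightarrow> (\<exists>u w P Q W. blocked_pair v u w P Q W) \<or>
      (lam v = 0 \<and> card (nbrs v) = 3 \<and> (\<forall>r\<in>nbrs v. center v r))"
    and b: "blocked_pair v u w P Q W"
    and least: "\<And>v' u' w' P' Q' W'. blocked_pair v' u' w' P' Q' W' \<Longrightarrow> card W \<le> card W'"
  shows False
proof -
  let ?R = "W - (P \<union> Q)" and ?K = "W - Q"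
  have b': "node v" "u \<noteq> w" "petal v P u" "petal v Q w" "critical W" "u \<in> W" "w \<in> W" "v \<notin> W"
    using b unfolding blocked_pair_def by auto
  note st = blocked_pair_structure[OF b]
  note pp = petal_pair[OF b'(1,3,4,2)]
  have uw: "u \<in> P" "w \<in> Q" using b' petal_center by auto
  have P: "cotight P" "P \<subseteq> X" "v \<notin> P" "nbrs v \<inter> P = {u}" using b' unfolding petal_def cotight_def by auto
  have W: "finite W" using critical_subD b' by auto
  have KR: "?K = P \<union> ?R" "P \<inter> ?R = {}" using st(1) pp(1) by auto
  have cK: "card ?K < card W" using W uw st(1) by (intro psubset_card_mono) auto
  have cR: "card ?R < card W" using W uw st(1) by (intro psubset_card_mono) auto
  have nbP: "nbrs z \<subseteq> insert v ?K" if "z \<in> P" for z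
    using st(3) pp(2) that by fastforce
  \<comment> \<open>Two centers in \<open>?R\<close> would form a blocked pair with the smaller
    critical set \<open>?R\<close>.\<close>
  have noR: False if z: "node z" "z \<notin> ?R" "s \<in> ?R" "t \<in> ?R" "s \<noteq> t" "center z s" "center z t" for z s t
  proof -
    obtain A where "petal z A s" using center_in_critical[OF z(6) st(4) z(3,2)] by blast
    moreover obtain B where "petal z B t" using center_in_critical[OF z(7) st(4) z(4,2)] by blast
    ultimately have "blocked_pair z s t A B ?R" using z st(4) unfolding blocked_pair_def by blast
    then show False using least cR by fastforce
  qed
  show False
  proof (cases "2 \<le> card P")
    case True
    have inner: "nbrs z \<subseteq> ?K \<and> (\<forall>r\<in>nbrs z. \<exists>A. petal z A r) \<and> 2 \<le> card (nbrs z \<inter> P)"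
      if z: "node z" "z \<in> P" "z \<noteq> u" for z
    proof -
      have "v \<notin> nbrs z" using P z nbrs_sym[of v z] by auto
      then have nK: "nbrs z \<subseteq> ?K" using nbP[OF z(2)] by blast
      \<comment> \<open>A critical set of such a pair shares \<open>s\<close> and \<open>t\<close>
        with the critical set \<open>?K\<close>, so it can be replaced by its intersection with
        \<open>?K\<close>, which is smaller than \<open>W\<close>.\<close>
      have nb: "\<not> blocked_pair z s t A B W'" for s t A B W'
      proof
        assume bz: "blocked_pair z s t A B W'"
        then have z': "s \<noteq> t" "petal z A s" "petal z B t" "critical W'" "s \<in> W'" "t \<in> W'" "z \<notin> W'"
          unfolding blocked_pair_def by auto
        have "{s, t} \<subseteq> W' \<inter> ?K" using z' nK petal_center by blast
        then have "card {s, t} \<le> card (W' \<inter> ?K)" using W by (intro card_mono) auto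
        then have "critical (W' \<inter> ?K)" using z' st(5) by (intro critical_Un_Int) auto
        then have "blocked_pair z s t A B (W' \<inter> ?K)"
          using bz \<open>{s, t} \<subseteq> W' \<inter> ?K\<close> unfolding blocked_pair_def by blast
        then have "card W \<le> card (W' \<inter> ?K)" by (rule least)
        also have "\<dots> \<le> card ?K" using W by (intro card_mono) auto
        finally show False using cK by simp
      qed
      have c3: "card (nbrs z) = 3" and cen: "\<And>r. r \<in> nbrs z \<Longrightarrow> center z r"
        using bad[OF z(1)] nb by auto
      have pet: "\<exists>A. petal z A r" if r: "r \<in> nbrs z" for r
      proof (cases "r \<in> P")
        case True
        then show ?thesis using cen[OF r] P(2) unfolding center_def by blast
      next
        case False
        then have "r \<in> ?R" using nK r by blast
        then show ?thesis using center_in_critical[OF cen[OF r] st(4)] z KR(2) by blast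
      qed
      have "2 \<le> card (nbrs z \<inter> P)"
      proof (rule ccontr)
        assume "\<not> ?thesis"
        moreover have "nbrs z - P = nbrs z \<inter> ?R" using nK by auto
        ultimately have "2 \<le> card (nbrs z \<inter> ?R)"
          using card_Int_Diff[OF finite_nbrs, of z P] c3 by simp
        then obtain s t where "s \<in> nbrs z \<inter> ?R" "t \<in> nbrs z \<inter> ?R" "s \<noteq> t"
          using obtain_two_elements[of "nbrs z \<inter> ?R"] by auto
        then show False using noR[OF z(1), of s t] cen z by blast
      qed
      then show ?thesis using nK pet by blast
    qed
    show False by (rule no_petal_descent[OF P(1) True, of u]) (use inner in blast)+
  next
    case False
    have "finite P" using P finite_sub_X by blast
    then have "card P \<noteq> 0" using uw by auto
    then have "card P = 1" using False by linarith
    then have Pu: "P = {u}" using uw by (metis card_1_singletonE singletonD)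
    have u: "node u" using P Pu unfolding cotight_def node_def by auto
    have uR: "u \<notin> ?R" using uw by simp
    have l0: "lam u = 0" using st(2) uw by auto
    then have c3: "card (nbrs u) = 3" using u touch_count_single[of u] unfolding node_def by simp
    have nR: "nbrs u \<subseteq> insert v ?R" using nbP[of u] uw Pu by auto
    have vu: "v \<in> nbrs u" using P nbrs_sym[of v u] by auto
    have notRR: False if "s \<in> nbrs u" "t \<in> nbrs u" "s \<noteq> v" "t \<noteq> v" "s \<noteq> t" "center u s" "center u t" for s t
      using noR[OF u uR _ _ that(5,6,7)] nR that by blast
    \<comment> \<open>\<open>W'\<close> meets \<open>?R\<close> only in \<open>t\<close>, as
      otherwise the union would be critical and contain all neighbours of \<open>u\<close>. But
      \<open>t\<close> lies in a petal of \<open>u\<close>, so its neighbours other than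
      \<open>u\<close> stay in \<open>W'\<close>, while it also has a neighbour in
      \<open>?R\<close>.\<close>
    have key: False if bu: "blocked_pair u v t A B W'" for t A B W'
    proof -
      have u': "v \<noteq> t" "petal u A v" "petal u B t" "critical W'" "v \<in> W'" "t \<in> W'" "u \<notin> W'"
        using bu unfolding blocked_pair_def by auto
      have t: "t \<in> nbrs u" "t \<in> B" using u' petal_center by auto
      then have tR: "t \<in> ?R" using nR u' by auto
      have "W' \<inter> ?R = {t}"
      proof (rule ccontr)
        assume ne: "W' \<inter> ?R \<noteq> {t}"
        have "t \<in> W' \<inter> ?R" using tR u' by simp
        with ne obtain t' where t': "t' \<in> W' \<inter> ?R" "t' \<noteq> t" by blast
        have "card {t, t'} \<le> card (W' \<inter> ?R)" using W tR u' t' by (intro card_mono) auto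
        then have "critical (W' \<union> ?R)" using u' st(4) t' by (intro critical_Un_Int) auto
        moreover have "nbrs u \<inter> (W' \<union> ?R) = nbrs u" using nR u' by blast
        ultimately show False
          using critical_not_overfull[of "W' \<union> ?R" u] c3 u' uR u X_sub unfolding node_def by auto
      qed
      obtain z where z: "z \<in> ?R" "z \<in> nbrs t" using critical_nbr[OF st(4) tR] by blast
      then have "z \<in> W'" using blocked_pair_structure(3)[OF bu] t uR by blast
      then have "z = t" using z \<open>W' \<inter> ?R = {t}\<close> by blast
      then show False using z by simp
    qed
    from bad[OF u] show False
    proof
      assume "\<exists>s t A B W'. blocked_pair u s t A B W'"
      then obtain s t A B W' where bu: "blocked_pair u s t A B W'" by blast
      then have st': "s \<noteq> t" "petal u A s" "petal u B t" unfolding blocked_pair_def by auto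
      consider "s = v" | "t = v" | "s \<noteq> v" "t \<noteq> v" by blast
      then show False
      proof cases
        case 1
        then show False using key bu by blast
      next
        case 2
        then show False using key blocked_pair_sym[OF bu] by blast
      next
        case 3
        have "center u s" "center u t" using st' unfolding center_def by blast+
        then show False using notRR[OF _ _ 3 st'(1)] st' petal_center by blast
      qed
    next
      assume a: "lam u = 0 \<and> card (nbrs u) = 3 \<and> (\<forall>r\<in>nbrs u. center u r)"
      have "2 \<le> card (nbrs u - {v})" using vu c3 by simp
      then obtain s t where "s \<in> nbrs u - {v}" "t \<in> nbrs u - {v}" "s \<noteq> t"
        using obtain_two_elements[of "nbrs u - {v}"] by auto
      then show False using notRR[of s t] a by blast
    qed
  qed
qed

theorem good_reduction_exists:
  "\<exists>v f. node v \<and> f \<subseteq> nbrs v \<and> (card f = 2 \<or> (card f = 1 \<and> 1 \<le> lam v)) \<and> good_reduction v f"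
proof (rule ccontr)
  assume none: "\<not> ?thesis"
  have bad: "(\<exists>u w P Q W. blocked_pair v u w P Q W) \<or>
      (lam v = 0 \<and> card (nbrs v) = 3 \<and> (\<forall>r\<in>nbrs v. center v r))" if "node v" for v
    using bad_node[OF that] none that by blast
  show False
  proof (cases "\<exists>v u w P Q W. blocked_pair v u w P Q W")
    case True
    then obtain W0 where "\<exists>v u w P Q. blocked_pair v u w P Q W0" by blast
    then have "\<exists>W. (\<exists>v u w P Q. blocked_pair v u w P Q W) \<and>
        (\<forall>W'. (\<exists>v u w P Q. blocked_pair v u w P Q W') \<longrightarrow> card W \<le> card W')"
      by (rule ex_has_least_nat)
    then obtain v u w P Q W where b: "blocked_pair v u w P Q W"
      and least: "\<And>v' u' w' P' Q' W'. blocked_pair v' u' w' P' Q' W' \<Longrightarrow> card W \<le> card W'"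
      by blast
    show False by (rule minimal_blocked_pair_False[OF bad b least])
  next
    case False
    have all: "card (nbrs v) = 3 \<and> (\<forall>r\<in>nbrs v. center v r)" if "node v" for v
      using bad[OF that] False by blast
    have ct: "cotight X" using touch_X X_large unfolding cotight_def by auto
    have petal: "\<exists>A. petal v A r" if "node v" "r \<in> nbrs v" "r \<in> X" for v r
      using all[OF that(1)] that unfolding center_def by blast
    \<comment> \<open>Two neighbours outside \<open>X\<close> would both have to be the end of the
      only edge leaving \<open>X\<close>.\<close>
    have two: "2 \<le> card (nbrs v \<inter> X)" if v: "node v" for v
    proof (rule ccontr)
      assume "\<not> ?thesis"
      then have "2 \<le> card (nbrs v - X)" using card_Int_Diff[OF finite_nbrs, of v X] all[OF v] by simp
      then obtain s t where st: "s \<in> nbrs v - X" "t \<in> nbrs v - X" "s \<noteq> t"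
        using obtain_two_elements[of "nbrs v - X"] by auto
      then have "center v s" "\<not> (\<exists>A. petal v A s)" using all[OF v] petal_sub petal_center by blast+
      then have cut: "\<forall>e\<in>E. \<not> e \<subseteq> X \<longrightarrow> e = {v, s}" unfolding center_def by simp
      have "{v, t} \<in> E" "\<not> {v, t} \<subseteq> X" using st unfolding nbrs_def by auto
      then have "{v, t} = {v, s}" using cut by metis
      then show False using st by (auto simp: doubleton_eq_iff)
    qed
    \<comment> \<open>The hypotheses hold at every node, so the exempt vertex may be
      arbitrary.\<close>
    show False by (rule no_petal_descent[OF ct X_large, of undefined]) (use petal two in blast)+
  qed
qed

end

subsection \<open>Circuits and connectivity\<close>

text \<open>No ground set is fixed and connectivity refers to arbitrary sets, so that
  \<open>G\<close>, \<open>H\<close> and all reduced graphs share one structure.\<close>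

locale circuits =
  fixes circ :: "'e set \<Rightarrow> bool"
  assumes circ_finite: "circ C \<Longrightarrow> finite C"
    and circ_clutter: "circ C \<Longrightarrow> circ D \<Longrightarrow> C \<subseteq> D \<Longrightarrow> C = D"
    and circ_elim: "circ C \<Longrightarrow> circ D \<Longrightarrow> C \<noteq> D \<Longrightarrow> e \<in> C \<Longrightarrow> e \<in> D \<Longrightarrow>
      \<exists>Q. circ Q \<and> Q \<subseteq> C \<union> D - {e}"
begin

text \<open>If weak elimination loses \<open>f\<close>, its result has an element \<open>g\<close>
  of \<open>D\<close> outside \<open>C\<close>. Eliminating \<open>g\<close> while keeping
  \<open>e\<close>, then \<open>e\<close> while keeping \<open>f\<close>, involves only smaller
  unions: the first misses \<open>f\<close>, the second misses \<open>g\<close>.\<close>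

lemma strong_elim:
  "circ C \<Longrightarrow> circ D \<Longrightarrow> e \<in> C \<Longrightarrow> e \<in> D \<Longrightarrow> f \<in> C \<Longrightarrow> f \<notin> D \<Longrightarrow>
    \<exists>Q. circ Q \<and> f \<in> Q \<and> Q \<subseteq> C \<union> D - {e}"
proof (induction "card (C \<union> D)" arbitrary: C D e f rule: less_induct)
  case less
  have fin: "finite (C \<union> D)" using less.prems circ_finite by blast
  obtain C3 where C3: "circ C3" "C3 \<subseteq> C \<union> D - {e}"
    using circ_elim[OF less.prems(1,2) _ less.prems(3,4)] less.prems by blast
  show ?case
  proof (cases "f \<in> C3")
    case True
    then show ?thesis using C3 by blast
  next
    case False
    have "\<not> C3 \<subseteq> C" using circ_clutter[OF C3(1) less.prems(1)] C3 less.prems(3) by blast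
    then obtain g where g: "g \<in> C3" "g \<in> D" "g \<notin> C" using C3 by blast
    have "card (D \<union> C3) < card (C \<union> D)"
      by (rule psubset_card_mono[OF fin]) (use C3 False less.prems in blast)
    then obtain C4 where C4: "circ C4" "e \<in> C4" "C4 \<subseteq> D \<union> C3 - {g}"
      using less.hyps[of D C3 g e] less.prems C3 g by blast
    have "card (C \<union> C4) < card (C \<union> D)"
      by (rule psubset_card_mono[OF fin]) (use C3 C4 g in blast)
    then obtain C5 where "circ C5" "f \<in> C5" "C5 \<subseteq> C \<union> C4 - {e}"
      using less.hyps[of C C4 e f] less.prems C3 C4 False by blast
    then show ?thesis using C4 C3 by blast
  qed
qed

text \<open>Eliminate a common \<open>e\<close> twice, keeping \<open>a\<close> once and
  \<open>b\<close> once. Either the two results meet and their union misses \<open>e\<close>, or one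
  of them can replace \<open>C\<close> or \<open>D\<close> with a smaller union.\<close>

lemma common_circuit:
  "circ C \<Longrightarrow> circ D \<Longrightarrow> C \<inter> D \<noteq> {} \<Longrightarrow> a \<in> C \<Longrightarrow> b \<in> D \<Longrightarrow>
    \<exists>Q. circ Q \<and> a \<in> Q \<and> b \<in> Q \<and> Q \<subseteq> C \<union> D"
proof (induction "card (C \<union> D)" arbitrary: C D rule: less_induct)
  case less
  have fin: "finite (C \<union> D)" using less.prems circ_finite by blast
  show ?case
  proof (cases "a \<in> D \<or> b \<in> C")
    case True
    then show ?thesis using less.prems by blast
  next
    case False
    obtain e where e: "e \<in> C" "e \<in> D" using less.prems by blast
    obtain C3 where C3: "circ C3" "a \<in> C3" "C3 \<subseteq> C \<union> D - {e}"
      using strong_elim[OF less.prems(1,2) e less.prems(4)] False by blast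
    obtain C4 where C4: "circ C4" "b \<in> C4" "C4 \<subseteq> D \<union> C - {e}"
      using strong_elim[OF less.prems(2,1) e(2,1) less.prems(5)] False by blast
    have n3: "\<not> C3 \<subseteq> C" using circ_clutter[OF C3(1) less.prems(1)] C3 e by blast
    have n4: "\<not> C4 \<subseteq> D" using circ_clutter[OF C4(1) less.prems(2)] C4 e by blast
    show ?thesis
    proof (cases "C3 \<union> D = C \<union> D \<and> C \<union> C4 = C \<union> D")
      case True
      have meet: "C3 \<inter> C4 \<noteq> {}" using True n3 C3 by blast
      have "card (C3 \<union> C4) < card (C \<union> D)"
        by (rule psubset_card_mono[OF fin]) (use C3 C4 e in blast)
      then obtain Q where "circ Q" "a \<in> Q" "b \<in> Q" "Q \<subseteq> C3 \<union> C4"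
        using less.hyps[OF _ C3(1) C4(1) meet C3(2) C4(2)] by blast
      then show ?thesis using C3 C4 by blast
    next
      case False
      then consider "C3 \<union> D \<subset> C \<union> D" | "C \<union> C4 \<subset> C \<union> D"
        using C3 C4 by blast
      then show ?thesis
      proof cases
        case 1
        have meet: "C3 \<inter> D \<noteq> {}" using n3 C3 by blast
        show ?thesis
          using less.hyps[OF psubset_card_mono[OF fin 1] C3(1) less.prems(2) meet C3(2) less.prems(5)] 1
          by blast
      next
        case 2
        have meet: "C \<inter> C4 \<noteq> {}" using n4 C4 by blast
        show ?thesis
          using less.hyps[OF psubset_card_mono[OF fin 2] less.prems(1) C4(1) meet less.prems(4) C4(2)] 2
          by blast
      qed
    qed
  qed
qed

definition connected_set :: "'e set \<Rightarrow> bool" where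
  "connected_set S \<longleftrightarrow> (\<forall>a\<in>S. \<forall>b\<in>S. a \<noteq> b \<longrightarrow> (\<exists>C. circ C \<and> C \<subseteq> S \<and> a \<in> C \<and> b \<in> C))"

lemma connected_circuit: "circ C \<Longrightarrow> connected_set C"
  unfolding connected_set_def by blast

lemma connected_Un_circuit:
  assumes H: "connected_set H" and C: "circ C" and meet: "H \<inter> C \<noteq> {}"
  shows "connected_set (H \<union> C)"
proof -
  have mixed: "\<exists>Q. circ Q \<and> Q \<subseteq> H \<union> C \<and> a \<in> Q \<and> b \<in> Q" if a: "a \<in> H" and b: "b \<in> C" for a b
  proof (cases "a \<in> C")
    case True
    then show ?thesis using C b by blast
  next
    case False
    obtain h where h: "h \<in> H" "h \<in> C" using meet by blast
    then obtain C1 where C1: "circ C1" "C1 \<subseteq> H" "a \<in> C1" "h \<in> C1"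
      using H a False unfolding connected_set_def by metis
    have "C1 \<inter> C \<noteq> {}" using C1 h by blast
    from common_circuit[OF C1(1) C this C1(3) b] C1(2) show ?thesis by blast
  qed
  show ?thesis unfolding connected_set_def
  proof (intro ballI impI)
    fix a b assume ab: "a \<in> H \<union> C" "b \<in> H \<union> C" "a \<noteq> b"
    show "\<exists>Q. circ Q \<and> Q \<subseteq> H \<union> C \<and> a \<in> Q \<and> b \<in> Q"
    proof (cases "a \<in> H \<and> b \<in> H")
      case True
      then obtain Q where "circ Q" "Q \<subseteq> H" "a \<in> Q" "b \<in> Q"
        using H ab unfolding connected_set_def by metis
      then show ?thesis by blast
    next
      case False
      then show ?thesis using mixed[of a b] mixed[of b a] C ab by blast
    qed
  qed
qed

end

subsection \<open>The count matroid\<close>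

definition wf_elements :: "'a element set \<Rightarrow> bool" where
  "wf_elements F \<longleftrightarrow> finite F \<and> (\<forall>e. Inl e \<in> F \<longrightarrow> card e = 2)"

text \<open>Both count conditions in one function. The empty set counts as loopless, with value -3;
  this makes the function submodular without exception and is why sparsity quantifies over nonempty
  sets.\<close>

definition bound :: "'a element set \<Rightarrow> int" where
  "bound F = 2 * int (card (incident_verts F)) - (if F \<subseteq> range Inl then 3 else 0)"

definition sparse_set :: "'a element set \<Rightarrow> bool" where
  "sparse_set F \<longleftrightarrow> (\<forall>F'\<subseteq>F. F' \<noteq> {} \<longrightarrow> int (card F') \<le> bound F')"

definition lc_circuit :: "'a element set \<Rightarrow> bool" where
  "lc_circuit C \<longleftrightarrow> wf_elements C \<and> \<not> sparse_set C \<and> (\<forall>D\<subset>C. sparse_set D)"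

lemma wf_elements_subset: "wf_elements F \<Longrightarrow> F' \<subseteq> F \<Longrightarrow> wf_elements F'"
  unfolding wf_elements_def by (auto intro: finite_subset)

lemma wf_elements_Un [simp]: "wf_elements (F \<union> F') \<longleftrightarrow> wf_elements F \<and> wf_elements F'"
  unfolding wf_elements_def by auto

lemma finite_ends: "wf_elements F \<Longrightarrow> d \<in> F \<Longrightarrow> finite (ends d)"
  unfolding wf_elements_def by (cases d) (auto intro: card_ge_0_finite)

lemma incident_verts_Un [simp]: "incident_verts (F \<union> F') = incident_verts F \<union> incident_verts F'"
  and incident_verts_insert [simp]: "incident_verts (insert d F) = ends d \<union> incident_verts F"
  and incident_verts_empty [simp]: "incident_verts {} = {}"
  unfolding incident_verts_def by auto

lemma incident_verts_mono: "F \<subseteq> F' \<Longrightarrow> incident_verts F \<subseteq> incident_verts F'"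
  unfolding incident_verts_def by auto

lemma finite_incident_verts: "wf_elements F \<Longrightarrow> finite (incident_verts F)"
  using finite_ends unfolding incident_verts_def wf_elements_def by auto

lemma sparse_set_subset: "sparse_set F \<Longrightarrow> F' \<subseteq> F \<Longrightarrow> sparse_set F'"
  unfolding sparse_set_def by auto

lemma bound_mono:
  assumes "wf_elements F'" "F \<subseteq> F'"
  shows "bound F \<le> bound F'"
proof -
  have "card (incident_verts F) \<le> card (incident_verts F')"
    using assms by (intro card_mono finite_incident_verts incident_verts_mono)
  then show ?thesis using assms(2) unfolding bound_def by auto
qed

lemma bound_submod:
  assumes "wf_elements A" "wf_elements B"
  shows "bound (A \<union> B) + bound (A \<inter> B) \<le> bound A + bound B"
proof -
  have f: "finite (incident_verts A)" "finite (incident_verts B)" using assms finite_incident_verts by auto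
  have "card (incident_verts (A \<inter> B)) \<le> card (incident_verts A \<inter> incident_verts B)"
    using f by (intro card_mono) (auto simp: incident_verts_def)
  moreover have "card (incident_verts A \<union> incident_verts B) + card (incident_verts A \<inter> incident_verts B) =
      card (incident_verts A) + card (incident_verts B)"
    using card_Un_Int[OF f] by simp
  ultimately show ?thesis unfolding bound_def by auto
qed

lemma sparse_set_single: "wf_elements {d} \<Longrightarrow> sparse_set {d}"
  unfolding sparse_set_def wf_elements_def bound_def
  by (cases d) (auto simp: subset_singleton_iff incident_verts_def)

text \<open>Only \<open>C\<close> itself can violate its bound, and deleting an element lowers the
  cardinality by just one. Singletons are treated apart because deletion leaves the empty set, on
  which sparsity says nothing.\<close>

lemma circuit_card:
  assumes C: "lc_circuit C"
  shows "int (card C) = bound C + 1" and "C \<noteq> {}" and "finite C"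
proof -
  show fC: "finite C" using C unfolding lc_circuit_def wf_elements_def by auto
  obtain F where F: "F \<subseteq> C" "F \<noteq> {}" "\<not> int (card F) \<le> bound F"
    using C unfolding lc_circuit_def sparse_set_def by auto
  have FC: "F = C"
  proof (rule ccontr)
    assume "F \<noteq> C"
    then have "sparse_set F" using C F unfolding lc_circuit_def by auto
    then show False using F unfolding sparse_set_def by auto
  qed
  show ne: "C \<noteq> {}" using F FC by simp
  then obtain c where c: "c \<in> C" by auto
  show "int (card C) = bound C + 1"
  proof (cases "C = {c}")
    case True
    then have "sparse_set C" using sparse_set_single C unfolding lc_circuit_def by auto
    then show ?thesis using C unfolding lc_circuit_def by auto
  next
    case False
    have "sparse_set (C - {c})" using C c unfolding lc_circuit_def by auto
    moreover have "C - {c} \<noteq> {}" using False c by blast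
    ultimately have "int (card (C - {c})) \<le> bound (C - {c})" unfolding sparse_set_def by blast
    also have "\<dots> \<le> bound C" using C unfolding lc_circuit_def by (intro bound_mono) auto
    finally have "int (card C) - 1 \<le> bound C" using card_Suc_Diff1[OF fC c] by linarith
    then show ?thesis using F FC by simp
  qed
qed

lemma circuit_proper: "lc_circuit C \<Longrightarrow> D \<subset> C \<Longrightarrow> D \<noteq> {} \<Longrightarrow> int (card D) \<le> bound D"
  unfolding lc_circuit_def sparse_set_def by blast

lemma dependent_circuit: "wf_elements F \<Longrightarrow> \<not> sparse_set F \<Longrightarrow> \<exists>C\<subseteq>F. lc_circuit C"
proof (induction "card F" arbitrary: F rule: less_induct)
  case less
  show ?case
  proof (cases "\<forall>D\<subset>F. sparse_set D")
    case True
    then show ?thesis using less.prems unfolding lc_circuit_def by auto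
  next
    case False
    then obtain D where D: "D \<subset> F" "\<not> sparse_set D" by auto
    then have "card D < card F" using less.prems(1) unfolding wf_elements_def by (intro psubset_card_mono) auto
    then show ?thesis using less.hyps[of D] D wf_elements_subset less.prems(1) by (meson order_trans psubset_imp_subset)
  qed
qed

lemma overfull_circuit:
  assumes "wf_elements F" "F \<noteq> {}" "bound F < int (card F)"
  shows "\<exists>C\<subseteq>F. lc_circuit C"
  using assms by (intro dependent_circuit) (auto simp: sparse_set_def)

interpretation lc: circuits lc_circuit
proof
  show "finite C" if "lc_circuit C" for C :: "'a element set" using circuit_card(3) that .
  show "C = D" if "lc_circuit C" "lc_circuit D" "C \<subseteq> D" for C D :: "'a element set"
    using that unfolding lc_circuit_def by blast
  fix C D :: "'a element set" and e
  assume C: "lc_circuit C" and D: "lc_circuit D" and ne: "C \<noteq> D" and e: "e \<in> C" "e \<in> D"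
  let ?U = "C \<union> D"
  have w: "wf_elements C" "wf_elements D" "wf_elements ?U" using C D unfolding lc_circuit_def by auto
  have psub: "C \<inter> D \<subset> C" using ne C D unfolding lc_circuit_def by blast
  have "int (card (C \<inter> D)) \<le> bound (C \<inter> D)" using circuit_proper[OF C psub] e by auto
  moreover have "card ?U + card (C \<inter> D) = card C + card D" using card_Un_Int circuit_card(3) C D by metis
  \<comment> \<open>Each circuit exceeds its bound by one and the intersection does not, so the
    union exceeds its bound by two and stays overfull without \<open>e\<close>.\<close>
  ultimately have "bound ?U + 2 \<le> int (card ?U)"
    using bound_submod[OF w(1,2)] circuit_card(1)[OF C] circuit_card(1)[OF D] by linarith
  moreover have "bound (?U - {e}) \<le> bound ?U" using w by (intro bound_mono) auto
  moreover have "int (card (?U - {e})) = int (card ?U) - 1"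
    using card_Suc_Diff1[of ?U e] e w unfolding wf_elements_def by simp
  ultimately have "bound (?U - {e}) < int (card (?U - {e}))" by linarith
  moreover have "?U - {e} \<noteq> {}" using psub e by blast
  moreover have "wf_elements (?U - {e})" by (rule wf_elements_subset[OF w(3)]) auto
  ultimately show "\<exists>Q. lc_circuit Q \<and> Q \<subseteq> C \<union> D - {e}" using overfull_circuit by blast
qed

lemma wf_ground: "looped_simple_graph G \<Longrightarrow> wf_elements (ground G)"
proof -
  assume G: "looped_simple_graph G"
  have "finite (edges G)"
    by (rule finite_subset[of _ "Pow (verts G)"]) (use G in \<open>auto simp: looped_simple_graph_def\<close>)
  then show ?thesis using G unfolding wf_elements_def looped_simple_graph_def ground_def by auto
qed

lemma mlc_indep_iff:
  assumes G: "looped_simple_graph G"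
  shows "mlc_indep G F \<longleftrightarrow> F \<subseteq> ground G \<and> sparse_set F"
proof -
  have "(\<forall>F'\<subseteq>F. int (card F') \<le> 2 * int (card (incident_verts F'))) \<and>
     (\<forall>F'\<subseteq>F \<inter> Inl ` edges G. F' \<noteq> {} \<longrightarrow> int (card F') \<le> 2 * int (card (incident_verts F')) - 3)
     \<longleftrightarrow> sparse_set F" (is "?L \<longleftrightarrow> _") if F: "F \<subseteq> ground G"
  proof
    assume L: ?L
    show "sparse_set F" unfolding sparse_set_def
    proof (intro allI impI)
      fix F' assume F': "F' \<subseteq> F" "F' \<noteq> {}"
      show "int (card F') \<le> bound F'"
      proof (cases "F' \<subseteq> range Inl")
        case True
        then have "F' \<subseteq> F \<inter> Inl ` edges G" using F F' unfolding ground_def by auto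
        then show ?thesis using L F' True unfolding bound_def by simp
      next
        case False
        then show ?thesis using L F' unfolding bound_def by simp
      qed
    qed
  next
    assume s: "sparse_set F"
    have "int (card F') \<le> 2 * int (card (incident_verts F'))" if "F' \<subseteq> F" for F'
    proof (cases "F' = {}")
      case False
      then have "int (card F') \<le> bound F'" using s that unfolding sparse_set_def by auto
      then show ?thesis unfolding bound_def by (simp split: if_splits)
    qed simp
    moreover have "int (card F') \<le> 2 * int (card (incident_verts F')) - 3"
      if "F' \<subseteq> F \<inter> Inl ` edges G" "F' \<noteq> {}" for F'
    proof -
      have "int (card F') \<le> bound F'" using s that unfolding sparse_set_def by auto
      moreover have "F' \<subseteq> range Inl" using that by auto
      ultimately show ?thesis unfolding bound_def by simp
    qed
    ultimately show ?L by blast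
  qed
  then show ?thesis unfolding mlc_indep_def by (cases "F \<subseteq> ground G") simp_all
qed

lemma mlc_circuit_iff:
  assumes "looped_simple_graph G"
  shows "mlc_circuit G C \<longleftrightarrow> C \<subseteq> ground G \<and> lc_circuit C"
proof (cases "C \<subseteq> ground G")
  case True
  have indep: "mlc_indep G D \<longleftrightarrow> sparse_set D" if "D \<subseteq> C" for D
    unfolding mlc_indep_iff[OF assms] using order_trans[OF that True] by simp
  have "(\<forall>D\<subset>C. mlc_indep G D) \<longleftrightarrow> (\<forall>D\<subset>C. sparse_set D)"
    using indep by (meson psubset_imp_subset)
  then show ?thesis
    using True indep[OF order_refl] wf_elements_subset[OF wf_ground[OF assms] True]
    unfolding mlc_circuit_def lc_circuit_def by simp
qed (simp add: mlc_circuit_def)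

lemma mlc_connected_iff:
  assumes "looped_simple_graph G"
  shows "mlc_connected G \<longleftrightarrow> lc.connected_set (ground G)"
  unfolding mlc_connected_def lc.connected_set_def mlc_circuit_iff[OF assms] by (simp add: conj_ac)

subsection \<open>The last ear\<close>

text \<open>\<open>B\<close> witnesses the largest possible rank \<open>2|V|\<close>, which a
  nonempty loopless set cannot have. The empty set qualifies, so a graph that is a single circuit is
  an ear over nothing.\<close>

definition full_connected :: "'a element set \<Rightarrow> 'a element set \<Rightarrow> bool" where
  "full_connected H B \<longleftrightarrow> lc.connected_set H \<and> B \<subseteq> H \<and> sparse_set B \<and>
     card B = 2 * card (incident_verts H)"

lemma sparse_card_le: "sparse_set F \<Longrightarrow> card F \<le> 2 * card (incident_verts F)"
proof (cases "F = {}")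
  case False
  assume "sparse_set F"
  then have "int (card F) \<le> bound F" using False unfolding sparse_set_def by blast
  then show ?thesis unfolding bound_def by (simp split: if_splits)
qed simp

lemma sparse_loopless_card_le:
  assumes "sparse_set F" "F \<subseteq> range Inl" "F \<noteq> {}"
  shows "card F + 3 \<le> 2 * card (incident_verts F)"
proof -
  have "int (card F) \<le> bound F" using assms unfolding sparse_set_def by blast
  then show ?thesis using assms unfolding bound_def by simp
qed

lemma circuit_card_loop: "lc_circuit C \<Longrightarrow> \<not> C \<subseteq> range Inl \<Longrightarrow> card C = 2 * card (incident_verts C) + 1"
  using circuit_card(1)[of C] unfolding bound_def by simp

lemma circuit_card_loopless: "lc_circuit C \<Longrightarrow> C \<subseteq> range Inl \<Longrightarrow> card C + 2 = 2 * card (incident_verts C)"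
  using circuit_card(1)[of C] unfolding bound_def by simp

lemma circuit_wf: "lc_circuit C \<Longrightarrow> wf_elements C"
  unfolding lc_circuit_def by simp

lemma circuit_sparse_subset: "lc_circuit C \<Longrightarrow> D \<subset> C \<Longrightarrow> sparse_set D"
  unfolding lc_circuit_def by simp

text \<open>\<open>C\<close> exceeds its bound by one while its proper part in \<open>H\<close>
  respects its own; the difference must be paid on the new vertices. For loopless \<open>C\<close>
  the constant 3 occurs on both sides and cancels.\<close>

lemma crossing_circuit_card:
  assumes C: "lc_circuit C" and meet: "C \<inter> H \<noteq> {}" and out: "\<not> C \<subseteq> H"
  shows "2 * card (incident_verts C - incident_verts H) + 1 \<le> card (C - H)"
proof -
  have fC: "finite C" "finite (incident_verts C)"
    using circuit_card(3)[OF C] finite_incident_verts[OF circuit_wf[OF C]] by auto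
  have sub: "incident_verts (C \<inter> H) \<subseteq> incident_verts C \<inter> incident_verts H"
    unfolding incident_verts_def by auto
  have le: "card (incident_verts (C \<inter> H)) \<le> card (incident_verts C \<inter> incident_verts H)"
    by (rule card_mono[OF _ sub]) (use fC in simp)
  have v: "card (incident_verts C) = card (incident_verts C \<inter> incident_verts H) + card (incident_verts C - incident_verts H)"
    by (rule card_Int_Diff[OF fC(2)])
  have c: "card C = card (C \<inter> H) + card (C - H)" by (rule card_Int_Diff[OF fC(1)])
  have s: "sparse_set (C \<inter> H)" by (rule circuit_sparse_subset[OF C]) (use out in blast)
  show ?thesis
  proof (cases "C \<subseteq> range Inl")
    case True
    then have "card (C \<inter> H) + 3 \<le> 2 * card (incident_verts (C \<inter> H))"
      using sparse_loopless_card_le[OF s] meet by blast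
    then show ?thesis using circuit_card_loopless[OF C True] le v c by linarith
  next
    case False
    then show ?thesis using circuit_card_loop[OF C False] sparse_card_le[OF s] le v c by linarith
  qed
qed

lemma full_connected_circuit:
  assumes C: "lc_circuit C" and l: "Inr l \<in> C"
  shows "full_connected C (C - {Inr l})"
proof -
  have loop: "\<not> C \<subseteq> range Inl" using l by auto
  have "card (C - {Inr l}) = 2 * card (incident_verts C)"
    using circuit_card_loop[OF C loop] l circuit_card(3)[OF C] by simp
  moreover have "sparse_set (C - {Inr l})" by (rule circuit_sparse_subset[OF C]) (use l in auto)
  ultimately show ?thesis using lc.connected_circuit[OF C] unfolding full_connected_def by auto
qed

text \<open>A circuit inside \<open>B\<close> and a proper part of \<open>C - H\<close> would lie in
  the independent \<open>B\<close>, or properly inside \<open>C\<close>, or would leave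
  \<open>H\<close> by fewer elements. So \<open>C - H\<close> is a circuit over \<open>H\<close>,
  and \<open>B\<close> extends by all but one of its elements to a set of size
  \<open>2|V|\<close>.\<close>

lemma minimal_crossing_circuit:
  assumes H: "full_connected H B" and wf: "wf_elements (H \<union> C)"
    and C: "lc_circuit C" and meet: "C \<inter> H \<noteq> {}" and out: "\<not> C \<subseteq> H"
    and least: "\<And>Q. lc_circuit Q \<Longrightarrow> Q \<inter> H \<noteq> {} \<Longrightarrow> \<not> Q \<subseteq> H \<Longrightarrow> Q \<subseteq> H \<union> C \<Longrightarrow> card (C - H) \<le> card (Q - H)"
  shows "\<And>d. d \<in> C - H \<Longrightarrow> sparse_set (B \<union> (C - H - {d}))"
    and "\<exists>B'. full_connected (H \<union> C) B'"
proof -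
  have fin: "finite C" "finite B" "finite H"
    using wf H unfolding wf_elements_def full_connected_def by (auto intro: finite_subset)
  have BH: "B \<subseteq> H" "sparse_set B" "card B = 2 * card (incident_verts H)"
    using H unfolding full_connected_def by auto
  show sp: "sparse_set (B \<union> (C - H - {d}))" if d: "d \<in> C - H" for d
  proof (rule ccontr)
    assume "\<not> ?thesis"
    moreover have "wf_elements (B \<union> (C - H - {d}))"
      by (rule wf_elements_subset[OF wf]) (use BH in auto)
    ultimately obtain Q where Q: "Q \<subseteq> B \<union> (C - H - {d})" "lc_circuit Q" using dependent_circuit by blast
    have "\<not> Q \<subseteq> B" using sparse_set_subset[OF BH(2)] Q(2) unfolding lc_circuit_def by blast
    then have QH: "\<not> Q \<subseteq> H" using Q by blast
    show False
    proof (cases "Q \<inter> H = {}")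
      case True
      then have "Q \<subset> C" using Q d BH by blast
      then show False using C Q(2) unfolding lc_circuit_def by blast
    next
      case False
      have "card (C - H) \<le> card (Q - H)" by (rule least[OF Q(2) False QH]) (use Q BH in blast)
      moreover have "card (Q - H) < card (C - H)"
        using Q BH d fin by (intro psubset_card_mono) auto
      ultimately show False by simp
    qed
  qed
  obtain d where d: "d \<in> C - H" using out by blast
  let ?B = "B \<union> (C - H - {d})"
  have fV: "finite (incident_verts H)" "finite (incident_verts C)"
    using finite_incident_verts wf by auto
  have "card (incident_verts H \<union> (incident_verts C - incident_verts H)) =
      card (incident_verts H) + card (incident_verts C - incident_verts H)"
    by (rule card_Un_disjoint) (use fV in auto)
  then have V: "card (incident_verts (H \<union> C)) = card (incident_verts H) + card (incident_verts C - incident_verts H)"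
    by (simp add: Un_Diff_cancel)
  have "card ?B = card B + card (C - H - {d})"
    by (rule card_Un_disjoint) (use fin BH in auto)
  moreover have "card (C - H - {d}) + 1 = card (C - H)"
    using card_Suc_Diff1[OF _ d] fin by simp
  ultimately have "2 * card (incident_verts (H \<union> C)) \<le> card ?B"
    using crossing_circuit_card[OF C meet out] BH V by linarith
  moreover have "card ?B \<le> 2 * card (incident_verts ?B)" by (rule sparse_card_le[OF sp[OF d]])
  moreover have "card (incident_verts ?B) \<le> card (incident_verts (H \<union> C))"
    by (intro card_mono incident_verts_mono finite_incident_verts wf) (use BH in auto)
  ultimately have "card ?B = 2 * card (incident_verts (H \<union> C))" by linarith
  moreover have "lc.connected_set (H \<union> C)"
    by (rule lc.connected_Un_circuit) (use H C meet in \<open>auto simp: full_connected_def\<close>)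
  ultimately show "\<exists>B'. full_connected (H \<union> C) B'"
    using sp[OF d] BH(1) unfolding full_connected_def by (intro exI[of _ ?B]) auto
qed

text \<open>The last ear, with \<open>B\<close> in the role of a basis of \<open>H\<close>:
  \<open>D_indep\<close> says that \<open>D\<close> is minimally dependent over \<open>H\<close>.
  One inequality for the size of \<open>D\<close> suffices, as \<open>D_indep\<close> gives the
  other.\<close>

locale lobe =
  fixes H B D C :: "'a element set"
  assumes wf: "wf_elements (H \<union> D)"
    and disjoint: "H \<inter> D = {}"
    and full: "full_connected H B"
    and D_indep: "d \<in> D \<Longrightarrow> sparse_set (B \<union> (D - {d}))"
    and circuit: "lc_circuit C" "D \<subseteq> C" "C \<subseteq> H \<union> D"
    and D_ne: "D \<noteq> {}"
    and D_large: "2 * card (incident_verts D - incident_verts H) + 1 \<le> card D"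
    and meets: "H \<noteq> {} \<Longrightarrow> C \<inter> H \<noteq> {}"
    and has_loop: "H = {} \<Longrightarrow> \<not> D \<subseteq> range Inl"

text \<open>\<open>H\<close> is a largest proper subset that is full and connected. Attaching a
  circuit that leaves it by as few elements as possible keeps both properties, so maximality makes
  this ear the last one.\<close>

lemma lobe_exists:
  assumes S: "lc.connected_set S" "wf_elements S" and l: "Inr l \<in> S" and two: "2 \<le> card S"
  shows "\<exists>H B D C. lobe H B D C \<and> S = H \<union> D"
proof -
  have fS: "finite S" using S unfolding wf_elements_def by simp
  have "\<not> S \<subseteq> {Inr l}" using card_mono[of "{Inr l}" S] two by auto
  then obtain g where g: "g \<in> S" "g \<noteq> Inr l" by auto
  then obtain C0 where C0: "lc_circuit C0" "C0 \<subseteq> S" "Inr l \<in> C0"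
    using S l unfolding lc.connected_set_def by metis
  show ?thesis
  proof (cases "C0 = S")
    case True
    have S0: "lc_circuit S" "\<not> S \<subseteq> range Inl" using C0 True l by auto
    have "lobe {} {} S S"
    proof
      show "full_connected {} ({} :: 'a element set)"
        unfolding full_connected_def lc.connected_set_def sparse_set_def by simp
      show "sparse_set ({} \<union> (S - {d}))" if "d \<in> S" for d
        using circuit_sparse_subset[OF S0(1)] that by auto
      show "2 * card (incident_verts S - incident_verts {}) + 1 \<le> card S"
        using circuit_card_loop[OF S0] by simp
    qed (use S0 S l in auto)
    then show ?thesis by (intro exI[of _ "{}"] exI[of _ S]) simp
  next
    case False
    define Pr where "Pr = (\<lambda>H. H \<subset> S \<and> H \<noteq> {} \<and> (\<exists>B. full_connected H B))"
    have "Pr C0" using False C0 full_connected_circuit[OF C0(1,3)] unfolding Pr_def by blast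
    moreover have "card H < card S" if "Pr H" for H
      using psubset_card_mono[OF fS, of H] that unfolding Pr_def by simp
    ultimately have "\<exists>H. Pr H \<and> (\<forall>H'. Pr H' \<longrightarrow> card H' \<le> card H)"
      by (intro ex_has_greatest_nat[of Pr C0 card "card S"]) blast+
    then obtain H B where H: "H \<subset> S" "H \<noteq> {}" "full_connected H B"
      and great: "\<And>H'. Pr H' \<Longrightarrow> card H' \<le> card H" unfolding Pr_def by blast
    define Cr where "Cr = (\<lambda>C. lc_circuit C \<and> C \<subseteq> S \<and> C \<inter> H \<noteq> {} \<and> \<not> C \<subseteq> H)"
    obtain h d where hd: "h \<in> H" "d \<in> S" "d \<notin> H" using H by blast
    moreover have "h \<in> S" "h \<noteq> d" using hd H(1) by auto
    ultimately obtain C1 where "lc_circuit C1" "C1 \<subseteq> S" "h \<in> C1" "d \<in> C1"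
      using S(1) unfolding lc.connected_set_def by metis
    then have "Cr C1" using hd unfolding Cr_def by blast
    then have "\<exists>C. Cr C \<and> (\<forall>Q. Cr Q \<longrightarrow> card (C - H) \<le> card (Q - H))"
      by (rule ex_has_least_nat)
    then obtain C where C: "lc_circuit C" "C \<subseteq> S" "C \<inter> H \<noteq> {}" "\<not> C \<subseteq> H"
      and least: "\<And>Q. Cr Q \<Longrightarrow> card (C - H) \<le> card (Q - H)" unfolding Cr_def by blast
    have least': "card (C - H) \<le> card (Q - H)"
      if "lc_circuit Q" "Q \<inter> H \<noteq> {}" "\<not> Q \<subseteq> H" "Q \<subseteq> H \<union> C" for Q
      by (rule least) (use that H C in \<open>auto simp: Cr_def\<close>)
    have wfHC: "wf_elements (H \<union> C)" by (rule wf_elements_subset[OF S(2)]) (use H C in auto)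
    note mc = minimal_crossing_circuit[OF H(3) wfHC C(1,3,4) least']
    have all: "H \<union> C = S"
    proof (rule ccontr)
      assume "H \<union> C \<noteq> S"
      then have "Pr (H \<union> C)" using mc(2) H C unfolding Pr_def by blast
      then have "card (H \<union> C) \<le> card H" by (rule great)
      moreover have "card H < card (H \<union> C)"
        by (rule psubset_card_mono) (use wfHC C in \<open>auto simp: wf_elements_def\<close>)
      ultimately show False by simp
    qed
    have "incident_verts (C - H) - incident_verts H = incident_verts C - incident_verts H"
      unfolding incident_verts_def by auto
    then have lo: "lobe H B (C - H) C"
      using crossing_circuit_card[OF C(1,3,4)] mc(1) wfHC H C by unfold_locales (auto simp: Un_Diff_cancel)
    show ?thesis by (intro exI conjI) (rule lo, use all in blast)
  qed
qed

section \<open>Counts on the last ear\<close>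

context lobe
begin

definition Y :: "'a set" where "Y = incident_verts H"
definition X :: "'a set" where "X = incident_verts D - Y"

lemma B_facts: "B \<subseteq> H" "sparse_set B" "card B = 2 * card Y"
  using full unfolding full_connected_def Y_def by auto

lemma finite_facts: "finite H" "finite D" "finite B" "finite X" "finite Y"
  using wf B_facts finite_incident_verts[of H] finite_incident_verts[of D] unfolding wf_elements_def X_def Y_def
  by (auto intro: finite_subset)

lemma wf_parts: "wf_elements H" "wf_elements D" "wf_elements B"
  using wf wf_elements_subset[of H B] B_facts by auto

lemma D_verts: "incident_verts D \<subseteq> X \<union> Y"
  unfolding X_def by auto

text \<open>\<open>B\<close> alone exhausts the count \<open>2|Y|\<close>, so only
  \<open>2|X'|\<close> is left for \<open>F\<close>; omitting \<open>d\<close> is what makes the two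
  independent together.\<close>

lemma sparse_BD_card:
  assumes "F \<subseteq> D - {d}" "d \<in> D" "incident_verts F \<subseteq> X' \<union> Y" "finite X'"
  shows "card F \<le> 2 * card X'"
proof -
  have fF: "finite F" using assms finite_facts finite_subset by blast
  have "sparse_set (B \<union> F)" by (rule sparse_set_subset[OF D_indep[OF assms(2)]]) (use assms in auto)
  then have "card (B \<union> F) \<le> 2 * card (incident_verts (B \<union> F))" by (rule sparse_card_le)
  also have "\<dots> \<le> 2 * card (X' \<union> Y)"
    using assms finite_facts incident_verts_mono[OF B_facts(1)] unfolding Y_def
    by (intro mult_le_mono2 card_mono) auto
  also have "\<dots> \<le> 2 * (card X' + card Y)" by (intro mult_le_mono2 card_Un_le)
  finally have "card (B \<union> F) \<le> 2 * card X' + card B" using B_facts by simp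
  moreover have "card (B \<union> F) = card B + card F"
    by (rule card_Un_disjoint) (use assms fF finite_facts B_facts disjoint in auto)
  ultimately show ?thesis by simp
qed

lemma card_D: "card D = 2 * card X + 1"
proof -
  obtain d where d: "d \<in> D" using D_ne by blast
  have "card (D - {d}) \<le> 2 * card X"
    by (rule sparse_BD_card[OF order_refl d _ finite_facts(4)])
      (use D_verts incident_verts_mono[of "D - {d}" D] in auto)
  moreover have "card (D - {d}) + 1 = card D" using card_Suc_Diff1[OF finite_facts(2) d] by simp
  ultimately show ?thesis using D_large unfolding X_def Y_def by simp
qed

lemma touches_X:
  assumes "2 \<le> card D" "d \<in> D"
  shows "ends d \<inter> X \<noteq> {}"
proof
  assume e: "ends d \<inter> X = {}"
  have "\<not> D \<subseteq> {d}" using assms card_mono[of "{d}" D] by auto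
  then obtain d' where d': "d' \<in> D" "d' \<noteq> d" by auto
  have "ends d \<subseteq> incident_verts D" using assms unfolding incident_verts_def by auto
  then have "card {d} \<le> 2 * card ({} :: 'a set)"
    by (intro sparse_BD_card[OF _ d'(1)]) (use assms d' e D_verts in auto)
  then show False by simp
qed

text \<open>Complementary count: the elements avoiding \<open>Z\<close> live on \<open>X - Z\<close>
  and \<open>Y\<close>, so they are at most \<open>2|X - Z|\<close> of the
  \<open>2|X| + 1\<close>.\<close>

lemma touch_lower:
  assumes "Z \<subseteq> X" "Z \<noteq> {}"
  shows "2 * card Z + 1 \<le> card {d \<in> D. ends d \<inter> Z \<noteq> {}}"
proof -
  let ?T = "{d \<in> D. ends d \<inter> Z \<noteq> {}}"
  obtain z where z: "z \<in> Z" using assms by auto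
  then obtain d where d: "d \<in> D" "z \<in> ends d" using assms unfolding X_def incident_verts_def by auto
  have "incident_verts (D - ?T) \<subseteq> (X - Z) \<union> Y"
    using D_verts unfolding incident_verts_def by auto
  then have "card (D - ?T) \<le> 2 * card (X - Z)"
    by (intro sparse_BD_card[OF _ d(1)]) (use d z finite_facts in auto)
  moreover have "card D = card (D - ?T) + card ?T"
    using card_Int_Diff[OF finite_facts(2), of ?T] by (simp add: Int_absorb1)
  moreover have "card X = card Z + card (X - Z)"
    using card_Int_Diff[OF finite_facts(4), of Z] assms by (simp add: Int_absorb1)
  ultimately show ?thesis using card_D by linarith
qed

text \<open>\<open>C\<close> meets \<open>H\<close> or, if \<open>H\<close> is empty, contains a
  loop; either way \<open>F\<close> is a proper subset of this circuit.\<close>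

lemma edges_sparse:
  assumes "F \<subseteq> D" "F \<subseteq> range Inl" "F \<noteq> {}"
  shows "card F + 3 \<le> 2 * card (incident_verts F)"
proof -
  have "F \<noteq> C"
  proof
    assume "F = C"
    then have "C \<inter> H = {}" "D = F" using assms disjoint circuit by auto
    then show False using meets has_loop assms by auto
  qed
  then have "F \<subset> C" using assms circuit by auto
  from circuit_sparse_subset[OF circuit(1) this] show ?thesis
    using sparse_loopless_card_le assms by blast
qed

text \<open>Otherwise \<open>D\<close>, a proper part of the circuit \<open>C\<close>, would be
  independent with \<open>2|X| + 1\<close> elements on \<open>|X|\<close> vertices.\<close>

lemma D_meets_Y:
  assumes "H \<noteq> {}"
  shows "incident_verts D \<inter> Y \<noteq> {}"
proof
  assume "incident_verts D \<inter> Y = {}"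
  then have "incident_verts D = X" unfolding X_def by auto
  moreover have "D \<subset> C" using meets[OF assms] circuit disjoint by blast
  then have "card D \<le> 2 * card (incident_verts D)"
    using circuit_sparse_subset[OF circuit(1)] sparse_card_le by blast
  ultimately show False using card_D by simp
qed

text \<open>A replacement \<open>D'\<close> of the lobe attaches to \<open>H\<close> as a single circuit, so connectivity is kept.\<close>
lemma reattach:
  assumes wf': "wf_elements D'" and dis: "H \<inter> D' = {}"
    and V: "incident_verts D' \<subseteq> X' \<union> Y" "finite X'" "X' \<inter> Y = {}"
    and c: "card D' = 2 * card X' + 1"
    and low: "\<And>A. A \<subseteq> X' \<Longrightarrow> A \<noteq> {} \<Longrightarrow> 2 * card A + 1 \<le> card {d \<in> D'. ends d \<inter> A \<noteq> {}}"
    and ed: "\<And>F. F \<subseteq> D' \<Longrightarrow> F \<subseteq> range Inl \<Longrightarrow> F \<noteq> {} \<Longrightarrow> card F + 3 \<le> 2 * card (incident_verts F)"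
    and att: "H \<noteq> {} \<Longrightarrow> incident_verts D' \<inter> Y \<noteq> {}"
  shows "lc.connected_set (H \<union> D')"
proof -
  have fD: "finite D'" using wf' unfolding wf_elements_def by simp
  have BD: "B \<inter> D' = {}" using dis B_facts by blast
  have "bound (B \<union> D') \<le> 2 * int (card (incident_verts (B \<union> D')))" unfolding bound_def by simp
  also have "card (incident_verts (B \<union> D')) \<le> card (X' \<union> Y)"
    using V finite_facts incident_verts_mono[OF B_facts(1)] unfolding Y_def by (intro card_mono) auto
  also have "card (X' \<union> Y) = card X' + card Y" using V finite_facts by (intro card_Un_disjoint) auto
  finally have "bound (B \<union> D') \<le> 2 * int (card X' + card Y)" by simp
  moreover have "card (B \<union> D') = card B + card D'" using finite_facts fD BD by (intro card_Un_disjoint) auto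
  ultimately have "bound (B \<union> D') < int (card (B \<union> D'))" using c B_facts by simp
  moreover have "wf_elements (B \<union> D')" using wf' wf_parts by simp
  moreover have "B \<union> D' \<noteq> {}" using c by auto
  \<comment> \<open>One element too many for independence produces a circuit. It remains to see that
    it contains all of \<open>D'\<close> and, if \<open>H\<close> is nonempty, meets
    \<open>B\<close>.\<close>
  ultimately obtain Q where Q: "Q \<subseteq> B \<union> D'" "lc_circuit Q" using overfull_circuit by blast
  have wQ: "finite Q" "finite (incident_verts Q)"
    using circuit_card(3)[OF Q(2)] finite_incident_verts[OF circuit_wf[OF Q(2)]] by auto
  have sB: "sparse_set (Q \<inter> B)" using sparse_set_subset[OF B_facts(2)] by blast
  have QV: "incident_verts Q \<subseteq> X' \<union> Y"
    using incident_verts_mono[OF Q(1)] V incident_verts_mono[OF B_facts(1)] unfolding Y_def by auto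
  have cV: "card (incident_verts Q) = card (incident_verts Q \<inter> X') + card (incident_verts Q \<inter> Y)"
  proof -
    have "incident_verts Q = (incident_verts Q \<inter> X') \<union> (incident_verts Q \<inter> Y)" using QV by auto
    moreover have "card \<dots> = card (incident_verts Q \<inter> X') + card (incident_verts Q \<inter> Y)"
      using wQ V by (intro card_Un_disjoint) auto
    ultimately show ?thesis by simp
  qed
  have cQ: "card Q = card (Q \<inter> B) + card (Q \<inter> D')"
  proof -
    have "Q = (Q \<inter> B) \<union> (Q \<inter> D')" using Q by auto
    moreover have "card \<dots> = card (Q \<inter> B) + card (Q \<inter> D')" using wQ BD by (intro card_Un_disjoint) auto
    ultimately show ?thesis by simp
  qed
  have VB: "card (incident_verts (Q \<inter> B)) \<le> card (incident_verts Q \<inter> Y)"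
    using wQ B_facts unfolding Y_def by (intro card_mono) (auto simp: incident_verts_def)
  have big: "2 * card (incident_verts Q \<inter> X') + 1 \<le> card (Q \<inter> D')"
  proof (cases "Q \<subseteq> range Inl")
    case True
    have "Q \<inter> B \<noteq> {}"
    proof
      assume "Q \<inter> B = {}"
      then have "Q \<subseteq> D'" using Q by auto
      then have "card Q + 3 \<le> 2 * card (incident_verts Q)"
        using ed[OF _ True] circuit_card(2)[OF Q(2)] by blast
      then show False using circuit_card_loopless[OF Q(2) True] by simp
    qed
    then have "card (Q \<inter> B) + 3 \<le> 2 * card (incident_verts (Q \<inter> B))"
      using sparse_loopless_card_le[OF sB] True by blast
    then show ?thesis using circuit_card_loopless[OF Q(2) True] cV cQ VB by linarith
  next
    case False
    then show ?thesis using circuit_card_loop[OF Q(2) False] sparse_card_le[OF sB] cV cQ VB by linarith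
  qed
  \<comment> \<open>\<open>Q\<close> loses all elements at the vertices it misses, and by
    \<open>low\<close> these are so many that \<open>big\<close> could no longer hold.\<close>
  have XQ: "X' \<subseteq> incident_verts Q"
  proof (rule ccontr)
    assume n: "\<not> ?thesis"
    let ?A = "X' - incident_verts Q"
    let ?T = "{d \<in> D'. ends d \<inter> ?A \<noteq> {}}"
    have "2 * card ?A + 1 \<le> card ?T" by (rule low) (use n in auto)
    moreover have "card D' = card ?T + card (D' - ?T)"
      using card_Int_Diff[OF fD, of ?T] by (simp add: Int_absorb1)
    moreover have "card (Q \<inter> D') \<le> card (D' - ?T)"
      by (rule card_mono) (use fD in \<open>auto simp: incident_verts_def\<close>)
    moreover have "card X' = card (incident_verts Q \<inter> X') + card ?A"
      using card_Int_Diff[OF V(2), of "incident_verts Q"] by (simp add: Int_commute)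
    ultimately show False using big c by linarith
  qed
  have "card D' \<le> card (Q \<inter> D')" using big c XQ by (simp add: Int_absorb1)
  then have "Q \<inter> D' = D'" using fD by (intro card_subset_eq card_seteq) auto
  then have DQ: "D' \<subseteq> Q" by auto
  show ?thesis
  proof (cases "H = {}")
    case True
    then have "B = {}" using B_facts by auto
    then show ?thesis using Q DQ True lc.connected_circuit[OF Q(2)] by (metis Un_empty_left subset_antisym)
  next
    case False
    \<comment> \<open>Otherwise \<open>D'\<close> itself would be a circuit; but loopless sets in
      \<open>D'\<close> are sparse, and with a loop \<open>D'\<close> has too few elements once it
      also has a vertex in \<open>Y\<close>.\<close>
    have "Q \<inter> B \<noteq> {}"
    proof
      assume "Q \<inter> B = {}"
      then have QD: "Q = D'" using Q DQ by auto
      show False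
      proof (cases "Q \<subseteq> range Inl")
        case True
        then have "card Q + 3 \<le> 2 * card (incident_verts Q)"
          using ed[of Q] circuit_card(2)[OF Q(2)] QD by blast
        then show False using circuit_card_loopless[OF Q(2) True] by simp
      next
        case F: False
        have "card (incident_verts Q \<inter> Y) \<noteq> 0" using att[OF False] QD wQ by simp
        then show False using circuit_card_loop[OF Q(2) F] cV c QD XQ by (simp add: Int_absorb1)
      qed
    qed
    then have "lc.connected_set (H \<union> Q)"
      using full Q B_facts unfolding full_connected_def by (intro lc.connected_Un_circuit) auto
    moreover have "H \<union> Q = H \<union> D'" using Q DQ B_facts by auto
    ultimately show ?thesis by simp
  qed
qed

end

subsection \<open>Reductions and balance in looped graphs\<close>

lemma ground_delete_element: "ground (delete_element G f) = ground G - {f}"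
  unfolding ground_def delete_element_def by (auto split: sum.splits)

lemma simple_delete_element: "looped_simple_graph G \<Longrightarrow> looped_simple_graph (delete_element G f)"
  unfolding looped_simple_graph_def delete_element_def by (auto split: sum.splits)

lemma admissible_element_iff:
  assumes "looped_simple_graph G"
  shows "admissible_element G f \<longleftrightarrow> f \<in> ground G \<and> lc.connected_set (ground G - {f})"
  unfolding admissible_element_def mlc_connected_iff[OF simple_delete_element[OF assms]] ground_delete_element ..

lemma in_ground [simp]: "Inl e \<in> ground G \<longleftrightarrow> e \<in> edges G" "Inr l \<in> ground G \<longleftrightarrow> l \<in> loops G"
  unfolding ground_def by auto

lemma ends_ground: "looped_simple_graph G \<Longrightarrow> d \<in> ground G \<Longrightarrow> ends d \<subseteq> verts G"
  unfolding looped_simple_graph_def by (cases d) auto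

lemma edge_at_vertex:
  assumes "looped_simple_graph G" "e \<in> edges G" "v \<in> e"
  shows "\<exists>w. w \<noteq> v \<and> w \<in> verts G \<and> e = {v, w}"
proof -
  have "card e = 2" "e \<subseteq> verts G" using assms unfolding looped_simple_graph_def by auto
  then obtain a b where "e = {a, b}" "a \<noteq> b" by (meson card_2_iff)
  then show ?thesis using assms(3) \<open>e \<subseteq> verts G\<close> by auto
qed

section \<open>1-reductions as operations on graphs\<close>

definition reduce :: "'a looped_graph \<Rightarrow> 'a \<Rightarrow> 'a set set \<Rightarrow> ('a \<times> nat) set \<Rightarrow> 'a looped_graph" where
  "reduce G v E' L' = G\<lparr>verts := verts G - {v}, edges := {e \<in> edges G. v \<notin> e} \<union> E',
     loops := {l \<in> loops G. fst l \<noteq> v} \<union> L'\<rparr>"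

lemma ground_reduce: "ground (reduce G v E' L') = {d \<in> ground G. v \<notin> ends d} \<union> Inl ` E' \<union> Inr ` L'"
  unfolding reduce_def ground_def by auto

lemma simple_reduce:
  assumes "looped_simple_graph G" "finite L'" "\<And>e. e \<in> E' \<Longrightarrow> e \<subseteq> verts G - {v} \<and> card e = 2"
    "\<And>l. l \<in> L' \<Longrightarrow> fst l \<in> verts G - {v}"
  shows "looped_simple_graph (reduce G v E' L')"
  using assms unfolding looped_simple_graph_def reduce_def by fastforce

lemma third_element:
  assumes "card S = 3" "a \<in> S" "b \<in> S" "a \<noteq> b"
  obtains c where "S = {a, b, c}" "c \<noteq> a" "c \<noteq> b"
proof -
  have "finite S" using assms card_gt_0_iff[of S] by simp
  then have "card (S - {a, b}) = 1" using assms by (simp add: card_Diff_subset)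
  then obtain c where "S - {a, b} = {c}" by (rule card_1_singletonE)
  then show thesis using that[of c] assms by blast
qed

lemma admissible_node_edge:
  assumes G: "looped_simple_graph G" and v: "v \<in> verts G" "card {d \<in> ground G. v \<in> ends d} = 3"
    and p: "{v, p} \<in> edges G" and q: "{v, q} \<in> edges G" and pq: "p \<noteq> q" "{p, q} \<notin> edges G"
    and conn: "lc.connected_set (insert (Inl {p, q}) {d \<in> ground G. v \<notin> ends d})"
  shows "admissible_node G v"
proof -
  let ?R = "reduce G v {{p, q}} {}"
  have edge_card: "card e = 2 \<and> e \<subseteq> verts G" if "e \<in> edges G" for e
    using that G unfolding looped_simple_graph_def by auto
  have pv: "p \<noteq> v" "q \<noteq> v" "p \<in> verts G" "q \<in> verts G"
    using edge_card[OF p] edge_card[OF q] by (auto simp: card_insert_if split: if_splits)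
  have R: "looped_simple_graph ?R" by (rule simple_reduce[OF G]) (use pv pq in auto)
  have "ground ?R = insert (Inl {p, q}) {d \<in> ground G. v \<notin> ends d}" unfolding ground_reduce by auto
  then have connR: "mlc_connected ?R" using conn mlc_connected_iff[OF R] by simp
  have "Inl {v, p} \<in> {d \<in> ground G. v \<in> ends d}" "Inl {v, q} \<in> {d \<in> ground G. v \<in> ends d}"
    "Inl {v, p} \<noteq> (Inl {v, q} :: 'a element)"
    using p q pq by (auto simp: doubleton_eq_iff)
  \<comment> \<open>The third element at \<open>v\<close> decides which of the two forms of the
    1-extension is being undone.\<close>
  then obtain t where t: "{d \<in> ground G. v \<in> ends d} = {Inl {v, p}, Inl {v, q}, t}"
    "t \<noteq> Inl {v, p}" "t \<noteq> Inl {v, q}"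
    by (rule third_element[OF v(2)]) 
  have tG: "t \<in> ground G" "v \<in> ends t" using t by blast+
  have ed: "{e \<in> edges G. v \<in> e} = {e. Inl e \<in> {d \<in> ground G. v \<in> ends d}}" by auto
  have lo: "{l \<in> loops G. fst l = v} = {l. Inr l \<in> {d \<in> ground G. v \<in> ends d}}" by auto
  have ext: "(\<exists>x\<in>verts ?R - {p, q}. edges G = edges ?R - {{p, q}} \<union> {{p, v}, {q, v}, {v, x}} \<and> loops G = loops ?R) \<or>
      (\<exists>i. edges G = edges ?R - {{p, q}} \<union> {{p, v}, {q, v}} \<and> loops G = loops ?R \<union> {(v, i)})"
  proof (cases t)
    case (Inl e)
    then have eG: "e \<in> edges G" "v \<in> e" using tG by auto
    then obtain x where x: "x \<noteq> v" "x \<in> verts G" "e = {v, x}" using edge_at_vertex[OF G] by blast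
    have "{e \<in> edges G. v \<in> e} = {{p, v}, {q, v}, {v, x}}" unfolding ed t(1) Inl x by (auto simp: insert_commute)
    moreover have "edges G = {e \<in> edges G. v \<notin> e} \<union> {e \<in> edges G. v \<in> e}" by auto
    ultimately have "edges G = edges ?R - {{p, q}} \<union> {{p, v}, {q, v}, {v, x}}"
      using pq(2) pv unfolding reduce_def by auto
    moreover have "{l \<in> loops G. fst l = v} = {}" unfolding lo t(1) Inl by auto
    then have "loops G = loops ?R" unfolding reduce_def by auto
    moreover have "x \<in> verts ?R - {p, q}" using x t Inl unfolding reduce_def by auto
    ultimately show ?thesis by blast
  next
    case (Inr l)
    then obtain i where l: "l = (v, i)" using tG by (cases l) auto
    have "{e \<in> edges G. v \<in> e} = {{p, v}, {q, v}}" unfolding ed t(1) Inr by (auto simp: insert_commute)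
    moreover have "edges G = {e \<in> edges G. v \<notin> e} \<union> {e \<in> edges G. v \<in> e}" by auto
    ultimately have "edges G = edges ?R - {{p, q}} \<union> {{p, v}, {q, v}}"
      using pq(2) pv unfolding reduce_def by auto
    moreover have "{l \<in> loops G. fst l = v} = {(v, i)}" unfolding lo t(1) Inr l by auto
    then have "loops G = loops ?R \<union> {(v, i)}" unfolding reduce_def by auto
    ultimately show ?thesis by blast
  qed
  have R0: "v \<notin> verts ?R" "verts G = insert v (verts ?R)" using v unfolding reduce_def by auto
  have "{p, q} \<in> edges ?R" unfolding reduce_def by auto
  then have "\<exists>u w. u \<noteq> w \<and> {u, w} \<in> edges ?R \<and> ((\<exists>x\<in>verts ?R - {u, w}.
      edges G = edges ?R - {{u, w}} \<union> {{u, v}, {w, v}, {v, x}} \<and> loops G = loops ?R) \<or>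
      (\<exists>i. edges G = edges ?R - {{u, w}} \<union> {{u, v}, {w, v}} \<and> loops G = loops ?R \<union> {(v, i)}))"
    using pq(1) ext by meson
  then have "edge_one_extension ?R v G" unfolding edge_one_extension_def using R0 by (intro conjI) assumption+
  then show ?thesis
    using v R connR unfolding admissible_node_def is_node_def one_reduction_def by blast
qed

lemma admissible_node_loop:
  assumes G: "looped_simple_graph G" and v: "v \<in> verts G" "card {d \<in> ground G. v \<in> ends d} = 3"
    and u: "{v, u} \<in> edges G" and j: "(v, j) \<in> loops G" and i: "(u, i) \<notin> loops G"
    and conn: "lc.connected_set (insert (Inr (u, i)) {d \<in> ground G. v \<notin> ends d})"
  shows "admissible_node G v"
proof -
  let ?R = "reduce G v {} {(u, i)}"
  have "card {v, u} = 2 \<and> {v, u} \<subseteq> verts G"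
    using u G unfolding looped_simple_graph_def by auto
  then have uv: "u \<noteq> v" "u \<in> verts G" by (auto simp: card_insert_if split: if_splits)
  have R: "looped_simple_graph ?R" by (rule simple_reduce[OF G]) (use uv in auto)
  have "ground ?R = insert (Inr (u, i)) {d \<in> ground G. v \<notin> ends d}" unfolding ground_reduce by auto
  then have connR: "mlc_connected ?R" using conn mlc_connected_iff[OF R] by simp
  have "Inl {v, u} \<in> {d \<in> ground G. v \<in> ends d}" "Inr (v, j) \<in> {d \<in> ground G. v \<in> ends d}"
    "Inl {v, u} \<noteq> (Inr (v, j) :: 'a element)"
    using u j by auto
  then obtain t where t: "{d \<in> ground G. v \<in> ends d} = {Inl {v, u}, Inr (v, j), t}"
    "t \<noteq> Inl {v, u}" "t \<noteq> Inr (v, j)"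
    by (rule third_element[OF v(2)])
  have tG: "t \<in> ground G" "v \<in> ends t" using t by blast+
  have ed: "{e \<in> edges G. v \<in> e} = {e. Inl e \<in> {d \<in> ground G. v \<in> ends d}}" by auto
  have lo: "{l \<in> loops G. fst l = v} = {l. Inr l \<in> {d \<in> ground G. v \<in> ends d}}" by auto
  have eR: "edges ?R = {e \<in> edges G. v \<notin> e}" and lR: "loops ?R - {(u, i)} = {l \<in> loops G. fst l \<noteq> v}"
    using i unfolding reduce_def by auto
  have ext: "(\<exists>w\<in>verts ?R - {u}. edges G = edges ?R \<union> {{u, v}, {w, v}} \<and> loops G = loops ?R - {(u, i)} \<union> {(v, j)}) \<or>
      (\<exists>k. k \<noteq> j \<and> edges G = edges ?R \<union> {{u, v}} \<and> loops G = loops ?R - {(u, i)} \<union> {(v, j), (v, k)})"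
  proof (cases t)
    case (Inl e)
    then have eG: "e \<in> edges G" "v \<in> e" using tG by auto
    then obtain x where x: "x \<noteq> v" "x \<in> verts G" "e = {v, x}" using edge_at_vertex[OF G] by blast
    have "{e \<in> edges G. v \<in> e} = {{u, v}, {x, v}}" unfolding ed t(1) Inl x by (auto simp: insert_commute)
    then have "edges G = edges ?R \<union> {{u, v}, {x, v}}" unfolding eR by auto
    moreover have "{l \<in> loops G. fst l = v} = {(v, j)}" unfolding lo t(1) Inl by auto
    then have "loops G = loops ?R - {(u, i)} \<union> {(v, j)}" unfolding lR by auto
    moreover have "x \<in> verts ?R - {u}" using x t Inl unfolding reduce_def by auto
    ultimately show ?thesis by blast
  next
    case (Inr l)
    then obtain k where l: "l = (v, k)" using tG by (cases l) auto
    have "{e \<in> edges G. v \<in> e} = {{u, v}}" unfolding ed t(1) Inr by (auto simp: insert_commute)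
    then have "edges G = edges ?R \<union> {{u, v}}" unfolding eR by auto
    moreover have "{l \<in> loops G. fst l = v} = {(v, j), (v, k)}" unfolding lo t(1) Inr l by auto
    then have "loops G = loops ?R - {(u, i)} \<union> {(v, j), (v, k)}" unfolding lR by auto
    moreover have "k \<noteq> j" using t Inr l by auto
    ultimately show ?thesis by blast
  qed
  have R0: "v \<notin> verts ?R" "verts G = insert v (verts ?R)" using v unfolding reduce_def by auto
  have "(u, i) \<in> loops ?R" unfolding reduce_def by auto
  then have "\<exists>u i j. (u, i) \<in> loops ?R \<and> ((\<exists>w\<in>verts ?R - {u}. edges G = edges ?R \<union> {{u, v}, {w, v}} \<and>
        loops G = loops ?R - {(u, i)} \<union> {(v, j)}) \<or>
      (\<exists>k. k \<noteq> j \<and> edges G = edges ?R \<union> {{u, v}} \<and> loops G = loops ?R - {(u, i)} \<union> {(v, j), (v, k)}))"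
    using ext by meson
  then have "loop_one_extension ?R v G" unfolding loop_one_extension_def using R0 by (intro conjI) assumption+
  then show ?thesis
    using v R connR unfolding admissible_node_def is_node_def one_reduction_def by blast
qed

lemma fresh_loop: "looped_simple_graph G \<Longrightarrow> \<exists>i. (u, i) \<notin> loops G"
proof (rule ccontr)
  assume G: "looped_simple_graph G" and "\<nexists>i. (u, i) \<notin> loops G"
  then have "range (Pair u) \<subseteq> loops G" by auto
  then have "finite (range (Pair u :: nat \<Rightarrow> _))" using G finite_subset unfolding looped_simple_graph_def by blast
  then have "finite (UNIV :: nat set)" by (rule finite_imageD) (simp add: inj_on_def)
  then show False by simp
qed

section \<open>Consequences of balancedness\<close>

text \<open>Edges leave \<open>Z\<close> only into the deleted pair, so the component of
  \<open>z\<close> stays in \<open>Z\<close> and its loop lies there.\<close>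

lemma balanced_component_loop:
  assumes bal: "balanced G" and P: "P \<subseteq> verts G" "card P = 2" and z: "z \<in> verts G - P"
    and closed: "\<And>a b. a \<in> Z \<Longrightarrow> {a, b} \<in> edges G \<Longrightarrow> b \<in> Z \<union> P" and zZ: "z \<in> Z"
  shows "\<exists>l\<in>loops G. fst l \<in> Z - P"
proof -
  let ?A = "adjacency (delete_verts G P)"
  have reach: "b \<in> Z" if "(z, b) \<in> ?A\<^sup>*" for b
    using that
  proof induction
    case (step a b)
    then have "{a, b} \<in> edges G" "b \<notin> P" unfolding adjacency_def delete_verts_def by auto
    then show ?case using closed[OF step.IH] by blast
  qed (rule zZ)
  have "?A\<^sup>* `` {z} \<in> components (delete_verts G P)"
    unfolding components_def using z by (auto simp: delete_verts_def)
  then have "\<exists>(v, i)\<in>loops (delete_verts G P). v \<in> ?A\<^sup>* `` {z}"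
    using bal P unfolding balanced_def by blast
  then obtain v i where "(v, i) \<in> loops (delete_verts G P)" "(z, v) \<in> ?A\<^sup>*" by auto
  then show ?thesis using reach unfolding delete_verts_def by force
qed

text \<open>At most two neighbours extend to a pair outside \<open>Z\<close>, whose deletion
  isolates a loopless component.\<close>

lemma balanced_three_nbrs:
  assumes G: "looped_simple_graph G" and bal: "balanced G" and loop: "loops G \<noteq> {}"
    and Z: "Z \<subseteq> verts G" "Z \<noteq> {}" "\<And>l. l \<in> loops G \<Longrightarrow> fst l \<notin> Z" and big: "3 \<le> card (verts G)"
  shows "3 \<le> card {w. w \<notin> Z \<and> (\<exists>z\<in>Z. {z, w} \<in> edges G)}" (is "3 \<le> card ?N")
proof (rule ccontr)
  assume "\<not> ?thesis"
  then have N2: "card ?N \<le> 2" by simp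
  have fV: "finite (verts G)" using G unfolding looped_simple_graph_def by simp
  have NV: "?N \<subseteq> verts G - Z" using G unfolding looped_simple_graph_def by auto
  obtain l where l: "l \<in> loops G" using loop by auto
  then have y: "fst l \<in> verts G - Z" using G Z(3) unfolding looped_simple_graph_def by auto
  show False
  proof (cases "2 \<le> card (verts G - Z)")
    case True
    obtain P where P: "?N \<subseteq> P" "P \<subseteq> verts G - Z" "card P = 2"
      using exists_subset_between[OF N2 True NV] fV by auto
    obtain z where z: "z \<in> Z" using Z by auto
    have "\<exists>l\<in>loops G. fst l \<in> Z - P"
      by (rule balanced_component_loop[OF bal _ P(3) _ _ z]) (use P z Z in auto)
    then show False using Z(3) by blast
  next
    case False
    have "card (verts G - Z) \<noteq> 0" using y fV by auto
    then have "card (verts G - Z) = 1" using False by linarith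
    then have VZ: "verts G - Z = {fst l}" using y by (metis card_1_singletonE singletonD)
    have "card (verts G) = card (verts G - Z) + card Z"
      using card_Int_Diff[OF fV, of Z] Z(1) by (simp add: Int_absorb1)
    then have "2 \<le> card Z" using big VZ by simp
    obtain p where p: "p \<in> Z" using Z by auto
    have "\<not> Z \<subseteq> {p}" using card_mono[of "{p}" Z] \<open>2 \<le> card Z\<close> by auto
    then obtain z where z: "z \<in> Z" "z \<noteq> p" by auto
    \<comment> \<open>Only one vertex lies outside \<open>Z\<close>, so the second deleted vertex
      comes from \<open>Z\<close>; three vertices in all leave a further one in
      \<open>Z\<close>.\<close>
    let ?P = "{fst l, p}"
    have "\<exists>l\<in>loops G. fst l \<in> Z - ?P"
    proof (rule balanced_component_loop[OF bal _ _ _ _ z(1)])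
      have "fst l \<noteq> p" "fst l \<noteq> z" using y p z by auto
      then show "?P \<subseteq> verts G" "card ?P = 2" "z \<in> verts G - ?P" using y p Z(1) z by auto
      show "b \<in> Z \<union> ?P" if "a \<in> Z" "{a, b} \<in> edges G" for a b
      proof -
        have "b \<in> verts G" using that(2) G unfolding looped_simple_graph_def by auto
        then show ?thesis using VZ by auto
      qed
    qed
    then show False using Z(3) by blast
  qed
qed

text \<open>With three vertices, deleting two leaves a component that must carry a loop; on fewer, a
  loopless graph has at most one edge.\<close>

lemma balanced_has_loop:
  assumes G: "looped_simple_graph G" and bal: "balanced G" and two: "2 \<le> card (ground G)"
  shows "loops G \<noteq> {}"
proof
  assume L: "loops G = {}"
  have fV: "finite (verts G)" using G unfolding looped_simple_graph_def by simp
  show False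
  proof (cases "3 \<le> card (verts G)")
    case True
    then have "2 \<le> card (verts G)" by simp
    then obtain P where P: "P \<subseteq> verts G" "card P = 2" by (rule obtain_subset_with_card_n)
    have "\<not> verts G \<subseteq> P" using True P card_mono[of P "verts G"] finite_subset[OF P(1) fV] by auto
    then obtain z where z: "z \<in> verts G - P" by auto
    have "\<exists>l\<in>loops G. fst l \<in> UNIV - P"
      by (rule balanced_component_loop[OF bal P z]) auto
    then show False using L by simp
  next
    case False
    have "e = verts G" if "e \<in> edges G" for e
      using that G False card_seteq[OF fV, of e] unfolding looped_simple_graph_def by auto
    then have "ground G \<subseteq> {Inl (verts G)}" using L unfolding ground_def by auto
    then have "card (ground G) \<le> 1" using card_mono[of "{Inl (verts G)}" "ground G"] by simp
    then show False using two by simp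
  qed
qed

section \<open>An edge made redundant by a one-vertex ear\<close>

lemma connected_hub:
  assumes K: "lc_circuit K" "K \<subseteq> T"
    and hub: "\<And>a. a \<in> T \<Longrightarrow> \<exists>Q. lc_circuit Q \<and> Q \<subseteq> T \<and> a \<in> Q \<and> Q \<inter> K \<noteq> {}"
  shows "lc.connected_set T"
  unfolding lc.connected_set_def
proof (intro ballI impI)
  fix a b assume ab: "a \<in> T" "b \<in> T" "a \<noteq> b"
  obtain Q where Q: "lc_circuit Q" "Q \<subseteq> T" "a \<in> Q" "Q \<inter> K \<noteq> {}" using hub[OF ab(1)] by auto
  obtain R where R: "lc_circuit R" "R \<subseteq> T" "b \<in> R" "R \<inter> K \<noteq> {}" using hub[OF ab(2)] by auto
  have "lc.connected_set (K \<union> Q \<union> R)"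
    by (intro lc.connected_Un_circuit lc.connected_circuit) (use K Q R in auto)
  moreover have "a \<in> K \<union> Q \<union> R" "b \<in> K \<union> Q \<union> R" using Q R by auto
  ultimately obtain C where C: "lc_circuit C" "C \<subseteq> K \<union> Q \<union> R" "a \<in> C" "b \<in> C"
    using ab(3) unfolding lc.connected_set_def by metis
  then have "C \<subseteq> T" using K(2) Q(2) R(2) by auto
  then show "\<exists>C. lc_circuit C \<and> C \<subseteq> T \<and> a \<in> C \<and> b \<in> C" using C by auto
qed

context lobe
begin

text \<open>The lobe turns \<open>H\<close> into the 1-extension of \<open>H\<close> at the edge \<open>pq\<close> together with \<open>pq\<close> itself,
  and 1-extensions preserve connectivity.\<close>
lemma edge_redundant:
  assumes D: "D = {Inl {v, p}, Inl {v, q}, Inl {v, r}}" and card3: "card D = 3"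
    and v: "v \<notin> Y" and e: "Inl {p, q} \<in> H" and r: "r \<in> Y" "r \<noteq> p" "r \<noteq> q"
  shows "lc.connected_set (H \<union> D - {Inl {p, q}})"
proof -
  let ?e = "Inl {p, q} :: 'a element"
  have Hne: "H \<noteq> {}" using e by auto
  have DC: "D \<subset> C" using meets[OF Hne] circuit disjoint by blast
  have Hc: "lc.connected_set H" using full unfolding full_connected_def by simp
  \<comment> \<open>A circuit through an element at \<open>r\<close> keeps \<open>r\<close> among
    its vertices after \<open>pq\<close> is removed, so \<open>v\<close> will be the only new
    vertex.\<close>
  obtain g where g: "g \<in> H" "r \<in> ends g" using r unfolding Y_def incident_verts_def by auto
  have "g \<noteq> ?e" using g r by auto
  then obtain C1 where C1: "lc_circuit C1" "C1 \<subseteq> H" "?e \<in> C1" "g \<in> C1"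
    using Hc g e unfolding lc.connected_set_def by metis
  have vC1: "v \<notin> incident_verts C1" using incident_verts_mono[OF C1(2)] v unfolding Y_def by auto
  have fC1: "finite C1" "finite (incident_verts C1)"
    using circuit_card(3)[OF C1(1)] finite_incident_verts[OF circuit_wf[OF C1(1)]] by auto
  let ?K = "C1 - {?e} \<union> D"
  have DI: "D \<subseteq> range Inl" using D by auto
  have C1D: "C1 \<inter> D = {}" using C1 disjoint by blast
  have wK: "wf_elements ?K" using circuit_wf[OF C1(1)] wf_parts(2) wf_elements_subset[of C1 "C1 - {?e}"] by auto
  have "incident_verts ?K = insert v (incident_verts C1)"
  proof -
    have "incident_verts C1 = {p, q} \<union> incident_verts (C1 - {?e})"
      using C1(3) incident_verts_insert[of ?e "C1 - {?e}"] by (simp add: insert_absorb)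
    moreover have "r \<in> incident_verts (C1 - {?e})"
      using g C1 \<open>g \<noteq> ?e\<close> unfolding incident_verts_def by auto
    ultimately show ?thesis unfolding D by auto
  qed
  then have bK: "bound ?K = bound C1 + 2"
    using vC1 fC1 C1(3) DI unfolding bound_def by auto
  have "card ?K = card (C1 - {?e}) + card D"
    by (rule card_Un_disjoint) (use fC1 finite_facts C1D in auto)
  moreover have "card (C1 - {?e}) + 1 = card C1" using card_Suc_Diff1[OF fC1(1) C1(3)] by simp
  ultimately have "card ?K = card C1 + 2" using card3 by simp
  then have "bound ?K < int (card ?K)" using circuit_card(1)[OF C1(1)] bK by simp
  then obtain Q where Q: "Q \<subseteq> ?K" "lc_circuit Q"
    using overfull_circuit[OF wK] D by blast
  \<comment> \<open>Outside \<open>D\<close>, \<open>Q\<close> is a proper part of the circuit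
    \<open>C1\<close> and misses \<open>v\<close>, so the counts require all three elements of
    \<open>D\<close>. Then \<open>pq\<close> with \<open>Q - D\<close> is overfull inside
    \<open>C1\<close>, hence all of it.\<close>
  have "Q = ?K"
  proof -
    let ?Q0 = "Q - D"
    have Q0C: "?Q0 \<subset> C1" using Q C1 by blast
    have fQ: "finite Q" "finite (incident_verts Q)"
      using circuit_card(3)[OF Q(2)] finite_incident_verts[OF circuit_wf[OF Q(2)]] by auto
    have QD: "Q \<inter> D \<noteq> {}"
    proof
      assume "Q \<inter> D = {}"
      then have "Q \<subset> C1" using Q0C by blast
      then show False using Q(2) C1(1) unfolding lc_circuit_def by blast
    qed
    have Q0ne: "?Q0 \<noteq> {}"
    proof
      assume "?Q0 = {}"
      then have "Q \<subset> C" using DC by blast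
      then show False using Q(2) circuit(1) unfolding lc_circuit_def by blast
    qed
    obtain d where d: "d \<in> Q" "d \<in> D" using QD by blast
    then have "v \<in> ends d" unfolding D by auto
    then have vQ: "v \<in> incident_verts Q" using d(1) unfolding incident_verts_def by blast
    have drop: "bound F + 2 \<le> bound Q"
      if "incident_verts F \<subseteq> incident_verts Q - {v}" "F \<subseteq> range Inl \<longleftrightarrow> Q \<subseteq> range Inl" for F
    proof -
      have "card (incident_verts F) \<le> card (incident_verts Q - {v})" by (rule card_mono[OF _ that(1)]) (use fQ in simp)
      moreover have "card (incident_verts Q - {v}) + 1 = card (incident_verts Q)"
        using card_Suc_Diff1[OF fQ(2) vQ] by simp
      ultimately show ?thesis using that(2) unfolding bound_def by auto
    qed
    have v0: "v \<notin> incident_verts ?Q0" using vC1 incident_verts_mono[of ?Q0 C1] Q0C by blast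
    have Q0V: "incident_verts ?Q0 \<subseteq> incident_verts Q - {v}"
      using incident_verts_mono[of ?Q0 Q] v0 by auto
    have loopy: "?Q0 \<subseteq> range Inl \<longleftrightarrow> Q \<subseteq> range Inl" using DI by blast
    have "int (card ?Q0) \<le> bound ?Q0" by (rule circuit_proper[OF C1(1) Q0C Q0ne])
    moreover have cQ: "card Q = card (Q \<inter> D) + card ?Q0" by (rule card_Int_Diff[OF fQ(1)])
    ultimately have "3 \<le> card (Q \<inter> D)"
      using drop[OF Q0V loopy] circuit_card(1)[OF Q(2)] by linarith
    then have "card D \<le> card (Q \<inter> D)" using card3 by simp
    then have QDe: "Q \<inter> D = D" by (intro card_seteq finite_facts) auto
    let ?Q1 = "insert ?e ?Q0"
    have pq: "p \<in> incident_verts Q - {v}" "q \<in> incident_verts Q - {v}"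
    proof -
      have "Inl {v, p} \<in> Q" "Inl {v, q} \<in> Q" using QDe D by auto
      moreover have "p \<in> Y" "q \<in> Y" using e unfolding Y_def incident_verts_def by force+
      ultimately show "p \<in> incident_verts Q - {v}" "q \<in> incident_verts Q - {v}"
        using v unfolding incident_verts_def by force+
    qed
    have "bound ?Q1 + 2 \<le> bound Q"
      by (rule drop) (use pq Q0V loopy in auto)
    moreover have "card ?Q1 = card ?Q0 + 1" using Q C1D fQ C1(3) by (subst card_insert_disjoint) auto
    ultimately have "bound ?Q1 < int (card ?Q1)"
      using cQ QDe card3 circuit_card(1)[OF Q(2)] by simp
    moreover have Q1C: "?Q1 \<subseteq> C1" using Q0C C1(3) by blast
    ultimately obtain Q2 where Q2: "Q2 \<subseteq> ?Q1" "lc_circuit Q2"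
      using overfull_circuit[OF wf_elements_subset[OF circuit_wf[OF C1(1)] Q1C]] by blast
    then have "Q2 = C1" using lc.circ_clutter[OF Q2(2) C1(1)] Q1C by blast
    then show ?thesis using Q2(1) QDe Q(1) by blast
  qed
  then have K: "lc_circuit ?K" using Q by simp
  show ?thesis
  proof (rule connected_hub[OF K])
    show "?K \<subseteq> H \<union> D - {?e}" using C1 e disjoint by blast
    fix a assume a: "a \<in> H \<union> D - {?e}"
    show "\<exists>Q. lc_circuit Q \<and> Q \<subseteq> H \<union> D - {?e} \<and> a \<in> Q \<and> Q \<inter> ?K \<noteq> {}"
    proof (cases "a \<in> ?K")
      case True
      then show ?thesis using K C1 e disjoint by blast
    next
      case False
      then have aH: "a \<in> H" "a \<noteq> ?e" "a \<notin> C1" using a by auto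
      then obtain Ca where Ca: "lc_circuit Ca" "Ca \<subseteq> H" "a \<in> Ca" "?e \<in> Ca"
        using Hc e unfolding lc.connected_set_def by metis
      \<comment> \<open>Strong elimination drops \<open>pq\<close> and keeps \<open>a\<close>; a
        result disjoint from \<open>C1\<close> would be a circuit properly inside
        \<open>Ca\<close>.\<close>
      obtain Q where Q: "lc_circuit Q" "a \<in> Q" "Q \<subseteq> Ca \<union> C1 - {?e}"
        using lc.strong_elim[OF Ca(1) C1(1) Ca(4) C1(3) Ca(3) aH(3)] by blast
      have "Q \<inter> C1 \<noteq> {}"
      proof
        assume "Q \<inter> C1 = {}"
        then have "Q \<subset> Ca" using Q Ca by blast
        then show False using Q(1) Ca(1) unfolding lc_circuit_def by blast
      qed
      then have "Q \<inter> ?K \<noteq> {}" using Q by blast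
      moreover have "Q \<subseteq> H \<union> D - {?e}" using Q Ca C1 by blast
      ultimately show ?thesis using Q by blast
    qed
  qed
qed

end

subsection \<open>An admissible node in the last ear\<close>

locale graph_lobe = lobe H B D C for H B D C :: "'a element set" +
  fixes G :: "'a looped_graph"
  assumes simple: "looped_simple_graph G" and bal: "balanced G"
    and ground_HD: "ground G = H \<union> D" and two: "2 \<le> card D" and loops_ne: "loops G \<noteq> {}"
begin

definition E :: "'a set set" where "E = {e. Inl e \<in> D}"
definition lam :: "'a \<Rightarrow> nat" where "lam x = card {i. (x, i) \<in> loops G}"

lemma E_iff: "e \<in> E \<longleftrightarrow> Inl e \<in> D" unfolding E_def by simp

lemma X_Y: "X \<inter> Y = {}" unfolding X_def by auto

lemma X_verts: "X \<subseteq> verts G" "Y \<subseteq> verts G"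
  using ends_ground[OF simple] ground_HD unfolding X_def Y_def incident_verts_def by blast+

lemma D_at_X: "d \<in> ground G \<Longrightarrow> x \<in> ends d \<Longrightarrow> x \<in> X \<Longrightarrow> d \<in> D"
  using X_Y ground_HD unfolding Y_def incident_verts_def by blast

lemma E_edges: "E \<subseteq> edges G"
  using ground_HD in_ground(1)[of _ G] unfolding E_def by blast

lemma E_at_X: "e \<in> edges G \<Longrightarrow> x \<in> e \<Longrightarrow> x \<in> X \<Longrightarrow> e \<in> E"
  using D_at_X[of "Inl e" x] unfolding E_def by simp

lemma star_eq: "x \<in> X \<Longrightarrow> {d \<in> ground G. x \<in> ends d} = {d \<in> D. x \<in> ends d}"
  using D_at_X ground_HD by blast

lemma nonstar_eq: "x \<in> X \<Longrightarrow> {d \<in> ground G. x \<notin> ends d} = H \<union> {d \<in> D. x \<notin> ends d}"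
  using X_Y ground_HD unfolding Y_def incident_verts_def by auto

sublocale wg: weighted_graph "X \<union> Y" E lam
proof
  show "finite (X \<union> Y)" using finite_facts by simp
  show "e \<subseteq> X \<union> Y" if "e \<in> E" for e
    using that D_verts unfolding E_def incident_verts_def by force
  show "card e = 2" if "e \<in> E" for e
    using that wf_parts(2) unfolding E_def wf_elements_def by blast
qed

text \<open>At vertices of \<open>X\<close> every element of the graph belongs to \<open>D\<close>,
  so the loops of \<open>G\<close> counted by \<open>lam\<close> are loops of the ear.\<close>

lemma card_touch:
  assumes Z: "Z \<subseteq> X"
  shows "card {d \<in> D. ends d \<inter> Z \<noteq> {}} = wg.touch_count Z"
proof -
  have fZ: "finite Z" using Z finite_facts finite_subset by blast
  have fin: "finite {i. (z, i) \<in> loops G}" for z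
    by (rule finite_subset[of _ "snd ` loops G"]) (use simple in \<open>force simp: looped_simple_graph_def\<close>)+
  let ?L = "Sigma Z (\<lambda>z. {i. (z, i) \<in> loops G})"
  have "{d \<in> D. ends d \<inter> Z \<noteq> {}} = Inl ` wg.touching Z \<union> Inr ` ?L" (is "?S = _")
  proof
    show "?S \<subseteq> Inl ` wg.touching Z \<union> Inr ` ?L"
    proof
      fix d assume d: "d \<in> ?S"
      show "d \<in> Inl ` wg.touching Z \<union> Inr ` ?L"
      proof (cases d)
        case (Inl e)
        then have "e \<in> wg.touching Z" using d unfolding wg.touching_def by (simp add: E_iff)
        then show ?thesis using Inl by blast
      next
        case (Inr l)
        then have "l \<in> loops G" "fst l \<in> Z" using d ground_HD in_ground(2)[of l G] by (auto, cases l, auto)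
        then have "l \<in> ?L" by (cases l) auto
        then show ?thesis using Inr by blast
      qed
    qed
    show "Inl ` wg.touching Z \<union> Inr ` ?L \<subseteq> ?S"
    proof
      fix d assume "d \<in> Inl ` wg.touching Z \<union> Inr ` ?L"
      then show "d \<in> ?S"
      proof
        assume "d \<in> Inr ` ?L"
        then obtain z i where "z \<in> Z" "d = Inr (z, i)" "(z, i) \<in> loops G" by auto
        then show ?thesis using D_at_X[of d z] Z by auto
      qed (auto simp: wg.touching_def E_iff)
    qed
  qed
  then have "?S = wg.touching Z <+> ?L" unfolding Plus_def .
  moreover have "finite ?L" using fZ fin by blast
  ultimately have "card ?S = card (wg.touching Z) + card ?L" by (simp add: card_Plus)
  moreover have "card ?L = sum lam Z" unfolding lam_def using fZ fin by (simp add: card_SigmaI)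
  ultimately show ?thesis unfolding wg.touch_count_def by simp
qed

lemma D_all: "{d \<in> D. ends d \<inter> X \<noteq> {}} = D"
  using touches_X[OF two] by auto

lemma connected_lobe_holds:
  assumes X2: "2 \<le> card X"
  shows "connected_lobe (X \<union> Y) E lam X"
proof
  show "X \<subseteq> X \<union> Y" by simp
  show "2 \<le> card X" by (rule X2)
  show tl: "2 * card Z + 1 \<le> wg.touch_count Z" if "Z \<subseteq> X" "Z \<noteq> {}" for Z
    using touch_lower[OF that] card_touch[OF that(1)] by simp
  show "wg.touch_count X = 2 * card X + 1"
    using card_touch[OF order_refl] D_all card_D by simp
  show "card (wg.inside W) + 3 \<le> 2 * card W" if W: "W \<subseteq> X \<union> Y" "2 \<le> card W" for W
  proof (cases "wg.inside W = {}")
    case False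
    have "card (Inl ` wg.inside W :: 'a element set) + 3 \<le> 2 * card (incident_verts (Inl ` wg.inside W))"
    proof (rule edges_sparse)
      have "wg.inside W \<subseteq> E" unfolding wg.inside_def by auto
      then show "Inl ` wg.inside W \<subseteq> D" unfolding E_def by auto
    qed (use False in auto)
    moreover have "card (Inl ` wg.inside W :: 'a element set) = card (wg.inside W)" by (rule card_image) simp
    moreover have "card (incident_verts (Inl ` wg.inside W)) \<le> card W"
      using W finite_facts finite_subset[OF W(1)] by (intro card_mono) (auto simp: incident_verts_def wg.inside_def)
    ultimately show ?thesis by linarith
  qed (use W in simp)
  show "3 \<le> card (\<Union> (wg.nbrs ` Z) - Z)" if Z: "Z \<subseteq> X" "Z \<noteq> {}" "\<And>z. z \<in> Z \<Longrightarrow> lam z = 0" for Z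
  proof -
    obtain z where z: "z \<in> Z" using Z by auto
    \<comment> \<open>A loopless vertex of \<open>X\<close> has three neighbours, which provides the
      three vertices required by \<open>balanced_three_nbrs\<close>.\<close>
    have "3 \<le> wg.touch_count {z}" using tl[of "{z}"] z Z by auto
    then have "3 \<le> card (wg.nbrs z)" using wg.touch_count_single Z(3)[OF z] by simp
    also have "\<dots> \<le> card (verts G)"
      using wg.nbrs_sub X_verts simple unfolding looped_simple_graph_def by (intro card_mono) auto
    finally have big: "3 \<le> card (verts G)" .
    have nol: "fst l \<notin> Z" if "l \<in> loops G" for l
    proof
      assume l: "fst l \<in> Z"
      have "finite {i. (fst l, i) \<in> loops G}"
        by (rule finite_subset[of _ "snd ` loops G"]) (use simple in \<open>force simp: looped_simple_graph_def\<close>)+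
      moreover have "snd l \<in> {i. (fst l, i) \<in> loops G}" using that by simp
      ultimately have "lam (fst l) \<noteq> 0" unfolding lam_def using card_0_eq by blast
      then show False using Z(3)[OF l] by simp
    qed
    have "\<Union> (wg.nbrs ` Z) - Z = {w. w \<notin> Z \<and> (\<exists>z\<in>Z. {z, w} \<in> edges G)}"
    proof -
      have "wg.nbrs z = {w. {z, w} \<in> edges G}" if "z \<in> Z" for z
        using E_at_X[of _ z] E_edges that Z(1) unfolding wg.nbrs_def by blast
      then show ?thesis by auto
    qed
    moreover have "Z \<subseteq> verts G" using Z(1) X_verts by blast
    ultimately show ?thesis
      using balanced_three_nbrs[OF simple bal loops_ne _ Z(2) nol big] by simp
  qed
  show "X = X \<union> Y \<or> (\<exists>e\<in>E. \<not> e \<subseteq> X)"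
  proof (cases "H = {}")
    case True
    then show ?thesis unfolding Y_def by simp
  next
    case False
    then obtain d y where d: "d \<in> D" "y \<in> ends d" "y \<in> Y" using D_meets_Y unfolding incident_verts_def by auto
    obtain x where x: "x \<in> ends d" "x \<in> X" using touches_X[OF two d(1)] by auto
    then have "x \<noteq> y" using d X_Y by auto
    then obtain e where "d = Inl e" using x d by (cases d) auto
    then show ?thesis using d X_Y unfolding E_def by auto
  qed
qed

end

section \<open>Ears with at least two new vertices\<close>

locale large_graph_lobe = graph_lobe +
  assumes X_two: "2 \<le> card X"
begin

sublocale cl: connected_lobe "X \<union> Y" E lam X
  by (rule connected_lobe_holds[OF X_two])

abbreviation rest :: "'a \<Rightarrow> 'a element set" where
  "rest v \<equiv> {d \<in> D. v \<notin> ends d}"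

lemma card_rest_touch:
  assumes v: "v \<in> X" and A: "A \<subseteq> X - {v}"
  shows "card {d \<in> rest v. ends d \<inter> A \<noteq> {}} + card (wg.nbrs v \<inter> A) = wg.touch_count A"
proof -
  let ?T = "{d \<in> D. ends d \<inter> A \<noteq> {}}" and ?S = "{d \<in> D. v \<in> ends d \<and> ends d \<inter> A \<noteq> {}}"
  have vA: "v \<notin> A" using A by auto
  have "?S = Inl ` {e \<in> E. v \<in> e \<and> e \<inter> A \<noteq> {}}"
  proof
    show "?S \<subseteq> Inl ` {e \<in> E. v \<in> e \<and> e \<inter> A \<noteq> {}}"
    proof
      fix d assume d: "d \<in> ?S"
      then obtain e where "d = Inl e" using vA by (cases d) auto
      then show "d \<in> Inl ` {e \<in> E. v \<in> e \<and> e \<inter> A \<noteq> {}}" using d by (auto simp: E_iff)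
    qed
  qed (auto simp: E_iff)
  then have "card ?S = card {e \<in> E. v \<in> e \<and> e \<inter> A \<noteq> {}}" by (simp add: card_image)
  then have S: "card ?S = card (wg.nbrs v \<inter> A)" using wg.card_star[OF vA] by simp
  have "?T = {d \<in> rest v. ends d \<inter> A \<noteq> {}} \<union> ?S" "{d \<in> rest v. ends d \<inter> A \<noteq> {}} \<inter> ?S = {}" by auto
  then have "card ?T = card {d \<in> rest v. ends d \<inter> A \<noteq> {}} + card ?S"
    using card_Un_disjoint[of "{d \<in> rest v. ends d \<inter> A \<noteq> {}}" ?S] finite_facts by simp
  moreover have "card ?T = wg.touch_count A" using card_touch A by blast
  ultimately show ?thesis using S by simp
qed

text \<open>An instance of \<open>reattach\<close> for \<open>X - {v}\<close>: the three clauses of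
  \<open>good_reduction\<close> yield the lower counts, the sparsity of loopless sets containing
  \<open>g\<close>, and the contact with \<open>Y\<close>.\<close>

lemma good_reattach:
  assumes v: "cl.node v" and f: "f \<subseteq> wg.nbrs v" "f \<noteq> {}" and good: "cl.good_reduction v f"
    and g: "ends g = f" "g \<notin> H \<union> D" "wf_elements {g}"
  shows "lc.connected_set (H \<union> insert g (rest v))"
proof (rule reattach)
  have vX: "v \<in> X" and t3: "wg.touch_count {v} = 3" using v unfolding cl.node_def by auto
  have vY: "v \<notin> Y" using vX X_Y by auto
  have gr: "2 * card A + 1 + card (wg.nbrs v \<inter> A) \<le> wg.touch_count A + (if f \<inter> A \<noteq> {} then 1 else 0)"
    if "A \<subseteq> X - {v}" "A \<noteq> {}" for A
    using good that unfolding cl.good_reduction_def by blast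
  have vf: "v \<notin> f" using f by auto
  show "wf_elements (insert g (rest v))"
    using g(3) wf_elements_subset[OF wf_parts(2), of "rest v"] wf_elements_Un[of "{g}" "rest v"] by auto
  show "H \<inter> insert g (rest v) = {}" using g disjoint by auto
  have "incident_verts (rest v) \<subseteq> (X - {v}) \<union> Y"
    using D_verts unfolding incident_verts_def by auto
  moreover have "f \<subseteq> (X - {v}) \<union> Y" using f wg.nbrs_sub vf by blast
  ultimately show "incident_verts (insert g (rest v)) \<subseteq> (X - {v}) \<union> Y" using g by simp
  show "finite (X - {v})" "(X - {v}) \<inter> Y = {}" using finite_facts X_Y by auto
  have cX: "card (X - {v}) + 1 = card X" using card_Suc_Diff1[OF finite_facts(4) vX] by simp
  have "card {d \<in> D. ends d \<inter> {v} \<noteq> {}} = 3" using card_touch[of "{v}"] vX t3 by simp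
  moreover have "{d \<in> D. ends d \<inter> {v} \<noteq> {}} = D - rest v" by auto
  moreover have "card D = card (rest v) + card (D - rest v)"
    using card_Int_Diff[OF finite_facts(2), of "rest v"] by (simp add: Int_absorb1)
  ultimately have cr: "card (rest v) + 3 = card D" by simp
  have gin: "g \<notin> rest v" using g by auto
  have frest: "finite (rest v)" using finite_facts by auto
  show "card (insert g (rest v)) = 2 * card (X - {v}) + 1"
    using gin frest cr card_D cX by simp
  show "2 * card A + 1 \<le> card {d \<in> insert g (rest v). ends d \<inter> A \<noteq> {}}" if A: "A \<subseteq> X - {v}" "A \<noteq> {}" for A
  proof (cases "f \<inter> A = {}")
    case True
    then have "{d \<in> insert g (rest v). ends d \<inter> A \<noteq> {}} = {d \<in> rest v. ends d \<inter> A \<noteq> {}}" using g by auto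
    then show ?thesis using gr[OF A] card_rest_touch[OF vX A(1)] True by simp
  next
    case False
    then have "{d \<in> insert g (rest v). ends d \<inter> A \<noteq> {}} = insert g {d \<in> rest v. ends d \<inter> A \<noteq> {}}" using g by auto
    moreover have "card (insert g {d \<in> rest v. ends d \<inter> A \<noteq> {}}) = card {d \<in> rest v. ends d \<inter> A \<noteq> {}} + 1"
      using g(2) finite_facts by simp
    ultimately show ?thesis using gr[OF A] card_rest_touch[OF vX A(1)] False by simp
  qed
  show "card F + 3 \<le> 2 * card (incident_verts F)"
    if F: "F \<subseteq> insert g (rest v)" "F \<subseteq> range Inl" "F \<noteq> {}" for F
  proof (cases "g \<in> F")
    case False
    then have "F \<subseteq> D" using F(1) by auto
    then show ?thesis by (rule edges_sparse[OF _ F(2,3)])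
  next
    case True
    let ?W = "incident_verts F"
    obtain e where ge: "g = Inl e" using True F by auto
    then have f2: "card f = 2" and ef: "e = f" using g unfolding wf_elements_def by auto
    have WV: "?W \<subseteq> (X - {v}) \<union> Y"
      using incident_verts_mono[OF F(1)] \<open>incident_verts (insert g (rest v)) \<subseteq> (X - {v}) \<union> Y\<close> by auto
    have fW: "f \<subseteq> ?W" using True g unfolding incident_verts_def by auto
    have finW: "finite ?W" using WV finite_facts finite_subset[OF WV] by auto
    have W2: "2 \<le> card ?W" using card_mono[OF finW fW] f2 by simp
    \<comment> \<open>A critical \<open>?W\<close> would have to contain \<open>v\<close>, so the
      induced edges stay below the bound and leave room for \<open>g\<close>.\<close>
    have "\<not> cl.critical ?W"
      using good f2 fW WV vY unfolding cl.good_reduction_def by auto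
    then have "card (wg.inside ?W) + 3 \<noteq> 2 * card ?W" using W2 WV unfolding cl.critical_def by auto
    moreover have "card (wg.inside ?W) + 3 \<le> 2 * card ?W" by (rule cl.sparse) (use WV W2 in auto)
    moreover have "F - {g} \<subseteq> Inl ` wg.inside ?W"
    proof
      fix d assume d: "d \<in> F - {g}"
      then obtain e' where "d = Inl e'" using F by auto
      then show "d \<in> Inl ` wg.inside ?W"
        using d F(1) unfolding wg.inside_def incident_verts_def by (force simp: E_iff)
    qed
    then have "card (F - {g}) \<le> card (wg.inside ?W)"
      using card_mono[of "Inl ` wg.inside ?W" "F - {g}"] by (simp add: card_image)
    moreover have "finite F" using F(1) frest finite_subset by blast
    then have "card F = card (F - {g}) + 1" using card_Suc_Diff1[OF _ True] by simp
    ultimately show ?thesis by linarith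
  qed
  show "incident_verts (insert g (rest v)) \<inter> Y \<noteq> {}" if H: "H \<noteq> {}"
  proof -
    have "Y \<noteq> {}" using D_meets_Y[OF H] by auto
    then have "X \<noteq> X \<union> Y" using X_Y by auto
    then consider e where "e \<in> E" "\<not> e \<subseteq> X" "v \<notin> e" | "\<not> f \<subseteq> X"
      using good unfolding cl.good_reduction_def by auto
    then show ?thesis
    proof cases
      case 1
      then have "Inl e \<in> rest v" "\<exists>y\<in>e. y \<in> Y" using wg.edge_sub[of e] by (auto simp: E_iff)
      then show ?thesis unfolding incident_verts_def by force
    next
      case 2
      then show ?thesis using f wg.nbrs_sub g by auto
    qed
  qed
qed

text \<open>Otherwise the count for \<open>X - {v}\<close> would fail by exactly one, because
  \<open>X\<close> attains its bound. This keeps the new edge from duplicating an edge of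
  \<open>H\<close>.\<close>

lemma good_meets_X:
  assumes v: "cl.node v" and f: "f \<subseteq> wg.nbrs v" and good: "cl.good_reduction v f"
  shows "f \<inter> X \<noteq> {}"
proof
  assume fX: "f \<inter> X = {}"
  have vX: "v \<in> X" and t3: "wg.touch_count {v} = 3" using v unfolding cl.node_def by auto
  have c: "card (X - {v}) + 1 = card X" using card_Suc_Diff1[OF finite_facts(4) vX] by simp
  then have "X - {v} \<noteq> {}" using X_two by (metis One_nat_def add_0 card.empty not_less_eq_eq numeral_2_eq_2 order_refl)
  then have "2 * card (X - {v}) + 1 + card (wg.nbrs v \<inter> (X - {v})) \<le> wg.touch_count (X - {v}) + (if f \<inter> (X - {v}) \<noteq> {} then 1 else 0)"
    using good unfolding cl.good_reduction_def by blast
  moreover have "f \<inter> (X - {v}) = {}" using fX by auto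
  moreover have "wg.touch_count (insert v (X - {v})) + card (wg.nbrs v \<inter> (X - {v})) = wg.touch_count (X - {v}) + 3"
    using wg.touch_count_insert[of v "X - {v}"] t3 finite_facts by simp
  moreover have "insert v (X - {v}) = X" using vX by auto
  ultimately show False using cl.touch_X c by simp
qed

lemma admissible_node_exists: "\<exists>v. admissible_node G v"
proof -
  obtain v f where v: "cl.node v" and f: "f \<subseteq> wg.nbrs v" and cf: "card f = 2 \<or> (card f = 1 \<and> 1 \<le> lam v)"
    and good: "cl.good_reduction v f"
    using cl.good_reduction_exists by blast
  have vX: "v \<in> X" and t3: "wg.touch_count {v} = 3" using v unfolding cl.node_def by auto
  have vG: "v \<in> verts G" using vX X_verts by auto
  have "card {d \<in> D. ends d \<inter> {v} \<noteq> {}} = 3" using card_touch[of "{v}"] vX t3 by simp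
  then have deg: "card {d \<in> ground G. v \<in> ends d} = 3" using star_eq[OF vX] by simp
  have nb: "{v, u} \<in> edges G" if "u \<in> f" for u
    using that f E_edges unfolding wg.nbrs_def by auto
  have fne: "f \<noteq> {}" using cf by auto
  have conn: "lc.connected_set (insert g {d \<in> ground G. v \<notin> ends d})"
    if "ends g = f" "g \<notin> H \<union> D" "wf_elements {g}" for g
    using good_reattach[OF v f fne good that] nonstar_eq[OF vX] by simp
  from cf show ?thesis
  proof
    assume f2: "card f = 2"
    then obtain p q where pq: "f = {p, q}" "p \<noteq> q" by (meson card_2_iff)
    \<comment> \<open>The ends of an existing edge form a critical set, as
      \<open>1 = 2 * 2 - 3\<close>, and a good reduction excludes that.\<close>
    have "Inl f \<notin> D"
    proof
      assume "Inl f \<in> D"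
      then have "f \<in> E" by (simp add: E_iff)
      then have "f \<in> wg.inside f" unfolding wg.inside_def by simp
      then have "card (wg.inside f) \<ge> 1" by (metis One_nat_def Suc_leI card_gt_0_iff empty_iff wg.finite_inside)
      moreover have "f \<subseteq> X \<union> Y" using f wg.nbrs_sub by blast
      then have "card (wg.inside f) + 3 \<le> 2 * card f" by (rule cl.sparse) (use f2 in simp)
      ultimately have "cl.critical f" using f2 \<open>f \<subseteq> X \<union> Y\<close> unfolding cl.critical_def by simp
      then have "v \<in> f" using good f2 unfolding cl.good_reduction_def by blast
      then show False using f by auto
    qed
    moreover have "Inl f \<notin> H"
    proof
      assume "Inl f \<in> H"
      then have "f \<subseteq> Y" unfolding Y_def incident_verts_def by force
      then show False using good_meets_X[OF v f good] X_Y by auto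
    qed
    ultimately have nin: "Inl f \<notin> H \<union> D" by simp
    then have "f \<notin> edges G" using ground_HD in_ground(1)[of f G] by simp
    moreover have "lc.connected_set (insert (Inl f) {d \<in> ground G. v \<notin> ends d})"
      by (rule conn) (use nin f2 in \<open>auto simp: wf_elements_def\<close>)
    ultimately have "admissible_node G v"
      using admissible_node_edge[OF simple vG deg nb nb pq(2)] pq by simp
    then show ?thesis by blast
  next
    assume a: "card f = 1 \<and> 1 \<le> lam v"
    then obtain u where u: "f = {u}" by (meson card_1_singletonE)
    have "card {j. (v, j) \<in> loops G} \<noteq> 0" using a unfolding lam_def by linarith
    then have "{j. (v, j) \<in> loops G} \<noteq> {}" by (metis card.empty)
    then obtain j where j: "(v, j) \<in> loops G" by auto
    obtain i where i: "(u, i) \<notin> loops G" using fresh_loop[OF simple] by blast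
    then have "Inr (u, i) \<notin> H \<union> D" using ground_HD in_ground(2)[of "(u, i)" G] by simp
    then have "lc.connected_set (insert (Inr (u, i)) {d \<in> ground G. v \<notin> ends d})"
      by (intro conn) (use u in \<open>auto simp: wf_elements_def\<close>)
    then have "admissible_node G v"
      using admissible_node_loop[OF simple vG deg nb j i] u by simp
    then show ?thesis by blast
  qed
qed

end

section \<open>Ears with one new vertex\<close>

context graph_lobe
begin

lemma single_vertex:
  assumes X: "X = {v}" and K: "\<not> is_K1_3 (drop_isolated G)"
  shows "(\<exists>f. admissible_element G f) \<or> (\<exists>v. admissible_node G v)"
proof -
  have c3: "card D = 3" using card_D X by simp
  have vX: "v \<in> X" using X by simp
  have vG: "v \<in> verts G" and vY: "v \<notin> Y" using vX X_verts X_Y by auto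
  have allv: "v \<in> ends d" if "d \<in> D" for d using touches_X[OF two that] X by auto
  then have star: "{d \<in> ground G. v \<in> ends d} = D" using star_eq[OF vX] by auto
  have nonstar: "{d \<in> ground G. v \<notin> ends d} = H" using nonstar_eq[OF vX] allv by auto
  have deg: "card {d \<in> ground G. v \<in> ends d} = 3" using star c3 by simp
  have edge: "\<exists>y\<in>Y. d = Inl {v, y}" if d: "d \<in> D" "d \<in> range Inl" for d
  proof -
    obtain e where e: "d = Inl e" using d by auto
    then have "e \<in> E" using d by (simp add: E_iff)
    then obtain y where "y \<noteq> v" "e = {v, y}" "y \<in> wg.nbrs v" using wg.edge_at[of e v] allv[OF d(1)] e by auto
    then show ?thesis using e wg.nbrs_sub X by auto
  qed
  \<comment> \<open>With no vertex outside \<open>Y\<close>, an ear has \<open>2 * 0 + 1\<close>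
    elements.\<close>
  have reconnect: "lc.connected_set (insert g {d \<in> ground G. v \<notin> ends d})"
    if g: "ends g \<subseteq> Y" "ends g \<noteq> {}" "g \<notin> ground G" "wf_elements {g}" for g
  proof -
    have "lc.connected_set (H \<union> {g})"
    proof (rule reattach[where X' = "{}"])
      show "card F + 3 \<le> 2 * card (incident_verts F)" if F: "F \<subseteq> {g}" "F \<subseteq> range Inl" "F \<noteq> {}" for F
      proof -
        obtain e where "F = {Inl e}" "g = Inl e" using F by auto
        then show ?thesis using g unfolding wf_elements_def by simp
      qed
    qed (use g ground_HD in auto)
    then show ?thesis using nonstar by simp
  qed
  show ?thesis
  proof (cases "H = {}")
    case True
    then have Y0: "Y = {}" unfolding Y_def by simp
    then have nE: "d \<notin> range Inl" if "d \<in> D" for d using edge[OF that] by auto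
    have gD: "ground G = D" using ground_HD True by simp
    have e0: "edges G = {}" using nE gD in_ground(1)[of _ G] by blast
    have "D = Inr ` loops G" using gD e0 unfolding ground_def by auto
    moreover have "card (Inr ` loops G :: 'a element set) = card (loops G)" by (rule card_image) simp
    ultimately have l3: "card (loops G) = 3" using c3 by simp
    have fst_v: "fst l = v" if "l \<in> loops G" for l
    proof -
      have "Inr l \<in> D" using that gD in_ground(2)[of l G] by simp
      then have "v \<in> ends (Inr l)" by (rule allv)
      then show ?thesis by (cases l) simp
    qed
    have lv: "loops G \<subseteq> {v} \<times> UNIV"
    proof
      fix l assume "l \<in> loops G"
      then show "l \<in> {v} \<times> UNIV" using fst_v[of l] by (cases l) simp
    qed
    have "incident_verts (ground G) = {v}"
      using Y0 X gD unfolding X_def by simp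
    then have "is_K1_3 (drop_isolated G)" using e0 l3 lv unfolding is_K1_3_def drop_isolated_def by simp
    then show ?thesis using K by simp
  next
    case H: False
    show ?thesis
    proof (cases "D \<subseteq> range Inl")
      case False
      then obtain d where d: "d \<in> D" "d \<notin> range Inl" by auto
      then obtain l where "d = Inr l" by (cases d) auto
      then obtain j where j: "(v, j) \<in> loops G"
        using allv[OF d(1)] d ground_HD in_ground(2)[of l G] by (cases l) auto
      obtain d' y where d': "d' \<in> D" "y \<in> ends d'" "y \<in> Y" using D_meets_Y[OF H] unfolding incident_verts_def by auto
      have "d' \<in> range Inl" using d' allv[OF d'(1)] vY by (cases d') auto
      then obtain u where u: "u \<in> Y" "d' = Inl {v, u}" using edge[OF d'(1)] by auto
      have uG: "{v, u} \<in> edges G" using d' u ground_HD in_ground(1)[of _ G] by blast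
      obtain i where i: "(u, i) \<notin> loops G" using fresh_loop[OF simple] by blast
      have "lc.connected_set (insert (Inr (u, i)) {d \<in> ground G. v \<notin> ends d})"
        by (rule reconnect) (use u i in \<open>auto simp: wf_elements_def\<close>)
      then show ?thesis using admissible_node_loop[OF simple vG deg uG j i] by blast
    next
      case True
      obtain d1 d2 where d12: "d1 \<in> D" "d2 \<in> D" "d1 \<noteq> d2"
        using c3 by (metis card_3_iff insertI1 insertI2)
      obtain d3 where d3: "D = {d1, d2, d3}" "d3 \<noteq> d1" "d3 \<noteq> d2"
        by (rule third_element[OF c3 d12])
      obtain p where p: "p \<in> Y" "d1 = Inl {v, p}" using edge d12 True by blast
      obtain q where q: "q \<in> Y" "d2 = Inl {v, q}" using edge d12 True by blast
      obtain r where r: "r \<in> Y" "d3 = Inl {v, r}" using edge[of d3] d3 True by blast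
      have ne: "p \<noteq> q" "r \<noteq> p" "r \<noteq> q" using p q r d12 d3 by auto
      have pG: "{v, p} \<in> edges G" and qG: "{v, q} \<in> edges G"
        using d12 p q ground_HD in_ground(1)[of _ G] by blast+
      show ?thesis
      proof (cases "{p, q} \<in> edges G")
        case False
        have "lc.connected_set (insert (Inl {p, q}) {d \<in> ground G. v \<notin> ends d})"
          by (rule reconnect) (use p q ne False in \<open>auto simp: wf_elements_def\<close>)
        then show ?thesis using admissible_node_edge[OF simple vG deg pG qG ne(1) False] by blast
      next
        case pq: True
        have "Inl {p, q} \<in> {d \<in> ground G. v \<notin> ends d}" using pq p q vY by auto
        then have pqH: "Inl {p, q} \<in> H" using nonstar by simp
        then have "lc.connected_set (H \<union> D - {Inl {p, q}})"
          using edge_redundant[of v p q r] d3(1) p q r c3 vY ne by simp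
        then have "admissible_element G (Inl {p, q})"
          using admissible_element_iff[OF simple] pqH ground_HD by simp
        then show ?thesis by blast
      qed
    qed
  qed
qed

end

theorem theorem6p6:
  fixes G :: "'a looped_graph"
  assumes "looped_simple_graph G"
    and "balanced G"
    and "mlc_connected G"
    and "ground G \<noteq> {}"
    and "\<not> is_K1_3 (drop_isolated G)"
  shows "(\<exists>f. admissible_element G f) \<or> (\<exists>v. admissible_node G v)"
proof (cases "2 \<le> card (ground G)")
  case False
  have wf: "wf_elements (ground G)" by (rule wf_ground[OF assms(1)])
  then have "card (ground G) = 1"
    using False assms(4) card_0_eq[of "ground G"] unfolding wf_elements_def by linarith
  then obtain f where "ground G = {f}" by (rule card_1_singletonE)
  then have "admissible_element G f"
    unfolding admissible_element_iff[OF assms(1)] lc.connected_set_def by simp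
  then show ?thesis by blast
next
  case True
  have loops: "loops G \<noteq> {}" by (rule balanced_has_loop[OF assms(1,2) True])
  then obtain l where "Inr l \<in> ground G" by auto
  then obtain H B D C where lobe: "lobe H B D C" and S: "ground G = H \<union> D"
    using lobe_exists[OF _ wf_ground[OF assms(1)] _ True] assms(1,3) mlc_connected_iff by blast
  interpret lobe H B D C by (rule lobe)
  show ?thesis
  proof (cases "2 \<le> card D")
    case False
    \<comment> \<open>The ear is a single element, and deleting it leaves the connected set
      \<open>H\<close>.\<close>
    then have "card D = 1" using card_D by simp
    then obtain f where f: "D = {f}" by (rule card_1_singletonE)
    then have "ground G - {f} = H" using S disjoint by auto
    then have "admissible_element G f"
      unfolding admissible_element_iff[OF assms(1)] using full S f unfolding full_connected_def by auto
    then show ?thesis by blast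
  next
    case D2: True
    interpret graph_lobe H B D C G
      by unfold_locales (rule assms(1), rule assms(2), rule S, rule D2, rule loops)
    show ?thesis
    proof (cases "2 \<le> card X")
      case True
      interpret large_graph_lobe H B D C G by unfold_locales (rule True)
      show ?thesis using admissible_node_exists by blast
    next
      case False
      then have "card X = 1" using card_D D2 by linarith
      then obtain v where "X = {v}" by (rule card_1_singletonE)
      then show ?thesis using single_vertex assms(5) by blast
    qed
  qed
qed

end
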